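(* For any helper rates $R_e\ge R_d\ge0$, $\mathcal R_g^O(R_e,R_d,D)=\mathcal R(R_d,D)$.
   Context: Let $\mathcal X,\mathcal Y,\mathcal Z,\hat{\mathcal X}$ be finite alphabets, $d:\mathcal X\times\hat{\mathcal X}\to[0,\infty)$, and $(X_i,Y_i,Z_i)$ i.i.d. $\sim p(x,y)p(z|x)$ (Markov chain $Y-X-Z$). An $(n,M,M_e,M_d,D)$ code with different helper messages consists of helper encoders $f_e:\mathcal Y^n\to\{1,\dots,M_e\}$ (message to the source encoder) and $f_d:\mathcal Y^n\to\{1,\dots,M_d\}$ (message to the decoder), a source encoder $f:\mathcal X^n\times\{1,\dots,M_e\}\to\{1,\dots,M\}$, and a decoder that, using $f(X^n,f_e(Y^n))$, $f_d(Y^n)$ and the side information $Z^n$, outputs $\hat X^n$, with $\mathbb E[\frac1n\sum_i d(X_i,\hat X_i)]\le D$. $(R,R_e,R_d)$ is achievable if for every $\delta>0$ and large $n$ there exists an $(n,2^{n(R+\delta)},2^{n(R_e+\delta)},2^{n(R_d+\delta)},D+\delta)$ code; $\mathcal R_g^O(D)$ is the closure of the set of achievable triples, and $\mathcal R_g^O(R_e,R_d,D)=\{R:(R,R_e,R_d)\in\mathcal R_g^O(D)\}$. Further, $\mathcal R_{Y-X-Z}(D)$ is the set of pairs $(R,R_1)$ with $R_1\ge I(U;Y|Z)$ and $R\ge I(X;W|U,Z)$ for some finite-alphabet $U,W$ with joint distribution $p(x,y)p(z|x)p(u|y)p(w|x,u)$ and a function $\hat X(U,W,Z)$ with $\mathbb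 E\, d(X,\hat X(U,W,Z))\le D$, and $\mathcal R(R_1,D)=\{R:(R,R_1)\in\mathcal R_{Y-X-Z}(D)\}$. *)

theory Defs
  imports "HOL-Probability.Probability"
begin

definition ent :: "'a pmf \<Rightarrow> real" where
  "ent q = - (\<Sum>a\<in>set_pmf q. pmf q a * log 2 (pmf q a))"

definition cmi :: "'o pmf \<Rightarrow> ('o \<Rightarrow> 'a) \<Rightarrow> ('o \<Rightarrow> 'b) \<Rightarrow> ('o \<Rightarrow> 'c) \<Rightarrow> real" where
  "cmi J fA fB fC =
     ent (map_pmf (\<lambda>\<omega>. (fA \<omega>, fC \<omega>)) J) + ent (map_pmf (\<lambda>\<omega>. (fB \<omega>, fC \<omega>)) J)
     - ent (map_pmf (\<lambda>\<omega>. (fA \<omega>, fB \<omega>, fC \<omega>)) J) - ent (map_pmf fC J)"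

definition src :: "('x \<times> 'y) pmf \<Rightarrow> ('x \<Rightarrow> 'z pmf) \<Rightarrow> ('x \<times> 'y \<times> 'z) pmf" where
  "src pXY pZ = do { (x, y) \<leftarrow> pXY; z \<leftarrow> pZ x; return_pmf (x, y, z) }"

fun iid :: "nat \<Rightarrow> 'a pmf \<Rightarrow> 'a list pmf" where
  "iid 0 P = return_pmf []"
| "iid (Suc n) P = do { a \<leftarrow> P; as \<leftarrow> iid n P; return_pmf (a # as) }"

definition is_code ::
  "('x \<times> 'y) pmf \<Rightarrow> ('x \<Rightarrow> 'z pmf) \<Rightarrow> ('x \<Rightarrow> 'xh \<Rightarrow> real) \<Rightarrow>
   nat \<Rightarrow> nat \<Rightarrow> nat \<Rightarrow> nat \<Rightarrow> real \<Rightarrow> bool" where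
  "is_code pXY pZ d n M Me Md D \<longleftrightarrow>
    (\<exists>(fe :: 'y list \<Rightarrow> nat) (fd :: 'y list \<Rightarrow> nat) (f :: 'x list \<Rightarrow> nat \<Rightarrow> nat)
       (g :: nat \<Rightarrow> nat \<Rightarrow> 'z list \<Rightarrow> 'xh list).
      (\<forall>ys. length ys = n \<longrightarrow> fe ys \<in> {1..Me}) \<and>
      (\<forall>ys. length ys = n \<longrightarrow> fd ys \<in> {1..Md}) \<and>
      (\<forall>xs m. length xs = n \<longrightarrow> m \<in> {1..Me} \<longrightarrow> f xs m \<in> {1..M}) \<and>
      (\<forall>a b zs. length zs = n \<longrightarrow> length (g a b zs) = n) \<and>
      measure_pmf.expectation (iid n (src pXY pZ))
        (\<lambda>t. let xs = map fst t; ys = map (fst \<circ> snd) t; zs = map (snd \<circ> snd) t;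
                 xh = g (f xs (fe ys)) (fd ys) zs
             in (1 / real n) * (\<Sum>i<n. d (xs ! i) (xh ! i))) \<le> D)"

definition achievable ::
  "('x \<times> 'y) pmf \<Rightarrow> ('x \<Rightarrow> 'z pmf) \<Rightarrow> ('x \<Rightarrow> 'xh \<Rightarrow> real) \<Rightarrow>
   real \<Rightarrow> real \<Rightarrow> real \<Rightarrow> real \<Rightarrow> bool" where
  "achievable pXY pZ d D R R_e R_d \<longleftrightarrow>
    (\<forall>\<delta>>0. \<exists>N. \<forall>n\<ge>N. n > 0 \<and>
       (\<exists>M Me Md. real M \<le> 2 powr (real n * (R + \<delta>)) \<and>
                  real Me \<le> 2 powr (real n * (R_e + \<delta>)) \<and>
                  real Md \<le> 2 powr (real n * (R_d + \<delta>)) \<and>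
                  is_code pXY pZ d n M Me Md (D + \<delta>)))"

definition RgO_D ::
  "('x \<times> 'y) pmf \<Rightarrow> ('x \<Rightarrow> 'z pmf) \<Rightarrow> ('x \<Rightarrow> 'xh \<Rightarrow> real) \<Rightarrow> real \<Rightarrow> (real \<times> real \<times> real) set" where
  "RgO_D pXY pZ d D = closure {(R, R_e, R_d). achievable pXY pZ d D R R_e R_d}"

definition RgO ::
  "('x \<times> 'y) pmf \<Rightarrow> ('x \<Rightarrow> 'z pmf) \<Rightarrow> ('x \<Rightarrow> 'xh \<Rightarrow> real) \<Rightarrow> real \<Rightarrow> real \<Rightarrow> real \<Rightarrow> real set" where
  "RgO pXY pZ d R_e R_d D = {R. (R, R_e, R_d) \<in> RgO_D pXY pZ d D}"

text \<open>Auxiliary variables U, W take values in finite subsets of nat (any finite alphabet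
  embeds into nat). Joint law p(x,y) p(z|x) p(u|y) p(w|x,u).\<close>
definition joint5 ::
  "('x \<times> 'y) pmf \<Rightarrow> ('x \<Rightarrow> 'z pmf) \<Rightarrow> ('y \<Rightarrow> nat pmf) \<Rightarrow> ('x \<Rightarrow> nat \<Rightarrow> nat pmf)
   \<Rightarrow> ('x \<times> 'y \<times> 'z \<times> nat \<times> nat) pmf" where
  "joint5 pXY pZ qU qW = do { (x, y) \<leftarrow> pXY; z \<leftarrow> pZ x; u \<leftarrow> qU y; w \<leftarrow> qW x u;
                              return_pmf (x, y, z, u, w) }"

definition RYXZ ::
  "('x \<times> 'y) pmf \<Rightarrow> ('x \<Rightarrow> 'z pmf) \<Rightarrow> ('x \<Rightarrow> 'xh \<Rightarrow> real) \<Rightarrow> real \<Rightarrow> (real \<times> real) set" where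
  "RYXZ pXY pZ d D = {(R, R1). \<exists>(qU :: 'y \<Rightarrow> nat pmf) (qW :: 'x \<Rightarrow> nat \<Rightarrow> nat pmf)
       (xhat :: nat \<Rightarrow> nat \<Rightarrow> 'z \<Rightarrow> 'xh).
      finite (\<Union>y. set_pmf (qU y)) \<and> finite (\<Union>x u. set_pmf (qW x u)) \<and>
      (let J = joint5 pXY pZ qU qW;
           X = (\<lambda>(x,y,z,u,w). x); Y = (\<lambda>(x,y,z,u,w). y); Z = (\<lambda>(x,y,z,u,w). z);
           U = (\<lambda>(x,y,z,u,w). u); W = (\<lambda>(x,y,z,u,w). w)
       in R1 \<ge> cmi J U Y Z \<and>
          R \<ge> cmi J X W (\<lambda>\<omega>. (U \<omega>, Z \<omega>)) \<and>
          measure_pmf.expectation J (\<lambda>(x,y,z,u,w). d x (xhat u w z)) \<le> D)}"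

definition Rreg ::
  "('x \<times> 'y) pmf \<Rightarrow> ('x \<Rightarrow> 'z pmf) \<Rightarrow> ('x \<Rightarrow> 'xh \<Rightarrow> real) \<Rightarrow> real \<Rightarrow> real \<Rightarrow> real set" where
  "Rreg pXY pZ d R1 D = {R. (R, R1) \<in> RYXZ pXY pZ d D}"

end

theory Submission
  imports Defs "HOL-Real_Asymp.Real_Asymp"
begin

text \<open>
  \<^emph>\<open>Achievability.\<close> The helper sends the same message to the encoder and to the decoder, and all
  parties share independent standard exponential clocks, one per pair of a candidate codeword and
  a message. Selecting the pair that minimises clock divided by weight draws the pair with
  probability proportional to the weight, and two parties with weights \<open>p\<close> and \<open>q\<close> both select
  \<open>v\<close> with probability at least \<open>1 / (1 / p v + 1 / q v)\<close>. The helper uses the weights \<open>p(u|y) / Md\<close>,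
  the encoder and the decoder \<open>p(u|x)\<close> and \<open>p(u|z)\<close> restricted to the received message; given \<open>u\<close>, the
  same is done for \<open>w\<close> with \<open>p(w|x,u) / M\<close> and \<open>p(w|u,z)\<close>. The failure probability is bounded by
  likelihood ratios, and the weak law of large numbers turns these into \<open>I(U;Y|Z)\<close>,
  \<open>I(U;Y|X) \<le> I(U;Y|Z)\<close> and \<open>I(X;W|U,Z)\<close>.

  \<^emph>\<open>Converse.\<close> Put \<open>U i = (Td, X^(i-1), Y^(i-1), Z without Z i)\<close> and let \<open>W i\<close> be the map that sends a
  value of \<open>Z i\<close> to the reconstruction of the \<open>i\<close>-th letter. The chain rule gives the two rate bounds.
  The alphabet of \<open>W i\<close> is fixed and finite, and conditionally on \<open>U\<close> all quantities are continuous
  functions of the laws of \<open>Y\<close> and of \<open>W\<close> given \<open>X\<close>. Hence they average to points in the convex hull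
  of a compact set; it is compact, which permits \<open>\<delta> \<rightarrow> 0\<close>, and its points are finite convex
  combinations, which gives back a finite \<open>U\<close>.
\<close>

section \<open>Entropy of finitely supported laws\<close>

text \<open>In achievability the source encoder does not see Y, so it must recover the helper's
  codeword from the message just as the decoder does. The decoder is the bottleneck, since Y - X - Z
  makes X the better side information. Races replace typical sets and binning by one inequality for
  arbitrary laws; the number of messages appears only as a weight attached to copies of a codeword.

  In the converse the obstacle is that \<open>W i\<close> may depend on \<open>Y i\<close> even
  given \<open>(X i, U i)\<close>, because the encoder has read a message about the whole of Y^n.
  The law coming from a code therefore need not factor as p(u|y) p(w|x,u). The repair is to average
  the law of W over Y given (X,U): Z depends on X alone, so the laws of (U,Y,Z) and of (U,X,W,Z) do
  not change, and the rates and the distortion are functions of these two laws. The alphabet of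
  \<open>U i\<close> grows with n, so limits are taken among convex hull points instead of among
  laws of U. The law of Y is kept as a coordinate of these points because only its mean over U is
  prescribed.\<close>

definition eta :: "real \<Rightarrow> real" where
  "eta t = - t * log 2 t"

text \<open>Letters off the support contribute \<open>eta 0 = 0\<close>. A summation range that does
  not move with the law is what continuity and slicing over U require.\<close>

lemma ent_eq_sum:
  assumes "finite S" "set_pmf q \<subseteq> S"
  shows "ent q = (\<Sum>a\<in>S. eta (pmf q a))"
proof -
  have "(\<Sum>a\<in>set_pmf q. pmf q a * log 2 (pmf q a)) = (\<Sum>a\<in>S. pmf q a * log 2 (pmf q a))"
    using assms by (intro sum.mono_neutral_left) (auto simp: set_pmf_iff)
  then show ?thesis
    by (simp add: ent_def eta_def sum_negf)
qed

lemma prob_eq_sum: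
  assumes "finite (set_pmf J)"
  shows "measure_pmf.prob J A = (\<Sum>\<omega>\<in>set_pmf J \<inter> A. pmf J \<omega>)"
proof -
  have "measure_pmf.prob J A = measure_pmf.prob J (set_pmf J \<inter> A)"
    by (simp add: measure_Int_set_pmf Int_commute)
  also have "\<dots> = (\<Sum>\<omega>\<in>set_pmf J \<inter> A. pmf J \<omega>)"
    using assms by (intro measure_measure_pmf_finite) auto
  finally show ?thesis .
qed

text \<open>Writing every entropy as a mean over the same space \<open>J\<close> lets entropies of
  different maps be compared and combined point by point.\<close>

lemma ent_map_pmf:
  assumes fin: "finite (set_pmf J)"
  shows "ent (map_pmf f J) =
    - (\<Sum>\<omega>\<in>set_pmf J. pmf J \<omega> * log 2 (pmf (map_pmf f J) (f \<omega>)))"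
proof -
  have "(\<Sum>\<omega>\<in>set_pmf J. pmf J \<omega> * log 2 (pmf (map_pmf f J) (f \<omega>))) =
    (\<Sum>a\<in>f ` set_pmf J. \<Sum>\<omega> | \<omega> \<in> set_pmf J \<and> f \<omega> = a.
       pmf J \<omega> * log 2 (pmf (map_pmf f J) (f \<omega>)))"
    by (rule sum.image_gen[OF fin])
  also have "\<dots> = (\<Sum>a\<in>f ` set_pmf J. pmf (map_pmf f J) a * log 2 (pmf (map_pmf f J) a))"
  proof (intro sum.cong refl)
    fix a
    have "pmf (map_pmf f J) a = (\<Sum>\<omega> | \<omega> \<in> set_pmf J \<and> f \<omega> = a. pmf J \<omega>)"
      unfolding pmf_map prob_eq_sum[OF fin] by (intro sum.cong) auto
    then show "(\<Sum>\<omega> | \<omega> \<in> set_pmf J \<and> f \<omega> = a. pmf J \<omega> * log 2 (pmf (map_pmf f J) (f \<omega>)))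
      = pmf (map_pmf f J) a * log 2 (pmf (map_pmf f J) a)"
      by (simp add: sum_distrib_right)
  qed
  finally show ?thesis
    by (simp add: ent_def)
qed

lemma pmf_map_pos: "\<omega> \<in> set_pmf J \<Longrightarrow> pmf (map_pmf f J) (f \<omega>) > 0"
  by (rule pmf_positive) simp

lemma pmf_map_mono:
  assumes "\<omega> \<in> set_pmf J"
    and "\<And>\<omega>'. \<omega>' \<in> set_pmf J \<Longrightarrow> f \<omega>' = f \<omega> \<Longrightarrow> g \<omega>' = g \<omega>"
  shows "pmf (map_pmf f J) (f \<omega>) \<le> pmf (map_pmf g J) (g \<omega>)"
proof -
  have "measure_pmf.prob J (f -` {f \<omega>}) = measure_pmf.prob J (f -` {f \<omega>} \<inter> set_pmf J)"
    by (simp add: measure_Int_set_pmf)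
  also have "\<dots> \<le> measure_pmf.prob J (g -` {g \<omega>})"
    by (intro measure_pmf.finite_measure_mono subsetI) (use assms in blast, simp)
  finally show ?thesis by (simp only: pmf_map)
qed

text \<open>If \<open>f\<close> determines \<open>g\<close> on the support, each fibre of
  \<open>f\<close> lies in a fibre of \<open>g\<close>, so the logarithms compare pointwise.\<close>

lemma ent_map_mono:
  assumes fin: "finite (set_pmf J)"
    and "\<And>\<omega> \<omega>'. \<omega> \<in> set_pmf J \<Longrightarrow> \<omega>' \<in> set_pmf J \<Longrightarrow> f \<omega> = f \<omega>' \<Longrightarrow> g \<omega> = g \<omega>'"
  shows "ent (map_pmf g J) \<le> ent (map_pmf f J)"
  unfolding ent_map_pmf[OF fin] neg_le_iff_le
proof (intro sum_mono mult_left_mono)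
  fix \<omega> assume w: "\<omega> \<in> set_pmf J"
  have "pmf (map_pmf f J) (f \<omega>) \<le> pmf (map_pmf g J) (g \<omega>)"
    using assms(2) w by (intro pmf_map_mono) blast+
  then show "log 2 (pmf (map_pmf f J) (f \<omega>)) \<le> log 2 (pmf (map_pmf g J) (g \<omega>))"
    using pmf_map_pos[OF w, of f] by simp
qed auto

lemma ent_map_cong:
  assumes "finite (set_pmf J)"
    and "\<And>\<omega> \<omega>'. \<omega> \<in> set_pmf J \<Longrightarrow> \<omega>' \<in> set_pmf J \<Longrightarrow> f \<omega> = f \<omega>' \<longleftrightarrow> g \<omega> = g \<omega>'"
  shows "ent (map_pmf f J) = ent (map_pmf g J)"
  by (intro antisym ent_map_mono) (use assms in blast)+

lemma ent_nonneg:
  assumes "finite (set_pmf q)"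
  shows "ent q \<ge> 0"
proof -
  have "(\<Sum>a\<in>set_pmf q. pmf q a * log 2 (pmf q a)) \<le> 0"
    by (intro sum_nonpos mult_nonneg_nonpos) (auto simp: pmf_le_1 pmf_positive)
  then show ?thesis by (simp add: ent_def)
qed

lemma log2_le: "x > 0 \<Longrightarrow> log 2 x \<le> (x - 1) / ln 2"
  by (simp add: log_def divide_right_mono ln_le_minus_one)

text \<open>The negated information is the mean of \<open>log 2 r\<close> with r = p(a,c) p(b,c) /
  (p(a,b,c) p(c)). By log t \<le> (t - 1) / ln 2 it suffices that r has mean at most 1.\<close>

lemma cmi_nonneg:
  assumes fin: "finite (set_pmf J)"
  shows "cmi J fA fB fC \<ge> 0"
proof -
  let ?ac = "map_pmf (\<lambda>\<omega>. (fA \<omega>, fC \<omega>)) J" and ?bc = "map_pmf (\<lambda>\<omega>. (fB \<omega>, fC \<omega>)) J"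
    and ?abc = "map_pmf (\<lambda>\<omega>. (fA \<omega>, fB \<omega>, fC \<omega>)) J" and ?c = "map_pmf fC J"
  define r where "r = (\<lambda>\<omega>. pmf ?ac (fA \<omega>, fC \<omega>) * pmf ?bc (fB \<omega>, fC \<omega>) /
      (pmf ?abc (fA \<omega>, fB \<omega>, fC \<omega>) * pmf ?c (fC \<omega>)))"
  let ?S = "set_pmf J"
  have pos: "pmf ?ac (fA \<omega>, fC \<omega>) > 0" "pmf ?bc (fB \<omega>, fC \<omega>) > 0"
    "pmf ?abc (fA \<omega>, fB \<omega>, fC \<omega>) > 0" "pmf ?c (fC \<omega>) > 0" if "\<omega> \<in> ?S" for \<omega>
    by (rule pmf_positive; use that in simp)+
  have "- cmi J fA fB fC = (\<Sum>\<omega>\<in>?S. pmf J \<omega> * log 2 (r \<omega>))"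
  proof -
    have "(\<Sum>\<omega>\<in>?S. pmf J \<omega> * log 2 (r \<omega>)) =
      (\<Sum>\<omega>\<in>?S. pmf J \<omega> * log 2 (pmf ?ac (fA \<omega>, fC \<omega>)) + pmf J \<omega> * log 2 (pmf ?bc (fB \<omega>, fC \<omega>))
        - pmf J \<omega> * log 2 (pmf ?abc (fA \<omega>, fB \<omega>, fC \<omega>)) - pmf J \<omega> * log 2 (pmf ?c (fC \<omega>)))"
    proof (intro sum.cong refl)
      fix \<omega> assume w: "\<omega> \<in> ?S"
      note p = pos[OF w]
      have "log 2 (r \<omega>) = log 2 (pmf ?ac (fA \<omega>, fC \<omega>)) + log 2 (pmf ?bc (fB \<omega>, fC \<omega>))
        - (log 2 (pmf ?abc (fA \<omega>, fB \<omega>, fC \<omega>)) + log 2 (pmf ?c (fC \<omega>)))"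
        unfolding r_def using p by (simp add: log_divide log_mult)
      then show "pmf J \<omega> * log 2 (r \<omega>) = pmf J \<omega> * log 2 (pmf ?ac (fA \<omega>, fC \<omega>)) + pmf J \<omega> * log 2 (pmf ?bc (fB \<omega>, fC \<omega>))
        - pmf J \<omega> * log 2 (pmf ?abc (fA \<omega>, fB \<omega>, fC \<omega>)) - pmf J \<omega> * log 2 (pmf ?c (fC \<omega>))"
        by (simp only: ring_distribs diff_diff_add)
    qed
    then show ?thesis
      unfolding cmi_def ent_map_pmf[OF fin] by (simp only: sum_subtractf sum.distrib)
  qed
  also have "\<dots> \<le> (\<Sum>\<omega>\<in>?S. pmf J \<omega> * ((r \<omega> - 1) / ln 2))"
    using pos by (intro sum_mono mult_left_mono log2_le) (auto simp: r_def)
  also have "\<dots> = ((\<Sum>\<omega>\<in>?S. pmf J \<omega> * r \<omega>) - 1) / ln 2"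
    using fin by (simp add: sum_subtractf sum_pmf_eq_1 right_diff_distrib sum_divide_distrib[symmetric])
  also have "(\<Sum>\<omega>\<in>?S. pmf J \<omega> * r \<omega>) \<le> 1"
  proof -
    let ?T = "\<lambda>\<omega>. (fA \<omega>, fB \<omega>, fC \<omega>)"
    have "(\<Sum>\<omega>\<in>?S. pmf J \<omega> * r \<omega>) =
      (\<Sum>t\<in>?T ` ?S. \<Sum>\<omega> | \<omega> \<in> ?S \<and> ?T \<omega> = t. pmf J \<omega> * r \<omega>)"
      by (rule sum.image_gen[OF fin])
    also have "\<dots> = (\<Sum>(a,b,c)\<in>?T ` ?S. pmf ?ac (a,c) * pmf ?bc (b,c) / pmf ?c c)"
    proof (intro sum.cong refl, clarify)
      fix a b c \<omega>0 assume w0: "\<omega>0 \<in> ?S"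
      have e: "pmf ?abc (?T \<omega>0) = (\<Sum>\<omega> | \<omega> \<in> ?S \<and> ?T \<omega> = ?T \<omega>0. pmf J \<omega>)"
        unfolding pmf_map prob_eq_sum[OF fin] by (intro sum.cong) auto
      have "(\<Sum>\<omega> | \<omega> \<in> ?S \<and> ?T \<omega> = ?T \<omega>0. pmf J \<omega> * r \<omega>) =
        (\<Sum>\<omega> | \<omega> \<in> ?S \<and> ?T \<omega> = ?T \<omega>0. pmf J \<omega> * r \<omega>0)"
        by (intro sum.cong refl) (auto simp: r_def)
      also have "\<dots> = pmf ?abc (?T \<omega>0) * r \<omega>0"
        unfolding e by (simp add: sum_distrib_right)
      also have "\<dots> = pmf ?ac (fA \<omega>0, fC \<omega>0) * pmf ?bc (fB \<omega>0, fC \<omega>0) / pmf ?c (fC \<omega>0)"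
        using pos[OF w0] by (simp add: r_def)
      finally show "(\<Sum>\<omega> | \<omega> \<in> ?S \<and> ?T \<omega> = ?T \<omega>0. pmf J \<omega> * r \<omega>) = \<dots>" .
    qed
    \<comment> \<open>Triples that never occur jointly are added here with nonnegative terms;
      afterwards the sum factors for each fixed c.\<close>
    also have "\<dots> \<le> (\<Sum>(a,b,c)\<in>fA ` ?S \<times> fB ` ?S \<times> fC ` ?S. pmf ?ac (a,c) * pmf ?bc (b,c) / pmf ?c c)"
      using fin by (intro sum_mono2) (auto intro!: mult_nonneg_nonneg divide_nonneg_nonneg)
    also have "\<dots> = (\<Sum>c\<in>fC ` ?S. (\<Sum>a\<in>fA ` ?S. pmf ?ac (a,c)) * (\<Sum>b\<in>fB ` ?S. pmf ?bc (b,c)) / pmf ?c c)"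
    proof -
      have "(\<Sum>(a,b,c)\<in>fA ` ?S \<times> fB ` ?S \<times> fC ` ?S. pmf ?ac (a,c) * pmf ?bc (b,c) / pmf ?c c) =
        (\<Sum>a\<in>fA ` ?S. \<Sum>b\<in>fB ` ?S. \<Sum>c\<in>fC ` ?S. pmf ?ac (a,c) * pmf ?bc (b,c) / pmf ?c c)"
        by (simp add: sum.cartesian_product)
      also have "\<dots> = (\<Sum>c\<in>fC ` ?S. \<Sum>a\<in>fA ` ?S. \<Sum>b\<in>fB ` ?S. pmf ?ac (a,c) * pmf ?bc (b,c) / pmf ?c c)"
        by (subst sum.swap[of _ "fC ` ?S" "fB ` ?S"], subst sum.swap[of _ "fC ` ?S" "fA ` ?S"]) simp
      finally show ?thesis
        by (simp add: sum_product sum_divide_distrib)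
    qed
    also have "\<dots> = (\<Sum>c\<in>fC ` ?S. pmf ?c c)"
    proof (intro sum.cong refl)
      fix c assume c: "c \<in> fC ` ?S"
      have m: "(\<Sum>a\<in>f ` ?S. pmf (map_pmf (\<lambda>\<omega>. (f \<omega>, fC \<omega>)) J) (a,c)) = pmf ?c c" for f :: "'a \<Rightarrow> 'e"
      proof -
        have "pmf (map_pmf (\<lambda>\<omega>. (f \<omega>, fC \<omega>)) J) (a,c) = (\<Sum>\<omega>\<in>{\<omega>\<in>{\<omega>\<in>?S. fC \<omega> = c}. f \<omega> = a}. pmf J \<omega>)" for a
          unfolding pmf_map prob_eq_sum[OF fin] by (intro sum.cong) auto
        moreover have "(\<Sum>a\<in>f ` ?S. \<Sum>\<omega>\<in>{\<omega>\<in>{\<omega>\<in>?S. fC \<omega> = c}. f \<omega> = a}. pmf J \<omega>) = (\<Sum>\<omega>\<in>{\<omega>\<in>?S. fC \<omega> = c}. pmf J \<omega>)"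
          using fin by (intro sum.group) auto
        moreover have "pmf ?c c = (\<Sum>\<omega>\<in>{\<omega>\<in>?S. fC \<omega> = c}. pmf J \<omega>)"
          unfolding pmf_map prob_eq_sum[OF fin] by (intro sum.cong) auto
        ultimately show ?thesis by simp
      qed
      show "(\<Sum>a\<in>fA ` ?S. pmf ?ac (a,c)) * (\<Sum>b\<in>fB ` ?S. pmf ?bc (b,c)) / pmf ?c c = pmf ?c c"
        unfolding m using c pos(4) by (auto simp del: set_map_pmf)
    qed
    also have "\<dots> = 1"
      using fin by (intro sum_pmf_eq_1) auto
    finally show ?thesis .
  qed
  finally show ?thesis by (simp add: divide_right_mono)
qed

text \<open>The same tangent bound for the logarithm, applied to the ratio of the uniform law on
  \<open>S\<close> to \<open>q\<close>.\<close>

lemma ent_le_log_card: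
  assumes "finite S" "set_pmf q \<subseteq> S"
  shows "ent q \<le> log 2 (card S)"
proof -
  have c: "card S > 0"
    using assms set_pmf_not_empty[of q] by (simp add: card_gt_0_iff) blast
  have fin: "finite (set_pmf q)" using assms finite_subset by blast
  have "ent q - log 2 (card S) = (\<Sum>a\<in>set_pmf q. pmf q a * log 2 (1 / (pmf q a * card S)))"
  proof -
    have "(\<Sum>a\<in>set_pmf q. pmf q a * log 2 (1 / (pmf q a * card S))) =
      (\<Sum>a\<in>set_pmf q. - (pmf q a * log 2 (pmf q a)) - pmf q a * log 2 (card S))"
      using c by (intro sum.cong) (auto simp: log_divide log_mult pmf_positive algebra_simps set_pmf_iff)
    also have "\<dots> = ent q - log 2 (card S)"
      using fin by (simp add: sum_subtractf ent_def sum_negf sum_distrib_right[symmetric] sum_pmf_eq_1)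
    finally show ?thesis by simp
  qed
  also have "\<dots> \<le> (\<Sum>a\<in>set_pmf q. pmf q a * ((1 / (pmf q a * card S) - 1) / ln 2))"
    using c by (intro sum_mono mult_left_mono log2_le) (auto simp: pmf_positive)
  also have "\<dots> = (\<Sum>a\<in>set_pmf q. (1 / card S - pmf q a) / ln 2)"
    using c by (intro sum.cong) (auto simp: field_simps set_pmf_iff)
  also have "\<dots> = (card (set_pmf q) / card S - 1) / ln 2"
    using fin by (simp add: sum_divide_distrib[symmetric] sum_subtractf sum_pmf_eq_1)
  also have "\<dots> \<le> 0"
    using c assms by (auto simp: divide_le_0_iff card_mono)
  finally show ?thesis by simp
qed

lemma ent_pair_pmf:
  assumes "finite (set_pmf A)" "finite (set_pmf B)"
  shows "ent (pair_pmf A B) = ent A + ent B"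
proof -
  have "ent (pair_pmf A B) =
    - (\<Sum>a\<in>set_pmf A. \<Sum>b\<in>set_pmf B. pmf A a * pmf B b * (log 2 (pmf A a) + log 2 (pmf B b)))"
    by (auto simp: ent_def sum.cartesian_product pmf_pair log_mult pmf_positive intro!: sum.cong)
  also have "(\<Sum>a\<in>set_pmf A. \<Sum>b\<in>set_pmf B. pmf A a * pmf B b * (log 2 (pmf A a) + log 2 (pmf B b)))
    = (\<Sum>a\<in>set_pmf A. pmf A a * log 2 (pmf A a) * (\<Sum>b\<in>set_pmf B. pmf B b)
        + pmf A a * (\<Sum>b\<in>set_pmf B. pmf B b * log 2 (pmf B b)))"
    by (simp add: algebra_simps sum.distrib sum_distrib_left sum_distrib_right)
  also have "\<dots> = - ent A - ent B"
    using assms by (simp add: sum_pmf_eq_1 sum.distrib ent_def flip: sum_distrib_right)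
  finally show ?thesis by simp
qed

section \<open>One-shot coding by exponential races\<close>

abbreviation exp_measure :: "real measure" where
  "exp_measure \<equiv> density lborel (exponential_density 1)"

lemma prob_space_exp_measure: "prob_space exp_measure"
  by (rule prob_space_exponential_density) simp

lemma emeasure_exp_measure_greaterThan:
  assumes "0 \<le> a"
  shows "emeasure exp_measure {a<..} = ennreal (exp (- a))"
proof -
  interpret prob_space exp_measure by (rule prob_space_exp_measure)
  have "distributed exp_measure lborel (\<lambda>x. x) (exponential_density 1)"
    by (auto simp: distributed_def distr_id2 sets_density)
  from exponential_distributedD_gt[OF this assms]
  have "prob {a<..} = exp (- a)"
    by (simp add: greaterThan_def)
  then show ?thesis by (simp add: emeasure_eq_measure)
qed

text \<open>Given e v = y, the other clocks exceed their thresholds independently, with total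
  probability exp(- L y), where L is the sum of the \<open>lam w\<close>. Averaging over the
  exponential variable y gives 1 / (1 + L).\<close>

lemma exponential_race:
  fixes lam :: "'v \<Rightarrow> real"
  assumes fin: "finite V" and v: "v \<in> V" and lam: "\<And>w. w \<in> V \<Longrightarrow> lam w \<ge> 0"
  defines "M \<equiv> PiM V (\<lambda>_. exp_measure)"
  defines "A \<equiv> {e \<in> space M. \<forall>w\<in>V - {v}. lam w * e v < e w}"
  shows "A \<in> sets M" and "measure M A = 1 / (1 + (\<Sum>w\<in>V - {v}. lam w))"
proof -
  interpret E: prob_space exp_measure by (rule prob_space_exp_measure)
  interpret product_sigma_finite "\<lambda>_::'v. exp_measure" by standard
  show A: "A \<in> sets M"
  proof -
    have c: "(\<lambda>e. e w) \<in> borel_measurable M" if "w \<in> V" for w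
      using measurable_component_singleton[OF that, of "\<lambda>_. exp_measure"]
      unfolding M_def by (simp add: measurable_def)
    have "{e \<in> space M. lam w * e v < e w} \<in> sets M" if "w \<in> V" for w
      using c[OF that] c[OF v] by measurable
    then show ?thesis
      unfolding A_def using fin by (intro sets.sets_Collect_finite_All) auto
  qed
  define V' where "V' = V - {v}"
  have V: "V = insert v V'" "v \<notin> V'" "finite V'" using v fin by (auto simp: V'_def)
  define L where "L = (\<Sum>w\<in>V'. lam w)"
  have L: "L \<ge> 0" unfolding L_def using lam V by (intro sum_nonneg) auto
  have inner: "(\<integral>\<^sup>+ e. indicator A (e(v := y)) \<partial>PiM V' (\<lambda>_. exp_measure)) = ennreal (exp (- L * y))"
    if y: "0 \<le> y" for y
  proof -
    have "(\<integral>\<^sup>+ e. indicator A (e(v := y)) \<partial>PiM V' (\<lambda>_. exp_measure)) =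
      (\<integral>\<^sup>+ e. indicator (PiE V' (\<lambda>w. {lam w * y<..})) e \<partial>PiM V' (\<lambda>_. exp_measure))"
    proof (intro nn_integral_cong)
      fix e assume e: "e \<in> space (PiM V' (\<lambda>_. exp_measure))"
      have "e(v := y) \<in> A \<longleftrightarrow> e \<in> PiE V' (\<lambda>w. {lam w * y<..})"
        using e V unfolding A_def M_def V'_def[symmetric]
        by (auto simp: space_PiM PiE_def extensional_def)
      then show "indicator A (e(v := y)) = (indicator (PiE V' (\<lambda>w. {lam w * y<..})) e :: ennreal)"
        by (simp add: indicator_def)
    qed
    also have "\<dots> = emeasure (PiM V' (\<lambda>_. exp_measure)) (PiE V' (\<lambda>w. {lam w * y<..}))"
      using V by (intro nn_integral_indicator sets_PiM_I_finite) auto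
    also have "\<dots> = (\<Prod>w\<in>V'. emeasure exp_measure {lam w * y<..})"
      using V by (intro emeasure_PiM) auto
    also have "\<dots> = (\<Prod>w\<in>V'. ennreal (exp (- (lam w * y))))"
      using V lam y by (intro prod.cong refl emeasure_exp_measure_greaterThan) auto
    also have "\<dots> = ennreal (exp (- L * y))"
      using V by (simp add: prod_ennreal exp_sum[symmetric] L_def sum_distrib_right sum_negf)
    finally show ?thesis .
  qed
  have "emeasure M A = (\<integral>\<^sup>+ e. indicator A e \<partial>M)"
    using A by simp
  also have "\<dots> = (\<integral>\<^sup>+ y. (\<integral>\<^sup>+ e. indicator A (e(v := y)) \<partial>PiM V' (\<lambda>_. exp_measure)) \<partial>exp_measure)"
    using A V unfolding M_def V(1)
    by (intro product_nn_integral_insert_rev) auto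
  also have "\<dots> = (\<integral>\<^sup>+ y. ennreal (exp (- L * y)) \<partial>exp_measure)"
    using inner by (intro nn_integral_cong_AE) (auto simp: AE_density exponential_density_def intro!: AE_I2)
  also have "\<dots> = (\<integral>\<^sup>+ y. ennreal (exponential_density 1 y) * ennreal (exp (- L * y)) \<partial>lborel)"
    by (intro nn_integral_density) auto
  \<comment> \<open>exp(-y) exp(-L y) is, up to the factor 1 / (1 + L), the exponential density of
    rate 1 + L, whose integral is 1.\<close>
  also have "\<dots> = (\<integral>\<^sup>+ y. ennreal (1 / (1 + L)) * ennreal (exponential_density (1 + L) y) \<partial>lborel)"
  proof (intro nn_integral_cong)
    fix y :: real
    show "ennreal (exponential_density 1 y) * ennreal (exp (- L * y)) =
      ennreal (1 / (1 + L)) * ennreal (exponential_density (1 + L) y)"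
    proof (cases "y < 0")
      case True
      then show ?thesis by (simp add: exponential_density_def)
    next
      case False
      then have "exponential_density 1 y * exp (- L * y) = 1 / (1 + L) * exponential_density (1 + L) y"
        using L by (simp add: exponential_density_def field_simps exp_add[symmetric])
      then show ?thesis using L
        by (simp only: ennreal_mult'[symmetric] exponential_density_nonneg) (simp add: ennreal_mult'[symmetric])
    qed
  qed
  also have "\<dots> = ennreal (1 / (1 + L)) * (\<integral>\<^sup>+ y. ennreal (exponential_density (1 + L) y) \<partial>lborel)"
    by (intro nn_integral_cmult) auto
  also have "(\<integral>\<^sup>+ y. ennreal (exponential_density (1 + L) y) \<partial>lborel) = 1"
  proof -
    interpret P: prob_space "density lborel (exponential_density (1 + L))"
      using L by (intro prob_space_exponential_density) simp
    show ?thesis using P.emeasure_space_1 by (simp add: emeasure_density)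
  qed
  finally have "emeasure M A = ennreal (1 / (1 + L))" by simp
  then show "measure M A = 1 / (1 + (\<Sum>w\<in>V - {v}. lam w))"
    using L by (simp add: measure_def L_def V'_def)
qed

section \<open>Simultaneous races of several parties on common clocks\<close>

definition win :: "'v set \<Rightarrow> ('v \<Rightarrow> real) \<Rightarrow> ('v \<Rightarrow> real) \<Rightarrow> 'v \<Rightarrow> bool" where
  "win V p e v \<longleftrightarrow> v \<in> V \<and> p v > 0 \<and> (\<forall>w\<in>V - {v}. p w * e v < p v * e w)"

lemma win_unique: "win V p e v \<Longrightarrow> win V p e w \<Longrightarrow> v = w"
  unfolding win_def by (metis DiffI less_asym singletonD)

lemma some_win_eq: "win V p e v \<Longrightarrow> (SOME v. win V p e v) = v"
  by (metis someI win_unique)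

text \<open>All parties pick \<open>v\<close> as soon as \<open>v\<close> wins one harder race, in
  which every competitor gets its largest relative weight among the parties. Bounding that maximum
  by the sum over the parties turns the winning probability into a harmonic expression.\<close>

lemma matching_lower_bound:
  fixes p :: "'i \<Rightarrow> 'v \<Rightarrow> real"
  assumes fin: "finite V" "finite I" and I: "I \<noteq> {}" and v: "v \<in> V"
    and nonneg: "\<And>i w. i \<in> I \<Longrightarrow> p i w \<ge> 0" and pos: "\<And>i. i \<in> I \<Longrightarrow> p i v > 0"
    and one: "\<And>i. i \<in> I \<Longrightarrow> (\<Sum>w\<in>V. p i w) = 1"
  defines "M \<equiv> PiM V (\<lambda>_. exp_measure)"
  defines "A \<equiv> {e \<in> space M. \<forall>i\<in>I. win V (p i) e v}"
  shows "A \<in> sets M" and "measure M A \<ge> 1 / (\<Sum>i\<in>I. 1 / p i v)"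
proof -
  define lam where "lam w = (MAX i\<in>I. p i w / p i v)" for w
  have lam_ge: "p i w / p i v \<le> lam w" if "i \<in> I" for i w
    unfolding lam_def using fin that by (intro Max_ge) auto
  have lam_in: "\<exists>i\<in>I. lam w = p i w / p i v" for w
  proof -
    have "lam w \<in> (\<lambda>i. p i w / p i v) ` I"
      unfolding lam_def using fin I by (intro Max_in) auto
    then show ?thesis by auto
  qed
  have lam0: "lam w \<ge> 0" for w
    using lam_in[of w] nonneg pos by (auto simp: less_imp_le)
  have lam_le: "lam w \<le> (\<Sum>i\<in>I. p i w / p i v)" for w
    using lam_in[of w] nonneg pos fin
    by (auto intro!: member_le_sum simp: less_imp_le)
  have ae: "AE x in exp_measure. 0 \<le> x"
    by (auto simp: AE_density exponential_density_def intro!: AE_I2)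
  let ?B = "{e \<in> space M. \<forall>w\<in>V - {v}. lam w * e v < e w}"
  have eq: "win V (p i) e v \<longleftrightarrow> (\<forall>w\<in>V - {v}. p i w / p i v * e v < e w)" if "i \<in> I" for i e
    using pos[OF that] v unfolding win_def by (auto simp: field_simps)
  have meas1: "{e \<in> space M. win V (p i) e v} \<in> sets M" if "i \<in> I" for i
    unfolding eq[OF that] M_def using fin v nonneg pos that
    by (intro exponential_race(1)) (auto simp: less_imp_le)
  then show A: "A \<in> sets M"
    unfolding A_def using fin by (intro sets.sets_Collect_finite_All) auto
  \<comment> \<open>Replacing \<open>p i w / p i v\<close> by the larger \<open>lam w\<close> is
    sound only when \<open>e v\<close> is nonnegative, which holds almost surely since the clocks
    live on the whole real line.\<close>
  interpret M: prob_space M unfolding M_def by (rule prob_space_PiM) (rule prob_space_exp_measure)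
  have aeN: "AE e in M. 0 \<le> e v"
    unfolding M_def using v prob_space_exp_measure ae by (intro AE_PiM_component) auto
  have B: "?B \<in> sets M" "measure M ?B = 1 / (1 + (\<Sum>w\<in>V - {v}. lam w))"
    unfolding M_def using fin v lam0 by (intro exponential_race; auto)+
  have "measure M ?B \<le> measure M A"
  proof (rule M.finite_measure_mono_AE[OF _ A])
    show "AE e in M. e \<in> ?B \<longrightarrow> e \<in> A"
      using aeN
    proof (eventually_elim, intro impI)
      fix e assume e0: "0 \<le> e v" and e: "e \<in> ?B"
      have "p i w / p i v * e v < e w" if "i \<in> I" "w \<in> V - {v}" for i w
      proof -
        have "lam w * e v < e w" using e that by blast
        then show ?thesis
          using mult_right_mono[OF lam_ge[OF that(1), of w] e0] by linarith
      qed
      then show "e \<in> A" using e eq by (auto simp: A_def)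
    qed
  qed
  moreover have "1 + (\<Sum>w\<in>V - {v}. lam w) \<le> (\<Sum>i\<in>I. 1 / p i v)"
  proof -
    have "(\<Sum>w\<in>V - {v}. lam w) \<le> (\<Sum>w\<in>V - {v}. \<Sum>i\<in>I. p i w / p i v)"
      by (intro sum_mono lam_le)
    also have "\<dots> = (\<Sum>i\<in>I. \<Sum>w\<in>V - {v}. p i w / p i v)" by (rule sum.swap)
    also have "\<dots> = (\<Sum>i\<in>I. 1 / p i v - 1)"
    proof (intro sum.cong refl)
      fix i assume i: "i \<in> I"
      have "(\<Sum>w\<in>V - {v}. p i w) = 1 - p i v"
        using one[OF i] fin v by (simp add: sum_diff1)
      then show "(\<Sum>w\<in>V - {v}. p i w / p i v) = 1 / p i v - 1"
        using pos[OF i] by (simp add: sum_divide_distrib[symmetric] diff_divide_distrib)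
    qed
    also have "\<dots> = (\<Sum>i\<in>I. 1 / p i v) - card I" by (simp add: sum_subtractf)
    \<comment> \<open>There is at least one party, and this pays for the 1 in 1 + sum of
      \<open>lam\<close>.\<close>
    also have "\<dots> \<le> (\<Sum>i\<in>I. 1 / p i v) - 1"
      using fin I by (simp add: Suc_le_eq card_gt_0_iff)
    finally show ?thesis by simp
  qed
  ultimately show "measure M A \<ge> 1 / (\<Sum>i\<in>I. 1 / p i v)"
    unfolding B(2) using lam0
    by (smt (verit) frac_le sum_nonneg zero_less_one)
qed

lemma (in prob_space) exists_le_expectation:
  fixes X :: "'a \<Rightarrow> real"
  assumes "integrable M X"
  shows "\<exists>\<omega>\<in>space M. X \<omega> \<le> expectation X"
proof (rule ccontr)
  assume "\<not> ?thesis"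
  then have "AE \<omega> in M. expectation X < X \<omega>" by (intro AE_I2) (auto simp: not_le)
  from expectation_greater[OF assms this] show False by simp
qed

lemma one_minus_inverse_le:
  fixes a :: real
  assumes "a \<ge> 0"
  shows "1 - 1 / (1 + a) \<le> min 1 a"
proof -
  have "1 - 1 / (1 + a) = a / (1 + a)" using assms by (simp add: field_simps)
  also have "\<dots> \<le> min 1 a"
    using assms by (simp add: divide_le_eq) (simp add: algebra_simps)
  finally show ?thesis .
qed

lemma expectation_eq_sum:
  fixes f :: "'a \<Rightarrow> real"
  assumes "finite (set_pmf p)"
  shows "measure_pmf.expectation p f = (\<Sum>a\<in>set_pmf p. pmf p a * f a)"
  using assms by (subst integral_measure_pmf[of "set_pmf p"]) auto

lemma sum_fst_times:
  fixes h :: "'a \<Rightarrow> real"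
  shows "(\<Sum>v\<in>Q \<times> {1..N::nat}. h (fst v)) = (\<Sum>u\<in>Q. N * h u)"
proof -
  have "(\<Sum>v\<in>Q \<times> {1..N}. h (fst v)) = (\<Sum>(u, m)\<in>Q \<times> {1..N}. h u)"
    by (simp add: case_prod_beta)
  then show ?thesis by (simp flip: sum.cartesian_product)
qed

text \<open>Agreement of all parties in both races reproduces the ideal reconstruction, and any
  disagreement costs at most \<open>dmax\<close>. Each of the three error terms is a likelihood
  ratio divided by a number of messages, truncated at 1. The support conditions make the
  denominators positive. The clocks are fixed at the end by averaging.\<close>

lemma one_shot_coding:
  fixes S :: "('x \<times> 'y \<times> 'z) pmf" and A :: "'y \<Rightarrow> 'u pmf" and B :: "'x \<Rightarrow> 'u pmf"
    and C :: "'z \<Rightarrow> 'u pmf" and E :: "'x \<Rightarrow> 'u \<Rightarrow> 'w pmf" and F :: "'u \<Rightarrow> 'z \<Rightarrow> 'w pmf"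
    and dst :: "'x \<Rightarrow> 'h \<Rightarrow> real" and g0 :: "'u \<Rightarrow> 'w \<Rightarrow> 'z \<Rightarrow> 'h" and M Md :: nat
  assumes finS: "finite (set_pmf S)" and fin: "finite Us" "finite Ws"
    and sub: "\<And>x y z u. (x, y, z) \<in> set_pmf S \<Longrightarrow> u \<in> Us \<Longrightarrow>
        set_pmf (A y) \<subseteq> Us \<and> set_pmf (B x) \<subseteq> Us \<and> set_pmf (C z) \<subseteq> Us \<and>
        set_pmf (E x u) \<subseteq> Ws \<and> set_pmf (F u z) \<subseteq> Ws"
    and Us: "Us \<noteq> {}"
    and posU: "\<And>x y z. (x, y, z) \<in> set_pmf S \<Longrightarrow> set_pmf (A y) \<subseteq> set_pmf (B x) \<inter> set_pmf (C z)"
    and posW: "\<And>x y z u. (x, y, z) \<in> set_pmf S \<Longrightarrow> u \<in> set_pmf (A y) \<Longrightarrow> set_pmf (E x u) \<subseteq> set_pmf (F u z)"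
    and d0: "\<And>x h. 0 \<le> dst x h" and dmax: "\<And>x h. dst x h \<le> dmax"
    and M: "M > 0" and Md: "Md > 0"
  shows "\<exists>fd f g. (\<forall>y. fd y \<in> {1..Md}) \<and> (\<forall>x m. f x m \<in> {1..M}) \<and>
     (\<forall>a b z. \<exists>u w. g a b z = g0 u w z) \<and>
     measure_pmf.expectation S (\<lambda>(x, y, z). dst x (g (f x (fd y)) (fd y) z)) \<le>
     measure_pmf.expectation S (\<lambda>(x, y, z). measure_pmf.expectation (A y) (\<lambda>u.
       measure_pmf.expectation (E x u) (\<lambda>w. dst x (g0 u w z) + dmax *
         (min 1 (pmf (A y) u / (Md * pmf (B x) u)) + min 1 (pmf (A y) u / (Md * pmf (C z) u))
          + min 1 (pmf (E x u) w / (M * pmf (F u z) w))))))"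
proof -
  define V1 where "V1 = Us \<times> {1..Md}"
  define V2 where "V2 = Ws \<times> {1..M}"
  define M1 where "M1 = PiM V1 (\<lambda>_. exp_measure)"
  define M2 where "M2 = PiM V2 (\<lambda>_. exp_measure)"
  \<comment> \<open>Each codeword is copied once per message. The sender's race spreads its weight
    evenly over the copies and so picks the message too; a receiver keeps only the copies that carry
    the received message.\<close>
  define pa where "pa = (\<lambda>y (u, m::nat). pmf (A y) u / Md)"
  define pb where "pb = (\<lambda>x m (u, m'::nat). if m' = m then pmf (B x) u else 0)"
  define pc where "pc = (\<lambda>z m (u, m'::nat). if m' = m then pmf (C z) u else 0)"
  define pe where "pe = (\<lambda>x u (w, k::nat). pmf (E x u) w / M)"
  define pf where "pf = (\<lambda>u z k (w, k'::nat). if k' = k then pmf (F u z) w else 0)"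
  define G1 where "G1 = (\<lambda>x y z (u, m) e. win V1 (pa y) e (u, m) \<and> win V1 (pb x m) e (u, m) \<and> win V1 (pc z m) e (u, m))"
  define G2 where "G2 = (\<lambda>x z u (w, k) e. win V2 (pe x u) e (w, k) \<and> win V2 (pf u z k) e (w, k))"
  \<comment> \<open>The default 1 covers clock values without a strict winner, so that the message
    stays in range for every realisation.\<close>
  define fd where "fd = (\<lambda>e1 y. if \<exists>v. win V1 (pa y) e1 v then snd (SOME v. win V1 (pa y) e1 v) else 1)"
  define fu where "fu = (\<lambda>e1 x m. fst (SOME v. win V1 (pb x m) e1 v))"
  define f where "f = (\<lambda>e1 e2 x m. if \<exists>v. win V2 (pe x (fu e1 x m)) e2 v
      then snd (SOME v. win V2 (pe x (fu e1 x m)) e2 v) else 1)"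
  define gu where "gu = (\<lambda>e1 z m. fst (SOME v. win V1 (pc z m) e1 v))"
  define g where "g = (\<lambda>e1 e2 k m z. g0 (gu e1 z m) (fst (SOME v. win V2 (pf (gu e1 z m) z k) e2 v)) z)"
  have fd_range: "fd e1 y \<in> {1..Md}" for e1 y
  proof (cases "\<exists>v. win V1 (pa y) e1 v")
    case True
    then obtain v where "win V1 (pa y) e1 v" by blast
    then show ?thesis by (auto simp: fd_def some_win_eq) (auto simp: win_def V1_def)
  qed (use Md in \<open>auto simp: fd_def\<close>)
  have f_range: "f e1 e2 x m \<in> {1..M}" for e1 e2 x m
  proof (cases "\<exists>v. win V2 (pe x (fu e1 x m)) e2 v")
    case True
    then obtain v where "win V2 (pe x (fu e1 x m)) e2 v" by blast
    then show ?thesis by (auto simp: f_def some_win_eq) (auto simp: win_def V2_def)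
  qed (use M in \<open>auto simp: f_def\<close>)
  have good: "g e1 e2 (f e1 e2 x (fd e1 y)) (fd e1 y) z = g0 u w z"
    if "G1 x y z (u, m) e1" "G2 x z u (w, k) e2" for x y z u m w k e1 e2
  proof -
    have a: "win V1 (pa y) e1 (u, m)" "win V1 (pb x m) e1 (u, m)" "win V1 (pc z m) e1 (u, m)"
      and b: "win V2 (pe x u) e2 (w, k)" "win V2 (pf u z k) e2 (w, k)"
      using that by (auto simp: G1_def G2_def)
    have 1: "fd e1 y = m" using a(1) by (auto simp: fd_def some_win_eq)
    have 2: "fu e1 x m = u" "gu e1 z m = u" using a by (auto simp: fu_def gu_def some_win_eq)
    have 3: "f e1 e2 x m = k" using b(1) by (auto simp: f_def 2 some_win_eq)
    show ?thesis unfolding 1 3 using b(2) by (simp add: g_def 2 some_win_eq)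
  qed
  define T where "T = (\<lambda>x y. SIGMA v : set_pmf (A y) \<times> {1..Md}. set_pmf (E x (fst v)) \<times> {1..M})"
  \<comment> \<open>An upper bound for the distortion: \<open>dmax\<close>, corrected at the single
    quadruple on which all parties agree, if there is one. As a finite sum of products of indicators
    it can be integrated directly, without any measurability of the choices made by
    \<open>SOME\<close>.\<close>
  define dist' where "dist' = (\<lambda>(x, y, z) (e1, e2). dmax + (\<Sum>(v, t)\<in>T x y.
      (if G1 x y z v e1 then 1 else 0) * (if G2 x z (fst v) t e2 then 1 else 0) * (dst x (g0 (fst v) (fst t) z) - dmax)))"
  have finA: "finite (set_pmf (A y))" and finE: "u \<in> set_pmf (A y) \<Longrightarrow> finite (set_pmf (E x u))"
    if "(x, y, z) \<in> set_pmf S" for x y z u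
    using sub[OF that] Us fin by (meson ex_in_conv finite_subset subsetD)+
  have finT: "finite (T x y)" if "(x, y, z) \<in> set_pmf S" for x y z
    unfolding T_def using finA[OF that] finE[OF that] by auto
  have le_dist': "dst x (g e1 e2 (f e1 e2 x (fd e1 y)) (fd e1 y) z) \<le> dist' (x, y, z) (e1, e2)"
    if s: "(x, y, z) \<in> set_pmf S" for x y z e1 e2
  proof (cases "\<exists>v t. (v, t) \<in> T x y \<and> G1 x y z v e1 \<and> G2 x z (fst v) t e2")
    case True
    then obtain v t where vt: "(v, t) \<in> T x y" "G1 x y z v e1" "G2 x z (fst v) t e2" by blast
    have uniq: "v' = v \<and> t' = t" if "G1 x y z v' e1" "G2 x z (fst v') t' e2" for v' t'
    proof
      have "win V1 (pa y) e1 v'" "win V1 (pa y) e1 v"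
        using that vt by (auto simp: G1_def split: prod.splits)
      then show v: "v' = v" by (rule win_unique)
      have "win V2 (pe x (fst v)) e2 t'" "win V2 (pe x (fst v)) e2 t"
        using that vt unfolding v by (auto simp: G2_def split: prod.splits)
      then show "t' = t" by (rule win_unique)
    qed
    have "(\<Sum>(v, t)\<in>T x y. (if G1 x y z v e1 then 1 else 0) * (if G2 x z (fst v) t e2 then 1 else 0) * (dst x (g0 (fst v) (fst t) z) - dmax))
      = (\<Sum>r\<in>T x y. if r = (v, t) then dst x (g0 (fst v) (fst t) z) - dmax else 0)"
    proof (intro sum.cong refl)
      fix r
      show "(case r of (v, t) \<Rightarrow> (if G1 x y z v e1 then 1 else 0) * (if G2 x z (fst v) t e2 then 1 else 0) * (dst x (g0 (fst v) (fst t) z) - dmax))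
        = (if r = (v, t) then dst x (g0 (fst v) (fst t) z) - dmax else 0)"
      proof (cases "r = (v, t)")
        case True
        then show ?thesis using vt(2,3) by simp
      next
        case False
        then have "\<not> (G1 x y z (fst r) e1 \<and> G2 x z (fst (fst r)) (snd r) e2)"
          using uniq[of "fst r" "snd r"] by (metis prod.collapse)
        then show ?thesis using False by (simp add: case_prod_beta)
      qed
    qed
    also have "\<dots> = dst x (g0 (fst v) (fst t) z) - dmax"
      using vt finT[OF s] by simp
    finally show ?thesis
      using good[of x y z "fst v" "snd v" e1 "fst t" "snd t" e2] vt by (simp add: dist'_def)
  next
    case False
    then have "(\<Sum>(v, t)\<in>T x y. (if G1 x y z v e1 then 1 else 0) * (if G2 x z (fst v) t e2 then 1 else 0) * (dst x (g0 (fst v) (fst t) z) - dmax)) = 0"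
      by (intro sum.neutral) auto
    then show ?thesis using dmax by (simp add: dist'_def)
  qed
  interpret P1: prob_space M1 unfolding M1_def by (rule prob_space_PiM) (rule prob_space_exp_measure)
  interpret P2: prob_space M2 unfolding M2_def by (rule prob_space_PiM) (rule prob_space_exp_measure)
  interpret P: pair_prob_space M1 M2 ..
  let ?M = "M1 \<Otimes>\<^sub>M M2"
  define err1 where "err1 = (\<lambda>x y z u. pmf (A y) u / (Md * pmf (B x) u) + pmf (A y) u / (Md * pmf (C z) u))"
  define err2 where "err2 = (\<lambda>x z u w. pmf (E x u) w / (M * pmf (F u z) w))"
  have finV: "finite V1" "finite V2" using fin by (auto simp: V1_def V2_def)
  have sum_pmf1: "(\<Sum>u\<in>Q. pmf p u) = 1" if "set_pmf p \<subseteq> Q" "finite Q" for p :: "'q pmf" and Q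
    using that by (simp add: sum_pmf_eq_1)
  have g1: "{e \<in> space M1. G1 x y z (u, m) e} \<in> sets M1"
      "measure M1 {e \<in> space M1. G1 x y z (u, m) e} \<ge> pmf (A y) u / Md * (1 / (1 + err1 x y z u))"
    if s: "(x, y, z) \<in> set_pmf S" and u: "u \<in> set_pmf (A y)" and m: "m \<in> {1..Md}" for x y z u m
  proof -
    \<comment> \<open>The parties 0, 1 and 2 are the helper, the encoder and the decoder.\<close>
    define p where "p = (\<lambda>i::nat. if i = 0 then pa y else if i = 1 then pb x m else pc z m)"
    have uU: "u \<in> Us" using sub[OF s] Us u by blast
    note subs = sub[OF s uU]
    have ps: "pmf (A y) u > 0" "pmf (B x) u > 0" "pmf (C z) u > 0"
      using posU[OF s] u by (auto intro: pmf_positive)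
    have one: "(\<Sum>w\<in>V1. p i w) = 1" for i
    proof -
      have "(\<Sum>w\<in>V1. pa y w) = 1"
        using Md subs fin by (simp add: V1_def pa_def sum.cartesian_product[symmetric] sum_pmf1)
      moreover have "(\<Sum>w\<in>V1. pb x m w) = 1" "(\<Sum>w\<in>V1. pc z m w) = 1"
        using m subs fin by (simp_all add: V1_def pb_def pc_def sum.cartesian_product[symmetric] sum_pmf1)
      ultimately show ?thesis by (auto simp: p_def)
    qed
    have nn: "p i w \<ge> 0" for i w
      by (cases w) (simp add: p_def pa_def pb_def pc_def)
    have pp: "p i (u, m) > 0" for i
      using ps Md by (simp add: p_def pa_def pb_def pc_def)
    have v: "(u, m) \<in> V1" using uU m by (simp add: V1_def)
    have eq: "{e \<in> space M1. G1 x y z (u, m) e} = {e \<in> space M1. \<forall>i\<in>{0,1,2}. win V1 (p i) e (u, m)}"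
      by (auto simp: G1_def p_def)
    have *: "{e \<in> space M1. \<forall>i\<in>{0,1,2}. win V1 (p i) e (u, m)} \<in> sets M1"
      "measure M1 {e \<in> space M1. \<forall>i\<in>{0,1,2}. win V1 (p i) e (u, m)} \<ge> 1 / (\<Sum>i\<in>{0,1,2}. 1 / p i (u, m))"
      unfolding M1_def by (rule matching_lower_bound; use finV one nn pp v in simp)+
    show "{e \<in> space M1. G1 x y z (u, m) e} \<in> sets M1" using *(1) by (simp only: eq)
    have "1 / (Md / a + (1 / b + 1 / c)) = a / Md * (1 / (1 + (a / (Md * b) + a / (Md * c))))"
      if "a > 0" "b > 0" "c > 0" for a b c :: real
    proof -
      have "a / Md * (1 / (1 + (a / (Md * b) + a / (Md * c)))) = 1 / ((Md / a) * (1 + (a / (Md * b) + a / (Md * c))))"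
        by simp
      also have "(Md / a) * (1 + (a / (Md * b) + a / (Md * c))) = Md / a + (1 / b + 1 / c)"
        using that Md by (simp add: ring_distribs)
      finally show ?thesis by simp
    qed
    from this[OF ps]
    have "1 / (\<Sum>i\<in>{0,1,2}. 1 / p i (u, m)) = pmf (A y) u / Md * (1 / (1 + err1 x y z u))"
      by (simp add: p_def pa_def pb_def pc_def err1_def)
    then show "measure M1 {e \<in> space M1. G1 x y z (u, m) e} \<ge> pmf (A y) u / Md * (1 / (1 + err1 x y z u))"
      using *(2) by (simp only: eq)
  qed
  have g2: "{e \<in> space M2. G2 x z u (w, k) e} \<in> sets M2"
      "measure M2 {e \<in> space M2. G2 x z u (w, k) e} \<ge> pmf (E x u) w / M * (1 / (1 + err2 x z u w))"
    if s: "(x, y, z) \<in> set_pmf S" and u: "u \<in> set_pmf (A y)" and w: "w \<in> set_pmf (E x u)" and k: "k \<in> {1..M}" for x y z u w k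
  proof -
    define p where "p = (\<lambda>i::nat. if i = 0 then pe x u else pf u z k)"
    have uU: "u \<in> Us" using sub[OF s] Us u by blast
    note subs = sub[OF s uU]
    have ps: "pmf (E x u) w > 0" "pmf (F u z) w > 0"
      using posW[OF s u] w by (auto intro: pmf_positive)
    have one: "(\<Sum>w\<in>V2. p i w) = 1" for i
    proof -
      have "(\<Sum>w\<in>V2. pe x u w) = 1"
        using M subs fin by (simp add: V2_def pe_def sum.cartesian_product[symmetric] sum_pmf1)
      moreover have "(\<Sum>w\<in>V2. pf u z k w) = 1"
        using k subs fin by (simp_all add: V2_def pf_def sum.cartesian_product[symmetric] sum_pmf1)
      ultimately show ?thesis by (auto simp: p_def)
    qed
    have nn: "p i w \<ge> 0" for i w
      by (cases w) (simp add: p_def pe_def pf_def)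
    have pp: "p i (w, k) > 0" for i
      using ps M by (simp add: p_def pe_def pf_def)
    have v: "(w, k) \<in> V2" using subs w k by (auto simp: V2_def)
    have eq: "{e \<in> space M2. G2 x z u (w, k) e} = {e \<in> space M2. \<forall>i\<in>{0,1}. win V2 (p i) e (w, k)}"
      by (auto simp: G2_def p_def)
    have *: "{e \<in> space M2. \<forall>i\<in>{0,1}. win V2 (p i) e (w, k)} \<in> sets M2"
      "measure M2 {e \<in> space M2. \<forall>i\<in>{0,1}. win V2 (p i) e (w, k)} \<ge> 1 / (\<Sum>i\<in>{0,1}. 1 / p i (w, k))"
      unfolding M2_def by (rule matching_lower_bound; use finV one nn pp v in simp)+
    show "{e \<in> space M2. G2 x z u (w, k) e} \<in> sets M2" using *(1) by (simp only: eq)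
    have "1 / (M / a + 1 / b) = a / M * (1 / (1 + a / (M * b)))" if "a > 0" "b > 0" for a b :: real
    proof -
      have "a / M * (1 / (1 + a / (M * b))) = 1 / ((M / a) * (1 + a / (M * b)))"
        by simp
      also have "(M / a) * (1 + a / (M * b)) = M / a + 1 / b"
        using that M by (simp add: ring_distribs)
      finally show ?thesis by simp
    qed
    from this[OF ps]
    have "1 / (\<Sum>i\<in>{0,1}. 1 / p i (w, k)) = pmf (E x u) w / M * (1 / (1 + err2 x z u w))"
      by (simp add: p_def pe_def pf_def err2_def)
    then show "measure M2 {e \<in> space M2. G2 x z u (w, k) e} \<ge> pmf (E x u) w / M * (1 / (1 + err2 x z u w))"
      using *(2) by (simp only: eq)
  qed
  have gp: "has_bochner_integral ?M (\<lambda>(e1, e2). (if G1 x y z v e1 then 1 else 0) * (if G2 x z (fst v) t e2 then 1 else 0) * c)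
      (measure M1 {e \<in> space M1. G1 x y z v e} * measure M2 {e \<in> space M2. G2 x z (fst v) t e} * c)"
    if s: "(x, y, z) \<in> set_pmf S" and vt: "(v, t) \<in> T x y" for x y z v t and c :: real
  proof -
    obtain u m w k where [simp]: "v = (u, m)" "t = (w, k)" by (cases v, cases t) auto
    have mem: "u \<in> set_pmf (A y)" "m \<in> {1..Md}" "w \<in> set_pmf (E x u)" "k \<in> {1..M}"
      using vt by (auto simp: T_def)
    let ?A = "{e \<in> space M1. G1 x y z v e}" and ?B = "{e \<in> space M2. G2 x z (fst v) t e}"
    have sets: "?A \<in> sets M1" "?B \<in> sets M2"
      using g1(1)[OF s mem(1,2)] g2(1)[OF s mem(1,3,4)] by simp_all
    have "has_bochner_integral ?M (\<lambda>e. c * indicator (?A \<times> ?B) e) (c * measure ?M (?A \<times> ?B))"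
      using sets by (intro has_bochner_integral_mult_right has_bochner_integral_real_indicator) (auto simp: P.emeasure_eq_measure)
    also have "measure ?M (?A \<times> ?B) = measure M1 ?A * measure M2 ?B"
      using sets by (simp add: measure_def P2.emeasure_pair_measure_Times enn2real_mult)
    finally show ?thesis
      by (rule has_bochner_integral_cong[THEN iffD1, rotated -1])
        (auto simp: space_pair_measure indicator_def split: if_splits)
  qed
  define I where "I = (\<lambda>(x, y, z). dmax + (\<Sum>(v, t)\<in>T x y. measure M1 {e \<in> space M1. G1 x y z v e}
      * measure M2 {e \<in> space M2. G2 x z (fst v) t e} * (dst x (g0 (fst v) (fst t) z) - dmax)))"
  have int_dist': "has_bochner_integral ?M (dist' s) (I s)" if s: "s \<in> set_pmf S" for s
  proof -
    obtain x y z where [simp]: "s = (x, y, z)" by (cases s) auto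
    have "has_bochner_integral ?M (\<lambda>_. dmax) dmax"
      by (simp add: has_bochner_integral_iff P.prob_space)
    moreover have "has_bochner_integral ?M (\<lambda>e. \<Sum>r\<in>T x y. case e of (e1, e2) \<Rightarrow> (if G1 x y z (fst r) e1 then 1 else 0) *
        (if G2 x z (fst (fst r)) (snd r) e2 then 1 else 0) * (dst x (g0 (fst (fst r)) (fst (snd r)) z) - dmax))
      (\<Sum>r\<in>T x y. measure M1 {e \<in> space M1. G1 x y z (fst r) e}
      * measure M2 {e \<in> space M2. G2 x z (fst (fst r)) (snd r) e} * (dst x (g0 (fst (fst r)) (fst (snd r)) z) - dmax))"
      using s by (intro has_bochner_integral_sum gp) auto
    ultimately have "has_bochner_integral ?M (\<lambda>e. dmax + (\<Sum>r\<in>T x y. case e of (e1, e2) \<Rightarrow> (if G1 x y z (fst r) e1 then 1 else 0) *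
        (if G2 x z (fst (fst r)) (snd r) e2 then 1 else 0) * (dst x (g0 (fst (fst r)) (fst (snd r)) z) - dmax))) (I s)"
      unfolding I_def by (simp add: case_prod_beta) (intro has_bochner_integral_add)
    also have "(\<lambda>e. dmax + (\<Sum>r\<in>T x y. case e of (e1, e2) \<Rightarrow> (if G1 x y z (fst r) e1 then 1 else 0) *
        (if G2 x z (fst (fst r)) (snd r) e2 then 1 else 0) * (dst x (g0 (fst (fst r)) (fst (snd r)) z) - dmax))) = dist' s"
      by (simp add: dist'_def case_prod_beta fun_eq_iff)
    finally show ?thesis .
  qed
  have I_le: "I (x, y, z) \<le> measure_pmf.expectation (A y) (\<lambda>u.
       measure_pmf.expectation (E x u) (\<lambda>w. dst x (g0 u w z) + dmax *
         (min 1 (pmf (A y) u / (Md * pmf (B x) u)) + min 1 (pmf (A y) u / (Md * pmf (C z) u))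
          + min 1 (pmf (E x u) w / (M * pmf (F u z) w)))))"
    if s: "(x, y, z) \<in> set_pmf S" for x y z
  proof -
    define er where "er = (\<lambda>u w. min 1 (pmf (A y) u / (Md * pmf (B x) u)) + min 1 (pmf (A y) u / (Md * pmf (C z) u))
          + min 1 (pmf (E x u) w / (M * pmf (F u z) w)))"
    have "(\<Sum>(v, t)\<in>T x y. measure M1 {e \<in> space M1. G1 x y z v e}
      * measure M2 {e \<in> space M2. G2 x z (fst v) t e} * (dst x (g0 (fst v) (fst t) z) - dmax)) \<le>
      (\<Sum>(v, t)\<in>T x y. pmf (A y) (fst v) / Md * (pmf (E x (fst v)) (fst t) / M) *
        (dst x (g0 (fst v) (fst t) z) - dmax + dmax * er (fst v) (fst t)))"
    proof (intro sum_mono, clarify)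
      fix u m w k assume vt: "((u, m), (w, k)) \<in> T x y"
      have mem: "u \<in> set_pmf (A y)" "m \<in> {1..Md}" "w \<in> set_pmf (E x u)" "k \<in> {1..M}"
        using vt by (auto simp: T_def)
      define a where "a = pmf (A y) u / Md"
      define b where "b = pmf (E x u) w / M"
      define s1 where "s1 = 1 / (1 + err1 x y z u)"
      define s2 where "s2 = 1 / (1 + err2 x z u w)"
      define q where "q = dst x (g0 u w z)"
      have q: "0 \<le> q" "q \<le> dmax" using d0 dmax by (auto simp: q_def)
      have ab: "a \<ge> 0" "b \<ge> 0" by (auto simp: a_def b_def)
      have e1: "err1 x y z u \<ge> 0" "err2 x z u w \<ge> 0" by (auto simp: err1_def err2_def)
      have s12: "0 \<le> s1" "s1 \<le> 1" "0 \<le> s2" "s2 \<le> 1" using e1 by (auto simp: s1_def s2_def)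
      have "1 - s1 \<le> min 1 (err1 x y z u)" unfolding s1_def by (rule one_minus_inverse_le[OF e1(1)])
      also have "\<dots> \<le> min 1 (pmf (A y) u / (Md * pmf (B x) u)) + min 1 (pmf (A y) u / (Md * pmf (C z) u))"
      proof -
        have "min 1 (p + r) \<le> min 1 p + min 1 r" if "p \<ge> 0" "r \<ge> 0" for p r :: real
          using that by (auto simp: min_def)
        then show ?thesis unfolding err1_def by simp
      qed
      finally have 1: "1 - s1 \<le> min 1 (pmf (A y) u / (Md * pmf (B x) u)) + min 1 (pmf (A y) u / (Md * pmf (C z) u))" .
      have 2: "1 - s2 \<le> min 1 (pmf (E x u) w / (M * pmf (F u z) w))"
        unfolding s2_def using one_minus_inverse_le[OF e1(2)] by (simp add: err2_def)
      have "0 \<le> (1 - s1) * (1 - s2)" using s12 by (intro mult_nonneg_nonneg) auto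
      \<comment> \<open>Union bound: one of the two races fails.\<close>
      then have "1 - s1 * s2 \<le> (1 - s1) + (1 - s2)" by (simp add: algebra_simps)
      also have "\<dots> \<le> er u w" unfolding er_def by (intro add_mono 1 2)
      finally have 3: "1 - s1 * s2 \<le> er u w" .
      have "a * s1 * (b * s2) \<le> measure M1 {e \<in> space M1. G1 x y z (u, m) e} * measure M2 {e \<in> space M2. G2 x z u (w, k) e}"
        using g1(2)[OF s mem(1,2)] g2(2)[OF s mem(1,3,4)] ab s12
        unfolding a_def[symmetric] b_def[symmetric] s1_def[symmetric] s2_def[symmetric]
        by (intro mult_mono) auto
      \<comment> \<open>The factor \<open>q - dmax\<close> is nonpositive, so a lower bound on the
        probability of agreement becomes an upper bound on the cost.\<close>
      then have "measure M1 {e \<in> space M1. G1 x y z (u, m) e} * measure M2 {e \<in> space M2. G2 x z u (w, k) e} * (q - dmax)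
        \<le> a * s1 * (b * s2) * (q - dmax)"
        using q by (intro mult_right_mono_neg) auto
      also have "\<dots> = a * b * (q - dmax + (1 - s1 * s2) * (dmax - q))" by (simp add: algebra_simps)
      also have "\<dots> \<le> a * b * (q - dmax + dmax * er u w)"
      proof (intro mult_left_mono add_left_mono)
        have "s1 * s2 \<le> 1" using s12 by (simp add: mult_le_one)
        then have "(1 - s1 * s2) * (dmax - q) \<le> (1 - s1 * s2) * dmax" using q by (intro mult_left_mono) auto
        also have "\<dots> \<le> er u w * dmax" using 3 q by (intro mult_right_mono) auto
        finally show "(1 - s1 * s2) * (dmax - q) \<le> dmax * er u w" by (simp add: mult.commute)
      qed (use ab in auto)
      finally show "measure M1 {e \<in> space M1. G1 x y z (u, m) e} * measure M2 {e \<in> space M2. G2 x z (fst (u, m)) (w, k) e}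
          * (dst x (g0 (fst (u, m)) (fst (w, k)) z) - dmax)
        \<le> pmf (A y) (fst (u, m)) / Md * (pmf (E x (fst (u, m))) (fst (w, k)) / M) *
        (dst x (g0 (fst (u, m)) (fst (w, k)) z) - dmax + dmax * er (fst (u, m)) (fst (w, k)))"
        by (simp add: a_def b_def q_def)
    qed
    also have "\<dots> = (\<Sum>u\<in>set_pmf (A y). pmf (A y) u * (\<Sum>w\<in>set_pmf (E x u). pmf (E x u) w *
        (dst x (g0 u w z) - dmax + dmax * er u w)))"
    proof -
      have "(\<Sum>(v, t)\<in>T x y. pmf (A y) (fst v) / Md * (pmf (E x (fst v)) (fst t) / M) *
        (dst x (g0 (fst v) (fst t) z) - dmax + dmax * er (fst v) (fst t))) =
        (\<Sum>v\<in>set_pmf (A y) \<times> {1..Md}. \<Sum>t\<in>set_pmf (E x (fst v)) \<times> {1..M}.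
          pmf (A y) (fst v) / Md * (pmf (E x (fst v)) (fst t) / M) *
        (dst x (g0 (fst v) (fst t) z) - dmax + dmax * er (fst v) (fst t)))"
        unfolding T_def using finA[OF s] finE[OF s] by (subst sum.Sigma) auto
      \<comment> \<open>The summand does not depend on the messages, so the sums over them cancel
        the weights 1 / Md and 1 / M.\<close>
      also have "\<dots> = (\<Sum>u\<in>set_pmf (A y). Md * (\<Sum>w\<in>set_pmf (E x u). M *
          (pmf (A y) u / Md * (pmf (E x u) w / M) * (dst x (g0 u w z) - dmax + dmax * er u w))))"
        by (subst sum_fst_times[where h = "\<lambda>u. \<Sum>t\<in>set_pmf (E x u) \<times> {1..M}.
            pmf (A y) u / Md * (pmf (E x u) (fst t) / M) * (dst x (g0 u (fst t) z) - dmax + dmax * er u (fst t))"],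
          subst sum_fst_times[where h = "\<lambda>w. pmf (A y) _ / Md * (pmf (E x _) w / M) *
            (dst x (g0 _ w z) - dmax + dmax * er _ w)"]) (rule refl)
      also have "\<dots> = (\<Sum>u\<in>set_pmf (A y). \<Sum>w\<in>set_pmf (E x u).
          pmf (A y) u * (pmf (E x u) w * (dst x (g0 u w z) - dmax + dmax * er u w)))"
        using M Md by (simp add: sum_distrib_left mult.assoc)
      finally show ?thesis by (simp only: sum_distrib_left)
    qed
    also have "\<dots> = (\<Sum>u\<in>set_pmf (A y). pmf (A y) u * ((\<Sum>w\<in>set_pmf (E x u). pmf (E x u) w *
        (dst x (g0 u w z) + dmax * er u w)) - dmax))"
    proof (intro sum.cong refl)
      fix u assume u: "u \<in> set_pmf (A y)"
      have "(\<Sum>w\<in>set_pmf (E x u). pmf (E x u) w * (dst x (g0 u w z) - dmax + dmax * er u w)) =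
        (\<Sum>w\<in>set_pmf (E x u). pmf (E x u) w * (dst x (g0 u w z) + dmax * er u w)) - dmax * (\<Sum>w\<in>set_pmf (E x u). pmf (E x u) w)"
        by (simp add: sum_distrib_left sum_subtractf[symmetric] algebra_simps)
      then show "pmf (A y) u * (\<Sum>w\<in>set_pmf (E x u). pmf (E x u) w * (dst x (g0 u w z) - dmax + dmax * er u w)) =
        pmf (A y) u * ((\<Sum>w\<in>set_pmf (E x u). pmf (E x u) w * (dst x (g0 u w z) + dmax * er u w)) - dmax)"
        using finE[OF s u] by (simp add: sum_pmf1)
    qed
    also have "\<dots> = (\<Sum>u\<in>set_pmf (A y). pmf (A y) u * (\<Sum>w\<in>set_pmf (E x u). pmf (E x u) w *
        (dst x (g0 u w z) + dmax * er u w))) - dmax"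
      using finA[OF s] by (simp add: right_diff_distrib sum_subtractf sum_distrib_right[symmetric] sum_pmf1)
    also have "(\<Sum>u\<in>set_pmf (A y). pmf (A y) u * (\<Sum>w\<in>set_pmf (E x u). pmf (E x u) w *
        (dst x (g0 u w z) + dmax * er u w))) = measure_pmf.expectation (A y) (\<lambda>u.
       measure_pmf.expectation (E x u) (\<lambda>w. dst x (g0 u w z) + dmax * er u w))"
      using finA[OF s] finE[OF s] by (simp add: expectation_eq_sum)
    finally show ?thesis by (simp add: I_def er_def)
  qed
  define X where "X = (\<lambda>e. \<Sum>s\<in>set_pmf S. pmf S s * dist' s e)"
  have X: "has_bochner_integral ?M X (\<Sum>s\<in>set_pmf S. pmf S s * I s)"
    unfolding X_def by (intro has_bochner_integral_sum has_bochner_integral_mult_right int_dist') auto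
  then have "integrable ?M X" "integral\<^sup>L ?M X = (\<Sum>s\<in>set_pmf S. pmf S s * I s)"
    by (simp_all add: has_bochner_integral_iff)
  \<comment> \<open>Derandomisation: some realisation of the clocks is at least as good as the mean,
    and it fixes the code.\<close>
  with P.exists_le_expectation[of X] obtain e where e: "X e \<le> (\<Sum>s\<in>set_pmf S. pmf S s * I s)" by auto
  obtain e1 e2 where [simp]: "e = (e1, e2)" by (cases e)
  have "measure_pmf.expectation S (\<lambda>(x, y, z). dst x (g e1 e2 (f e1 e2 x (fd e1 y)) (fd e1 y) z)) \<le> X e"
    unfolding X_def expectation_eq_sum[OF finS]
    using le_dist' by (auto intro!: sum_mono mult_left_mono)
  also note e
  also have "(\<Sum>s\<in>set_pmf S. pmf S s * I s) \<le> measure_pmf.expectation S (\<lambda>(x, y, z). measure_pmf.expectation (A y) (\<lambda>u.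
       measure_pmf.expectation (E x u) (\<lambda>w. dst x (g0 u w z) + dmax *
         (min 1 (pmf (A y) u / (Md * pmf (B x) u)) + min 1 (pmf (A y) u / (Md * pmf (C z) u))
          + min 1 (pmf (E x u) w / (M * pmf (F u z) w))))))"
    unfolding expectation_eq_sum[OF finS] using I_le by (auto intro!: sum_mono mult_left_mono)
  finally show ?thesis
    using fd_range f_range by (intro exI[of _ "fd e1"] exI[of _ "f e1 e2"] exI[of _ "g e1 e2"]) (auto simp: g_def)
qed

section \<open>Memoryless extensions\<close>

lemma iid_Suc_pair: "iid (Suc n) P = map_pmf (\<lambda>(a, as). a # as) (pair_pmf P (iid n P))"
  by (simp add: pair_pmf_def map_bind_pmf map_pmf_def bind_assoc_pmf bind_return_pmf)

lemma set_pmf_iid: "set_pmf (iid n P) = {t. length t = n \<and> set t \<subseteq> set_pmf P}"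
proof (induction n)
  case (Suc n)
  show ?case
    unfolding iid_Suc_pair set_map_pmf set_pair_pmf Suc
    by (auto simp: length_Suc_conv image_iff)
qed auto

lemma finite_set_pmf_iid: "finite (set_pmf P) \<Longrightarrow> finite (set_pmf (iid n P))"
  by (simp add: set_pmf_iid) (metis (no_types, lifting) Collect_cong conj_commute finite_lists_length_eq)

lemma expectation_bind_finite:
  fixes h :: "'b \<Rightarrow> real"
  assumes "finite (set_pmf p)" "\<And>a. a \<in> set_pmf p \<Longrightarrow> finite (set_pmf (f a))"
  shows "measure_pmf.expectation (bind_pmf p f) h =
    measure_pmf.expectation p (\<lambda>a. measure_pmf.expectation (f a) h)"
proof -
  \<comment> \<open>Off the support of \<open>p\<close> the law \<open>f a\<close> may be infinite;
    a point mass there leaves the mixture unchanged.\<close>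
  define f' where "f' = (\<lambda>a. if a \<in> set_pmf p then f a else return_pmf undefined)"
  have "bind_pmf p f = bind_pmf p f'" by (intro bind_pmf_cong) (auto simp: f'_def)
  then have "measure_pmf.expectation (bind_pmf p f) h = (\<Sum>a\<in>set_pmf p. pmf p a * measure_pmf.expectation (f' a) h)"
    using assms by (simp add: pmf_expectation_bind[of "set_pmf p"] f'_def)
  then show ?thesis using assms by (simp add: expectation_eq_sum f'_def)
qed

lemma expectation_iid_Suc:
  fixes h :: "'a list \<Rightarrow> real"
  assumes "finite (set_pmf P)"
  shows "measure_pmf.expectation (iid (Suc n) P) h =
    measure_pmf.expectation P (\<lambda>a. measure_pmf.expectation (iid n P) (\<lambda>as. h (a # as)))"
  using assms finite_set_pmf_iid[OF assms, of n]
  by (simp add: expectation_bind_finite)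

lemma integrable_finite_pmf: "finite (set_pmf p) \<Longrightarrow> integrable (measure_pmf p) (f :: _ \<Rightarrow> real)"
  by (rule integrable_measure_pmf_finite)

lemma expectation_iid_sum_list:
  fixes h :: "'a \<Rightarrow> real"
  assumes "finite (set_pmf P)"
  shows "measure_pmf.expectation (iid n P) (\<lambda>t. sum_list (map h t)) = n * measure_pmf.expectation P h"
proof (induction n)
  case (Suc n)
  show ?case
    unfolding expectation_iid_Suc[OF assms]
    using integrable_finite_pmf[OF assms] integrable_finite_pmf[OF finite_set_pmf_iid[OF assms, of n]] Suc
    by (simp add: algebra_simps)
qed simp

lemma expectation_iid_sum_list_square:
  fixes h :: "'a \<Rightarrow> real"
  assumes fin: "finite (set_pmf P)" and zero: "measure_pmf.expectation P h = 0"
  shows "measure_pmf.expectation (iid n P) (\<lambda>t. (sum_list (map h t))\<^sup>2) =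
    n * measure_pmf.expectation P (\<lambda>a. (h a)\<^sup>2)"
proof (induction n)
  case (Suc n)
  note i1 = integrable_finite_pmf[OF fin] and i2 = integrable_finite_pmf[OF finite_set_pmf_iid[OF fin, of n]]
  have s0: "measure_pmf.expectation (iid n P) (\<lambda>t. sum_list (map h t)) = 0"
    using zero by (simp add: expectation_iid_sum_list[OF fin])
  have "measure_pmf.expectation (iid (Suc n) P) (\<lambda>t. (sum_list (map h t))\<^sup>2) =
    measure_pmf.expectation P (\<lambda>a. measure_pmf.expectation (iid n P)
      (\<lambda>t. (h a)\<^sup>2 + (sum_list (map h t))\<^sup>2 + 2 * h a * sum_list (map h t)))"
    unfolding expectation_iid_Suc[OF fin] by (simp add: power2_sum)
  also have "\<dots> = measure_pmf.expectation P (\<lambda>a. (h a)\<^sup>2 + n * measure_pmf.expectation P (\<lambda>a. (h a)\<^sup>2))"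
    using i2 Suc s0 by simp
  also have "\<dots> = Suc n * measure_pmf.expectation P (\<lambda>a. (h a)\<^sup>2)"
    using i1 by (simp add: algebra_simps)
  finally show ?case .
qed simp

text \<open>Chebyshev in logarithmic form. If the sum of the logarithms exceeds its mean by
  n\<epsilon>, the truncated term is at most 1 and is charged to the variance; otherwise the product
  is at most 2 powr (n (\<mu> + \<epsilon>)).\<close>

lemma iid_min_one_prod_le:
  fixes \<rho> :: "'a \<Rightarrow> real"
  assumes fin: "finite (set_pmf P)" and pos: "\<And>a. a \<in> set_pmf P \<Longrightarrow> \<rho> a > 0"
    and c: "c \<ge> 0" and eps: "\<epsilon> > 0" and n: "n > 0"
  defines "\<mu> \<equiv> measure_pmf.expectation P (\<lambda>a. log 2 (\<rho> a))"
  shows "measure_pmf.expectation (iid n P) (\<lambda>t. min 1 (c * prod_list (map \<rho> t))) \<le>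
    measure_pmf.expectation P (\<lambda>a. (log 2 (\<rho> a) - \<mu>)\<^sup>2) / (n * \<epsilon>\<^sup>2) + c * 2 powr (n * (\<mu> + \<epsilon>))"
proof -
  note i1 = integrable_finite_pmf[OF fin] and i2 = integrable_finite_pmf[OF finite_set_pmf_iid[OF fin, of n]]
  let ?h = "\<lambda>a. log 2 (\<rho> a) - \<mu>"
  let ?s = "\<lambda>t. sum_list (map ?h t)"
  have zero: "measure_pmf.expectation P ?h = 0"
    using i1 by (simp add: \<mu>_def)
  have prod: "prod_list (map \<rho> t) = 2 powr (?s t + length t * \<mu>)" if "set t \<subseteq> set_pmf P" for t
    using that
  proof (induction t)
    case (Cons a t)
    then have "\<rho> a > 0" using pos by simp
    moreover have "?s (a # t) + length (a # t) * \<mu> = log 2 (\<rho> a) + (?s t + length t * \<mu>)"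
      by (simp add: algebra_simps)
    ultimately show ?case using Cons by (simp only: powr_add) simp
  qed simp
  have "measure_pmf.expectation (iid n P) (\<lambda>t. min 1 (c * prod_list (map \<rho> t))) \<le>
    measure_pmf.expectation (iid n P) (\<lambda>t. (?s t)\<^sup>2 / (n * \<epsilon>)\<^sup>2 + c * 2 powr (n * (\<mu> + \<epsilon>)))"
  proof (intro integral_mono_AE i2, unfold AE_measure_pmf_iff, intro ballI)
    fix t assume "t \<in> set_pmf (iid n P)"
    then have t: "length t = n" "set t \<subseteq> set_pmf P" by (auto simp: set_pmf_iid)
    show "min 1 (c * prod_list (map \<rho> t)) \<le> (?s t)\<^sup>2 / (n * \<epsilon>)\<^sup>2 + c * 2 powr (n * (\<mu> + \<epsilon>))"
    proof (cases "?s t \<ge> n * \<epsilon>")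
      case True
      then have "(n * \<epsilon>)\<^sup>2 \<le> (?s t)\<^sup>2" using eps n by (intro power_mono) auto
      then have "1 \<le> (?s t)\<^sup>2 / (n * \<epsilon>)\<^sup>2" using eps n by (simp add: le_divide_eq)
      then show ?thesis using c by (simp add: add_increasing2 min.coboundedI1)
    next
      case False
      then have "prod_list (map \<rho> t) \<le> 2 powr (n * (\<mu> + \<epsilon>))"
        using t by (simp add: prod algebra_simps)
      then have "c * prod_list (map \<rho> t) \<le> c * 2 powr (n * (\<mu> + \<epsilon>))" using c by (rule mult_left_mono)
      then show ?thesis by (smt (verit) divide_nonneg_nonneg zero_le_power2)
    qed
  qed
  also have "\<dots> = measure_pmf.expectation (iid n P) (\<lambda>t. (?s t)\<^sup>2) / (n * \<epsilon>)\<^sup>2 + c * 2 powr (n * (\<mu> + \<epsilon>))"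
    using i2 by simp
  also have "\<dots> = measure_pmf.expectation P (\<lambda>a. (?h a)\<^sup>2) / (n * \<epsilon>\<^sup>2) + c * 2 powr (n * (\<mu> + \<epsilon>))"
    unfolding expectation_iid_sum_list_square[OF fin zero] using n by (simp add: power2_eq_square)
  finally show ?thesis .
qed

text \<open>The memoryless extension of the channel \<open>K\<close> to blocks.\<close>

primrec kerlist :: "('a \<Rightarrow> 'b pmf) \<Rightarrow> 'a list \<Rightarrow> 'b list pmf" where
  "kerlist K [] = return_pmf []"
| "kerlist K (t # ts) = map_pmf (\<lambda>(b, bs). b # bs) (pair_pmf (K t) (kerlist K ts))"

lemma set_pmf_kerlist:
  "set_pmf (kerlist K ts) = {bs. list_all2 (\<lambda>b t. b \<in> set_pmf (K t)) bs ts}"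
  by (induction ts) (auto simp: list_all2_Cons2 image_iff)

lemma pmf_kerlist_map:
  "pmf (kerlist K (map f t)) (map g t) = prod_list (map (\<lambda>\<omega>. pmf (K (f \<omega>)) (g \<omega>)) t)"
proof (induction t)
  case (Cons a t)
  have "pmf (map_pmf (\<lambda>(b, bs). b # bs) (pair_pmf (K (f a)) (kerlist K (map f t))))
      ((\<lambda>(b, bs). b # bs) (g a, map g t)) = pmf (pair_pmf (K (f a)) (kerlist K (map f t))) (g a, map g t)"
    by (rule pmf_map_inj') (auto simp: inj_def)
  then show ?case using Cons by (simp add: pmf_pair)
qed simp

lemma prod_list_divide:
  "prod_list (map f t) / prod_list (map g t) = prod_list (map (\<lambda>a. f a / g a :: real) t)"
  by (induction t) (auto simp flip: times_divide_times_eq)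

definition unzip5 :: "('x \<times> 'y \<times> 'z \<times> 'u \<times> 'w) list \<Rightarrow> 'x list \<times> 'y list \<times> 'z list \<times> 'u list \<times> 'w list" where
  "unzip5 t = (map (\<lambda>(x,y,z,u,w). x) t, map (\<lambda>(x,y,z,u,w). y) t, map (\<lambda>(x,y,z,u,w). z) t,
     map (\<lambda>(x,y,z,u,w). u) t, map (\<lambda>(x,y,z,u,w). w) t)"

text \<open>The draws of u and w for one letter are independent of the remaining letters, so they
  can be moved past them. This lets the one-shot bound for block laws be evaluated under an i.i.d.
  law, letter by letter.\<close>

lemma unzip5_iid_joint5:
  "map_pmf unzip5 (iid n (joint5 pXY pZ qU qW)) =
    bind_pmf (iid n (src pXY pZ)) (\<lambda>t. bind_pmf (kerlist qU (map (fst \<circ> snd) t)) (\<lambda>us.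
      bind_pmf (kerlist (case_prod qW) (zip (map fst t) us)) (\<lambda>ws.
        return_pmf (map fst t, map (fst \<circ> snd) t, map (snd \<circ> snd) t, us, ws))))"
  (is "_ = ?R n")
proof (induction n)
  case 0
  show ?case by (simp add: unzip5_def bind_return_pmf)
next
  case (Suc n)
  let ?J = "joint5 pXY pZ qU qW" and ?S = "src pXY pZ"
  let ?add = "\<lambda>(x,y,z,u,w) (xs,ys,zs,us,ws). (x # xs, y # ys, z # zs, u # us, w # ws)"
  have J: "?J = bind_pmf ?S (\<lambda>(x,y,z). bind_pmf (qU y) (\<lambda>u. bind_pmf (qW x u) (\<lambda>w. return_pmf (x,y,z,u,w))))"
    by (simp add: joint5_def src_def bind_assoc_pmf bind_return_pmf case_prod_unfold comp_def)
  have "map_pmf unzip5 (iid (Suc n) ?J) =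
    bind_pmf ?J (\<lambda>\<omega>. bind_pmf (map_pmf unzip5 (iid n ?J)) (\<lambda>r. return_pmf (?add \<omega> r)))"
    by (simp add: map_pmf_def bind_assoc_pmf bind_return_pmf unzip5_def case_prod_unfold comp_def)
  also have "\<dots> = bind_pmf ?J (\<lambda>\<omega>. bind_pmf (?R n) (\<lambda>r. return_pmf (?add \<omega> r)))"
    by (simp only: Suc)
  also have "\<dots> = bind_pmf ?S (\<lambda>s. bind_pmf (qU (fst (snd s))) (\<lambda>u. bind_pmf (qW (fst s) u) (\<lambda>w.
      bind_pmf (iid n ?S) (\<lambda>t. bind_pmf (kerlist qU (map (fst \<circ> snd) t)) (\<lambda>us.
      bind_pmf (kerlist (case_prod qW) (zip (map fst t) us)) (\<lambda>ws.
        return_pmf (fst s # map fst t, fst (snd s) # map (fst \<circ> snd) t, snd (snd s) # map (snd \<circ> snd) t, u # us, w # ws)))))))"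
    unfolding J by (simp add: bind_assoc_pmf bind_return_pmf case_prod_unfold comp_def)
  also have "\<dots> = bind_pmf ?S (\<lambda>s. bind_pmf (qU (fst (snd s))) (\<lambda>u. 
      bind_pmf (iid n ?S) (\<lambda>t. bind_pmf (kerlist qU (map (fst \<circ> snd) t)) (\<lambda>us. bind_pmf (qW (fst s) u) (\<lambda>w.
      bind_pmf (kerlist (case_prod qW) (zip (map fst t) us)) (\<lambda>ws.
        return_pmf (fst s # map fst t, fst (snd s) # map (fst \<circ> snd) t, snd (snd s) # map (snd \<circ> snd) t, u # us, w # ws)))))))"
    by (intro bind_pmf_cong refl, rule trans[OF bind_commute_pmf], intro bind_pmf_cong refl, rule bind_commute_pmf)
  also have "\<dots> = bind_pmf ?S (\<lambda>s. bind_pmf (iid n ?S) (\<lambda>t. bind_pmf (qU (fst (snd s))) (\<lambda>u. 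
      bind_pmf (kerlist qU (map (fst \<circ> snd) t)) (\<lambda>us. bind_pmf (qW (fst s) u) (\<lambda>w.
      bind_pmf (kerlist (case_prod qW) (zip (map fst t) us)) (\<lambda>ws.
        return_pmf (fst s # map fst t, fst (snd s) # map (fst \<circ> snd) t, snd (snd s) # map (snd \<circ> snd) t, u # us, w # ws)))))))"
    by (intro bind_pmf_cong refl, rule bind_commute_pmf)
  also have "\<dots> = ?R (Suc n)"
    by (simp add: bind_assoc_pmf bind_return_pmf pair_pmf_def map_bind_pmf map_pmf_def case_prod_unfold comp_def)
  finally show ?case .
qed

lemma pmf_bind_map_pair:
  "pmf (bind_pmf p (\<lambda>a. map_pmf (\<lambda>b. (b, a)) (k a))) (b, a) = pmf p a * pmf (k a) b"
proof -
  have "pmf (map_pmf (\<lambda>b. (b, a')) (k a')) (b, a) = indicator {a} a' * pmf (k a) b" for a'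
  proof (cases "a' = a")
    case True
    have "inj (\<lambda>b. (b, a))" by (auto simp: inj_def)
    then show ?thesis using True pmf_map_inj'[of "\<lambda>b. (b, a)" "k a" b] by simp
  next
    case False
    then show ?thesis by (simp add: pmf_eq_0_set_pmf image_iff)
  qed
  then have "pmf (bind_pmf p (\<lambda>a. map_pmf (\<lambda>b. (b, a)) (k a))) (b, a) =
      measure_pmf.expectation p (\<lambda>a'. indicator {a} a' * pmf (k a) b)"
    by (simp only: pmf_bind)
  also have "\<dots> = pmf p a * pmf (k a) b"
    by (simp add: measure_pmf_single)
  finally show ?thesis .
qed

lemma pmf_map_kernel_cong:
  assumes "\<And>\<omega>'. f \<omega>' = f \<omega> \<longleftrightarrow> g \<omega>' = g \<omega>"
  shows "pmf (map_pmf f J) (f \<omega>) = pmf (map_pmf g J) (g \<omega>)"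
proof -
  have "f -` {f \<omega>} = g -` {g \<omega>}" using assms by auto
  then show ?thesis by (simp only: pmf_map)
qed

text \<open>Outside the support of \<open>f\<close> the conditional law is the junk value \<open>return_pmf 0\<close>.\<close>
definition condk :: "'o pmf \<Rightarrow> ('o \<Rightarrow> 'a) \<Rightarrow> ('o \<Rightarrow> nat) \<Rightarrow> 'a \<Rightarrow> nat pmf" where
  "condk J f g a = (if a \<in> f ` set_pmf J then map_pmf g (cond_pmf J (f -` {a})) else return_pmf 0)"

lemma set_condk: "set_pmf (condk J f g a) \<subseteq> insert 0 (g ` set_pmf J)"
proof (cases "a \<in> f ` set_pmf J")
  case True
  then have "set_pmf J \<inter> f -` {a} \<noteq> {}" by auto
  then show ?thesis using True by (auto simp: condk_def set_cond_pmf)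
qed (auto simp: condk_def)

lemma condk_in: "\<omega> \<in> set_pmf J \<Longrightarrow> g \<omega> \<in> set_pmf (condk J f g (f \<omega>))"
proof -
  assume w: "\<omega> \<in> set_pmf J"
  then have "set_pmf J \<inter> f -` {f \<omega>} \<noteq> {}" by auto
  then show ?thesis using w by (auto simp: condk_def set_cond_pmf)
qed

lemma pmf_condk:
  assumes "\<omega> \<in> set_pmf J"
  shows "pmf (condk J f g (f \<omega>)) v = pmf (map_pmf (\<lambda>\<omega>. (g \<omega>, f \<omega>)) J) (v, f \<omega>) / pmf (map_pmf f J) (f \<omega>)"
proof -
  have ne: "set_pmf J \<inter> f -` {f \<omega>} \<noteq> {}" using assms by auto
  have "pmf (condk J f g (f \<omega>)) v = measure (cond_pmf J (f -` {f \<omega>})) (g -` {v})"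
    using assms by (simp add: condk_def pmf_map)
  also have "\<dots> = measure (measure_pmf J) (f -` {f \<omega>} \<inter> g -` {v}) / measure (measure_pmf J) (f -` {f \<omega>})"
    unfolding cond_pmf.rep_eq[OF ne] using pmf_map_pos[OF assms, of f]
    by (subst measure_uniform_measure) (auto simp: measure_pmf.emeasure_eq_measure pmf_map)
  also have "f -` {f \<omega>} \<inter> g -` {v} = (\<lambda>\<omega>. (g \<omega>, f \<omega>)) -` {(v, f \<omega>)}" by auto
  finally show ?thesis by (simp only: pmf_map)
qed

section \<open>Achievability\<close>

abbreviation jX :: "'x \<times> 'y \<times> 'z \<times> 'u \<times> 'w \<Rightarrow> 'x" where "jX \<equiv> (\<lambda>(x,y,z,u,w). x)"
abbreviation jY :: "'x \<times> 'y \<times> 'z \<times> 'u \<times> 'w \<Rightarrow> 'y" where "jY \<equiv> (\<lambda>(x,y,z,u,w). y)"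
abbreviation jZ :: "'x \<times> 'y \<times> 'z \<times> 'u \<times> 'w \<Rightarrow> 'z" where "jZ \<equiv> (\<lambda>(x,y,z,u,w). z)"
abbreviation jU :: "'x \<times> 'y \<times> 'z \<times> 'u \<times> 'w \<Rightarrow> 'u" where "jU \<equiv> (\<lambda>(x,y,z,u,w). u)"
abbreviation jW :: "'x \<times> 'y \<times> 'z \<times> 'u \<times> 'w \<Rightarrow> 'w" where "jW \<equiv> (\<lambda>(x,y,z,u,w). w)"

lemmas pmf_monad = map_bind_pmf bind_assoc_pmf bind_map_pmf map_pmf_def bind_return_pmf case_prod_unfold

text \<open>Making one draw last shows what it depends on. The factorisations from here to
  \<open>joint5_Z_X\<close> express the Markov properties of U, W and Z that turn the channel
  probabilities into ratios of marginals.\<close>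

lemma joint5_U_YZ: "map_pmf (\<lambda>\<omega>. (jU \<omega>, (jY \<omega>, jZ \<omega>))) (joint5 pXY pZ qU qW) =
  bind_pmf (map_pmf (\<lambda>\<omega>. (jY \<omega>, jZ \<omega>)) (joint5 pXY pZ qU qW)) (\<lambda>v. map_pmf (\<lambda>u. (u, v)) (qU (fst v)))"
  by (simp add: joint5_def pmf_monad)

lemma joint5_W_XUZ: "map_pmf (\<lambda>\<omega>. (jW \<omega>, (jX \<omega>, jU \<omega>, jZ \<omega>))) (joint5 pXY pZ qU qW) =
  bind_pmf (map_pmf (\<lambda>\<omega>. (jX \<omega>, jU \<omega>, jZ \<omega>)) (joint5 pXY pZ qU qW))
    (\<lambda>v. map_pmf (\<lambda>w. (w, v)) (qW (fst v) (fst (snd v))))"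
  by (simp add: joint5_def pmf_monad)

lemma joint5_Z_UX: "map_pmf (\<lambda>\<omega>. (jZ \<omega>, (jU \<omega>, jX \<omega>))) (joint5 pXY pZ qU qW) =
  bind_pmf (map_pmf (\<lambda>\<omega>. (jU \<omega>, jX \<omega>)) (joint5 pXY pZ qU qW)) (\<lambda>v. map_pmf (\<lambda>z. (z, v)) (pZ (snd v)))"
  by (simp add: joint5_def pmf_monad) (intro bind_pmf_cong refl, rule bind_commute_pmf)

lemma joint5_Z_X: "map_pmf (\<lambda>\<omega>. (jZ \<omega>, jX \<omega>)) (joint5 pXY pZ qU qW) =
  bind_pmf (map_pmf jX (joint5 pXY pZ qU qW)) (\<lambda>v. map_pmf (\<lambda>z. (z, v)) (pZ v))"
  by (simp add: joint5_def pmf_monad)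

lemma joint5_src: "joint5 pXY pZ qU qW = bind_pmf (src pXY pZ) (\<lambda>(x,y,z). bind_pmf (qU y) (\<lambda>u. bind_pmf (qW x u) (\<lambda>w. return_pmf (x,y,z,u,w))))"
  by (simp add: joint5_def src_def bind_assoc_pmf bind_return_pmf case_prod_unfold)

lemma set_joint5: "(x, y, z, u, w) \<in> set_pmf (joint5 pXY pZ qU qW) \<longleftrightarrow>
   (x, y, z) \<in> set_pmf (src pXY pZ) \<and> u \<in> set_pmf (qU y) \<and> w \<in> set_pmf (qW x u)"
  unfolding joint5_src by (force simp: case_prod_unfold)

context
  fixes pXY :: "('x::finite \<times> 'y::finite) pmf" and pZ :: "'x \<Rightarrow> 'z::finite pmf"
    and qU :: "'y \<Rightarrow> nat pmf" and qW :: "'x \<Rightarrow> nat \<Rightarrow> nat pmf"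
  assumes finU: "finite (\<Union>y. set_pmf (qU y))" and finW: "finite (\<Union>x u. set_pmf (qW x u))"
begin

abbreviation "J5 \<equiv> joint5 pXY pZ qU qW"
abbreviation "marg f \<omega> \<equiv> pmf (map_pmf f J5) (f \<omega>)"

lemma finite_joint5: "finite (set_pmf J5)"
proof (rule finite_subset)
  show "set_pmf J5 \<subseteq> UNIV \<times> UNIV \<times> UNIV \<times> (\<Union>y. set_pmf (qU y)) \<times> (\<Union>x u. set_pmf (qW x u))"
    by (clarsimp simp: set_joint5) blast
qed (use finU finW in auto)

lemma qU_eq_YZ:
  assumes "\<omega> \<in> set_pmf J5"
  shows "pmf (qU (jY \<omega>)) (jU \<omega>) = marg (\<lambda>\<omega>. (jU \<omega>, jY \<omega>, jZ \<omega>)) \<omega> / marg (\<lambda>\<omega>. (jY \<omega>, jZ \<omega>)) \<omega>"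
  using pmf_map_pos[OF assms, of "\<lambda>\<omega>. (jY \<omega>, jZ \<omega>)"]
  by (simp add: joint5_U_YZ pmf_bind_map_pair)

lemma qW_eq:
  assumes "\<omega> \<in> set_pmf J5"
  shows "pmf (qW (jX \<omega>) (jU \<omega>)) (jW \<omega>) =
    marg (\<lambda>\<omega>. (jX \<omega>, jW \<omega>, (jU \<omega>, jZ \<omega>))) \<omega> / marg (\<lambda>\<omega>. (jX \<omega>, (jU \<omega>, jZ \<omega>))) \<omega>"
proof -
  have "marg (\<lambda>\<omega>. (jX \<omega>, jW \<omega>, (jU \<omega>, jZ \<omega>))) \<omega> = marg (\<lambda>\<omega>. (jW \<omega>, (jX \<omega>, jU \<omega>, jZ \<omega>))) \<omega>"
    by (rule pmf_map_kernel_cong) auto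
  then show ?thesis
    using pmf_map_pos[OF assms, of "\<lambda>\<omega>. (jX \<omega>, jU \<omega>, jZ \<omega>)"]
    by (simp add: joint5_W_XUZ pmf_bind_map_pair)
qed

text \<open>Z is produced from X alone, so it adds nothing about U once X is known. With Z inserted,
  the encoder's ratio can be compared with quantities conditioned on Z.\<close>

lemma U_given_XZ:
  assumes "\<omega> \<in> set_pmf J5"
  shows "marg (\<lambda>\<omega>. (jU \<omega>, jX \<omega>, jZ \<omega>)) \<omega> / marg (\<lambda>\<omega>. (jX \<omega>, jZ \<omega>)) \<omega> = marg (\<lambda>\<omega>. (jU \<omega>, jX \<omega>)) \<omega> / marg jX \<omega>"
proof -
  have "marg (\<lambda>\<omega>. (jU \<omega>, jX \<omega>, jZ \<omega>)) \<omega> = marg (\<lambda>\<omega>. (jZ \<omega>, (jU \<omega>, jX \<omega>))) \<omega>"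
    "marg (\<lambda>\<omega>. (jX \<omega>, jZ \<omega>)) \<omega> = marg (\<lambda>\<omega>. (jZ \<omega>, jX \<omega>)) \<omega>"
    by (rule pmf_map_kernel_cong; auto)+
  moreover have "marg (\<lambda>\<omega>. (jZ \<omega>, jX \<omega>)) \<omega> > 0" by (rule pmf_map_pos[OF assms])
  ultimately show ?thesis
    by (auto simp: joint5_Z_UX joint5_Z_X pmf_bind_map_pair)
qed

lemma expectation_log_pm: "measure_pmf.expectation J5 (\<lambda>\<omega>. log 2 (marg f \<omega>)) = - ent (map_pmf f J5)"
  by (simp add: expectation_eq_sum ent_map_pmf finite_joint5)

text \<open>\<open>r\<close> is a quotient of two conditional probabilities, so its mean logarithm
  is a difference of two conditional entropies. All three likelihood ratios of the code have this
  form.\<close>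

lemma mean_log_ratio:
  assumes "\<And>\<omega>. \<omega> \<in> set_pmf J5 \<Longrightarrow> r \<omega> = marg a \<omega> / marg b \<omega> / (marg c \<omega> / marg e \<omega>)"
  shows "measure_pmf.expectation J5 (\<lambda>\<omega>. log 2 (r \<omega>)) =
    ent (map_pmf b J5) + ent (map_pmf c J5) - ent (map_pmf a J5) - ent (map_pmf e J5)"
proof -
  have "measure_pmf.expectation J5 (\<lambda>\<omega>. log 2 (r \<omega>)) =
    measure_pmf.expectation J5 (\<lambda>\<omega>. log 2 (marg a \<omega>) - log 2 (marg b \<omega>) - (log 2 (marg c \<omega>) - log 2 (marg e \<omega>)))"
    unfolding expectation_eq_sum[OF finite_joint5]
  proof (intro sum.cong refl arg_cong[of _ _ "(*) _"])
    fix \<omega> assume w: "\<omega> \<in> set_pmf J5"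
    show "log 2 (r \<omega>) = log 2 (marg a \<omega>) - log 2 (marg b \<omega>) - (log 2 (marg c \<omega>) - log 2 (marg e \<omega>))"
      unfolding assms[OF w]
      using pmf_map_pos[OF w, of a] pmf_map_pos[OF w, of b] pmf_map_pos[OF w, of c] pmf_map_pos[OF w, of e]
      by (simp add: log_divide log_mult)
  qed
  then show ?thesis
    using integrable_finite_pmf[OF finite_joint5] by (simp add: expectation_log_pm)
qed

abbreviation "cX \<equiv> condk J5 jX jU"
abbreviation "cZ \<equiv> condk J5 jZ jU"
abbreviation "cUZ \<equiv> condk J5 (\<lambda>\<omega>. (jU \<omega>, jZ \<omega>)) jW"
abbreviation "rX \<omega> \<equiv> pmf (qU (jY \<omega>)) (jU \<omega>) / pmf (cX (jX \<omega>)) (jU \<omega>)"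
abbreviation "rZ \<omega> \<equiv> pmf (qU (jY \<omega>)) (jU \<omega>) / pmf (cZ (jZ \<omega>)) (jU \<omega>)"
abbreviation "rW \<omega> \<equiv> pmf (qW (jX \<omega>) (jU \<omega>)) (jW \<omega>) / pmf (cUZ (jU \<omega>, jZ \<omega>)) (jW \<omega>)"

lemma mean_rZ: "measure_pmf.expectation J5 (\<lambda>\<omega>. log 2 (rZ \<omega>)) = cmi J5 jU jY jZ"
  using mean_log_ratio[of rZ "\<lambda>\<omega>. (jU \<omega>, jY \<omega>, jZ \<omega>)" "\<lambda>\<omega>. (jY \<omega>, jZ \<omega>)" "\<lambda>\<omega>. (jU \<omega>, jZ \<omega>)" jZ]
  by (simp add: qU_eq_YZ pmf_condk cmi_def)

text \<open>The gap between the two sides is exactly I(U;X|Z). Hence a number of messages that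
  suffices for the decoder also suffices for the encoder.\<close>

lemma mean_rX: "measure_pmf.expectation J5 (\<lambda>\<omega>. log 2 (rX \<omega>)) \<le> cmi J5 jU jY jZ"
proof -
  have "measure_pmf.expectation J5 (\<lambda>\<omega>. log 2 (rX \<omega>)) =
    ent (map_pmf (\<lambda>\<omega>. (jY \<omega>, jZ \<omega>)) J5) + ent (map_pmf (\<lambda>\<omega>. (jU \<omega>, jX \<omega>, jZ \<omega>)) J5)
     - ent (map_pmf (\<lambda>\<omega>. (jU \<omega>, jY \<omega>, jZ \<omega>)) J5) - ent (map_pmf (\<lambda>\<omega>. (jX \<omega>, jZ \<omega>)) J5)"
    by (rule mean_log_ratio) (simp only: qU_eq_YZ pmf_condk U_given_XZ)
  moreover have "0 \<le> cmi J5 jU jX jZ" by (rule cmi_nonneg[OF finite_joint5])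
  ultimately show ?thesis by (simp add: cmi_def)
qed

lemma mean_rW: "measure_pmf.expectation J5 (\<lambda>\<omega>. log 2 (rW \<omega>)) = cmi J5 jX jW (\<lambda>\<omega>. (jU \<omega>, jZ \<omega>))"
proof -
  have "measure_pmf.expectation J5 (\<lambda>\<omega>. log 2 (rW \<omega>)) =
    ent (map_pmf (\<lambda>\<omega>. (jX \<omega>, (jU \<omega>, jZ \<omega>))) J5) + ent (map_pmf (\<lambda>\<omega>. (jW \<omega>, (jU \<omega>, jZ \<omega>))) J5)
     - ent (map_pmf (\<lambda>\<omega>. (jX \<omega>, jW \<omega>, (jU \<omega>, jZ \<omega>))) J5) - ent (map_pmf (\<lambda>\<omega>. (jU \<omega>, jZ \<omega>)) J5)"
  proof (rule mean_log_ratio)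
    fix \<omega> assume w: "\<omega> \<in> set_pmf J5"
    show "rW \<omega> = marg (\<lambda>\<omega>. (jX \<omega>, jW \<omega>, (jU \<omega>, jZ \<omega>))) \<omega> / marg (\<lambda>\<omega>. (jX \<omega>, (jU \<omega>, jZ \<omega>))) \<omega> /
      (marg (\<lambda>\<omega>. (jW \<omega>, (jU \<omega>, jZ \<omega>))) \<omega> / marg (\<lambda>\<omega>. (jU \<omega>, jZ \<omega>)) \<omega>)"
      unfolding qW_eq[OF w] pmf_condk[OF w, of "\<lambda>\<omega>. (jU \<omega>, jZ \<omega>)"] ..
  qed
  then show ?thesis by (simp add: cmi_def)
qed

lemma ratio_pos:
  assumes "\<omega> \<in> set_pmf J5"
  shows "rX \<omega> > 0" "rZ \<omega> > 0" "rW \<omega> > 0"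
proof -
  have "jU \<omega> \<in> set_pmf (qU (jY \<omega>))" "jW \<omega> \<in> set_pmf (qW (jX \<omega>) (jU \<omega>))"
    using assms by (auto simp: set_joint5 split: prod.splits)
  then show "rX \<omega> > 0" "rZ \<omega> > 0" "rW \<omega> > 0"
    using condk_in[OF assms, of jU jX] condk_in[OF assms, of jU jZ] condk_in[OF assms, of jW "\<lambda>\<omega>. (jU \<omega>, jZ \<omega>)"]
    by (auto intro!: divide_pos_pos pmf_positive)
qed

text \<open>The one-shot code is applied to blocks of length \<open>n\<close> with product channels.
  The likelihood ratios become products over the letters, and the Chebyshev bound is used with
  \<open>V\<close> as variance.\<close>

lemma block_code:
  fixes d :: "'x \<Rightarrow> 'xh::finite \<Rightarrow> real" and xhat :: "nat \<Rightarrow> nat \<Rightarrow> 'z \<Rightarrow> 'xh"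
  assumes d0: "\<And>a b. d a b \<ge> 0" and dmax: "\<And>a b. d a b \<le> dmax"
    and n: "n > 0" and M: "M > 0" and Md: "Md > 0" and eps: "\<epsilon> > 0"
  defines "V \<equiv> (\<lambda>r :: _ \<Rightarrow> real. measure_pmf.expectation J5 (\<lambda>a. (log 2 (r a) - measure_pmf.expectation J5 (\<lambda>a. log 2 (r a)))\<^sup>2))"
  shows "is_code pXY pZ d n M Md Md
    (measure_pmf.expectation J5 (\<lambda>(x,y,z,u,w). d x (xhat u w z)) + dmax *
      ((V rX / (n * \<epsilon>\<^sup>2) + 1 / Md * 2 powr (n * (cmi J5 jU jY jZ + \<epsilon>))) +
       (V rZ / (n * \<epsilon>\<^sup>2) + 1 / Md * 2 powr (n * (cmi J5 jU jY jZ + \<epsilon>))) +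
       (V rW / (n * \<epsilon>\<^sup>2) + 1 / M * 2 powr (n * (cmi J5 jX jW (\<lambda>\<omega>. (jU \<omega>, jZ \<omega>)) + \<epsilon>)))))"
    (is "is_code _ _ _ _ _ _ _ ?bound")
proof -
  let ?S0 = "src pXY pZ"
  define tri where "tri = (\<lambda>t :: ('x \<times> 'y \<times> 'z) list. (map fst t, map (fst \<circ> snd) t, map (snd \<circ> snd) t))"
  define S where "S = map_pmf tri (iid n ?S0)"
  \<comment> \<open>The letter 0 is included because \<open>condk\<close> falls back to it off its
    support, and the finite alphabet must contain the conditional laws at every argument that can
    arise.\<close>
  define Us where "Us = {us. set us \<subseteq> insert 0 (jU ` set_pmf J5) \<and> length us = n}"
  define Ws where "Ws = {ws. set ws \<subseteq> insert 0 (\<Union>x u. set_pmf (qW x u)) \<and> length ws = n}"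
  define E where "E = (\<lambda>xs us. kerlist (case_prod qW) (zip xs us))"
  define F where "F = (\<lambda>us zs. kerlist cUZ (zip us zs))"
  define dst where "dst = (\<lambda>xs xh. (1 / real n) * (\<Sum>i<n. d (xs ! i) (xh ! i)))"
  define g0 where "g0 = (\<lambda>us ws zs. map (\<lambda>i. xhat (us ! i) (ws ! i) (zs ! i)) [0..<n])"
  have finS0: "finite (set_pmf ?S0)" by simp
  have finS: "finite (set_pmf S)" using finite_set_pmf_iid[OF finS0] by (simp add: S_def)
  have finJ: "finite (set_pmf J5)" by (rule finite_joint5)
  have finUs: "finite Us" "finite Ws" using finJ finW by (auto simp: Us_def Ws_def intro!: finite_lists_length_eq)
  have set_kerlist: "set_pmf (kerlist K ts) \<subseteq> {bs. set bs \<subseteq> Q \<and> length bs = length ts}"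
    if "\<And>t. t \<in> set ts \<Longrightarrow> set_pmf (K t) \<subseteq> Q" for K :: "'q \<Rightarrow> nat pmf" and ts Q
    using that unfolding set_pmf_kerlist
    by (auto simp: list_all2_conv_all_nth in_set_conv_nth) (metis nth_mem subsetD)
  have kerlist_mono: "set_pmf (kerlist K ts) \<subseteq> set_pmf (kerlist L ts')"
    if "length ts = length ts'" "\<And>i. i < length ts \<Longrightarrow> set_pmf (K (ts ! i)) \<subseteq> set_pmf (L (ts' ! i))"
    for K :: "'q \<Rightarrow> nat pmf" and L :: "'r \<Rightarrow> nat pmf" and ts ts'
    using that unfolding set_pmf_kerlist by (auto simp: list_all2_conv_all_nth) blast
  have SD: "\<exists>t. x = map fst t \<and> y = map (fst \<circ> snd) t \<and> z = map (snd \<circ> snd) t \<and> length t = n \<and> set t \<subseteq> set_pmf ?S0"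
    if "(x, y, z) \<in> set_pmf S" for x y z
    using that by (auto simp: S_def tri_def set_pmf_iid)
  have exW: "\<exists>w. w \<in> set_pmf (qW x u)" for x u using set_pmf_not_empty by fast
  have qU_J: "u \<in> jU ` set_pmf J5 \<and> u \<in> set_pmf (cX x) \<and> u \<in> set_pmf (cZ z)"
    if "(x, y, z) \<in> set_pmf ?S0" "u \<in> set_pmf (qU y)" for x y z u
  proof -
    obtain w where "w \<in> set_pmf (qW x u)" using exW by blast
    then have J5: "(x, y, z, u, w) \<in> set_pmf J5" using that by (simp add: set_joint5)
    show ?thesis using condk_in[OF J5, of jU jX] condk_in[OF J5, of jU jZ] image_eqI[OF _ J5, of u jU] by simp
  qed
  have qW_J: "w \<in> set_pmf (cUZ (u, z))"
    if "(x, y, z) \<in> set_pmf ?S0" "u \<in> set_pmf (qU y)" "w \<in> set_pmf (qW x u)" for x y z u w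
  proof -
    have J5: "(x, y, z, u, w) \<in> set_pmf J5" using that by (simp add: set_joint5)
    show ?thesis using condk_in[OF J5, of jW "\<lambda>\<omega>. (jU \<omega>, jZ \<omega>)"] by simp
  qed
  have jW_sub: "jW ` set_pmf J5 \<subseteq> (\<Union>x u. set_pmf (qW x u))"
    by (clarsimp simp: set_joint5) blast
  have "\<exists>fd f g. (\<forall>y. fd y \<in> {1..Md}) \<and> (\<forall>x m. f x m \<in> {1..M}) \<and>
     (\<forall>a b z. \<exists>u w. g a b z = g0 u w z) \<and>
     measure_pmf.expectation S (\<lambda>(x, y, z). dst x (g (f x (fd y)) (fd y) z)) \<le>
     measure_pmf.expectation S (\<lambda>(x, y, z). measure_pmf.expectation (kerlist qU y) (\<lambda>u.
       measure_pmf.expectation (E x u) (\<lambda>w. dst x (g0 u w z) + dmax *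
         (min 1 (pmf (kerlist qU y) u / (Md * pmf (kerlist cX x) u)) + min 1 (pmf (kerlist qU y) u / (Md * pmf (kerlist cZ z) u))
          + min 1 (pmf (E x u) w / (M * pmf (F u z) w))))))"
  proof (rule one_shot_coding[OF finS finUs])
    show "Us \<noteq> {}" by (auto simp: Us_def intro!: exI[of _ "replicate n 0"])
  next
    fix x y z u assume s: "(x, y, z) \<in> set_pmf S" and u: "u \<in> Us"
    obtain t where t: "x = map fst t" "y = map (fst \<circ> snd) t" "z = map (snd \<circ> snd) t" "length t = n" "set t \<subseteq> set_pmf ?S0"
      using SD[OF s] by blast
    have "set_pmf (kerlist qU y) \<subseteq> {bs. set bs \<subseteq> insert 0 (jU ` set_pmf J5) \<and> length bs = length y}"
      using t by (intro set_kerlist) (auto dest!: qU_J)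
    moreover have "set_pmf (kerlist cX x) \<subseteq> {bs. set bs \<subseteq> insert 0 (jU ` set_pmf J5) \<and> length bs = length x}"
      "set_pmf (kerlist cZ z) \<subseteq> {bs. set bs \<subseteq> insert 0 (jU ` set_pmf J5) \<and> length bs = length z}"
      by (intro set_kerlist set_condk)+
    moreover have "set_pmf (E x u) \<subseteq> {bs. set bs \<subseteq> insert 0 (\<Union>x u. set_pmf (qW x u)) \<and> length bs = length (zip x u)}"
      unfolding E_def by (intro set_kerlist) (auto simp: case_prod_unfold)
    moreover have "set_pmf (F u z) \<subseteq> {bs. set bs \<subseteq> insert 0 (\<Union>x u. set_pmf (qW x u)) \<and> length bs = length (zip u z)}"
      unfolding F_def by (intro set_kerlist order.trans[OF set_condk]) (use jW_sub in blast)
    ultimately show "set_pmf (kerlist qU y) \<subseteq> Us \<and> set_pmf (kerlist cX x) \<subseteq> Us \<and> set_pmf (kerlist cZ z) \<subseteq> Us \<and>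
        set_pmf (E x u) \<subseteq> Ws \<and> set_pmf (F u z) \<subseteq> Ws"
      using t u by (simp add: Us_def Ws_def)
  next
    fix x y z assume s: "(x, y, z) \<in> set_pmf S"
    obtain t where t: "x = map fst t" "y = map (fst \<circ> snd) t" "z = map (snd \<circ> snd) t" "length t = n" "set t \<subseteq> set_pmf ?S0"
      using SD[OF s] by blast
    have ti: "(x ! i, y ! i, z ! i) \<in> set_pmf ?S0" if "i < n" for i
      using t that nth_mem[of i t] by (auto simp: comp_def)
    show "set_pmf (kerlist qU y) \<subseteq> set_pmf (kerlist cX x) \<inter> set_pmf (kerlist cZ z)"
      by (intro Int_greatest kerlist_mono) (use t ti in \<open>auto dest!: qU_J simp del: nth_map\<close>)
    show "set_pmf (E x u) \<subseteq> set_pmf (F u z)" if u: "u \<in> set_pmf (kerlist qU y)" for u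
    proof -
      have u': "length u = n" "\<And>i. i < n \<Longrightarrow> u ! i \<in> set_pmf (qU (y ! i))"
        using u t by (auto simp: set_pmf_kerlist list_all2_conv_all_nth)
      have l: "length x = n" "length z = n" using t by auto
      show ?thesis unfolding E_def F_def
      proof (rule kerlist_mono)
        fix i assume i: "i < length (zip x u)"
        show "set_pmf (case zip x u ! i of (x, u) \<Rightarrow> qW x u) \<subseteq> set_pmf (cUZ (zip u z ! i))"
          using i l u' qW_J[OF ti[of i] u'(2)[of i]] by auto
      qed (use l u' in auto)
    qed
  next
    show "0 \<le> dst x h" for x h by (auto simp: dst_def d0 sum_nonneg)
    have "(\<Sum>i<n. d (x ! i) (h ! i)) \<le> n * dmax" for x h
      using sum_bounded_above[of "{..<n}" "\<lambda>i. d (x ! i) (h ! i)" dmax] dmax by simp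
    then show "dst x h \<le> dmax" for x h using n by (simp add: dst_def field_simps)
  qed (use M Md in auto)
  then obtain fd f g where fdr: "\<And>y. fd y \<in> {1..Md}" and fr: "\<And>x m. f x m \<in> {1..M}"
    and gr: "\<And>a b z. \<exists>u w. g a b z = g0 u w z"
    and dle: "measure_pmf.expectation S (\<lambda>(x, y, z). dst x (g (f x (fd y)) (fd y) z)) \<le>
     measure_pmf.expectation S (\<lambda>(x, y, z). measure_pmf.expectation (kerlist qU y) (\<lambda>u.
       measure_pmf.expectation (E x u) (\<lambda>w. dst x (g0 u w z) + dmax *
         (min 1 (pmf (kerlist qU y) u / (Md * pmf (kerlist cX x) u)) + min 1 (pmf (kerlist qU y) u / (Md * pmf (kerlist cZ z) u))
          + min 1 (pmf (E x u) w / (M * pmf (F u z) w))))))"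
    by blast
  define H where "H = (\<lambda>(x, y, z, u, w). dst x (g0 u w z) + dmax *
         (min 1 (pmf (kerlist qU y) u / (Md * pmf (kerlist cX x) u)) + min 1 (pmf (kerlist qU y) u / (Md * pmf (kerlist cZ z) u))
          + min 1 (pmf (E x u) w / (M * pmf (F u z) w))))"
  have finK: "finite (set_pmf (kerlist K ts))" if "\<And>t. t \<in> set ts \<Longrightarrow> finite (set_pmf (K t))" for K :: "'q \<Rightarrow> nat pmf" and ts
    using that by (induction ts) auto
  have finqU: "finite (set_pmf (qU y))" for y using finU by (rule rev_finite_subset) auto
  have finqW: "finite (set_pmf (qW x u))" for x u using finW by (rule rev_finite_subset) auto
  have "measure_pmf.expectation S (\<lambda>(x, y, z). measure_pmf.expectation (kerlist qU y) (\<lambda>u.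
       measure_pmf.expectation (E x u) (\<lambda>w. H (x, y, z, u, w)))) =
     measure_pmf.expectation (map_pmf unzip5 (iid n J5)) H"
    unfolding unzip5_iid_joint5 S_def integral_map_pmf tri_def prod.case
    by (subst expectation_bind_finite expectation_bind_finite[OF finK] finite_set_pmf_iid[OF finS0];
        (intro finite_set_pmf_iid finS0 finK finqU)?)+
      (simp_all add: E_def expectation_bind_finite finK finqU finqW case_prod_unfold finite_set_pmf_iid)
  \<comment> \<open>Distortion averages and likelihood ratios both split over the letters.\<close>
  also have "\<dots> = measure_pmf.expectation (iid n J5) (\<lambda>t. (1 / n) * sum_list (map (\<lambda>(x,y,z,u,w). d x (xhat u w z)) t) +
      dmax * (min 1 (1 / Md * prod_list (map rX t)) + min 1 (1 / Md * prod_list (map rZ t)) + min 1 (1 / M * prod_list (map rW t))))"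
    unfolding integral_map_pmf expectation_eq_sum[OF finite_set_pmf_iid[OF finJ]]
  proof (intro sum.cong refl arg_cong[of _ _ "(*) _"])
    fix t assume "t \<in> set_pmf (iid n J5)"
    then have t: "length t = n" by (simp add: set_pmf_iid)
    have zips: "zip (map jX t) (map jU t) = map (\<lambda>\<omega>. (jX \<omega>, jU \<omega>)) t" "zip (map jU t) (map jZ t) = map (\<lambda>\<omega>. (jU \<omega>, jZ \<omega>)) t"
      by (simp_all add: zip_map_map zip_same_conv_map)
    have "dst (map jX t) (g0 (map jU t) (map jW t) (map jZ t)) = (1 / n) * sum_list (map (\<lambda>(x,y,z,u,w). d x (xhat u w z)) t)"
      unfolding dst_def g0_def using t
      by (simp add: sum_list_sum_nth atLeast0LessThan case_prod_unfold)
    moreover have "pmf (kerlist qU (map jY t)) (map jU t) / (Md * pmf (kerlist cX (map jX t)) (map jU t)) = 1 / Md * prod_list (map rX t)"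
      "pmf (kerlist qU (map jY t)) (map jU t) / (Md * pmf (kerlist cZ (map jZ t)) (map jU t)) = 1 / Md * prod_list (map rZ t)"
      "pmf (E (map jX t) (map jU t)) (map jW t) / (M * pmf (F (map jU t) (map jZ t)) (map jW t)) = 1 / M * prod_list (map rW t)"
      unfolding E_def F_def zips pmf_kerlist_map prod_list_divide[symmetric] by simp_all
    ultimately show "H (unzip5 t) = (1 / n) * sum_list (map (\<lambda>(x,y,z,u,w). d x (xhat u w z)) t) +
      dmax * (min 1 (1 / Md * prod_list (map rX t)) + min 1 (1 / Md * prod_list (map rZ t)) + min 1 (1 / M * prod_list (map rW t)))"
      unfolding H_def unzip5_def prod.case by (simp only:)
  qed
  also have "\<dots> = measure_pmf.expectation J5 (\<lambda>(x,y,z,u,w). d x (xhat u w z)) + dmax * (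
      measure_pmf.expectation (iid n J5) (\<lambda>t. min 1 (1 / Md * prod_list (map rX t))) +
      measure_pmf.expectation (iid n J5) (\<lambda>t. min 1 (1 / Md * prod_list (map rZ t))) +
      measure_pmf.expectation (iid n J5) (\<lambda>t. min 1 (1 / M * prod_list (map rW t))))"
    using integrable_finite_pmf[OF finite_set_pmf_iid[OF finJ, of n]] n
    by (simp add: expectation_iid_sum_list[OF finJ])
  also have "\<dots> \<le> ?bound"
  proof (intro add_left_mono mult_left_mono add_mono)
    have bnd: "measure_pmf.expectation (iid n J5) (\<lambda>t. min 1 (1 / K * prod_list (map r t))) \<le>
      V r / (n * \<epsilon>\<^sup>2) + 1 / K * 2 powr (n * (\<mu> + \<epsilon>))"
      if "\<And>\<omega>. \<omega> \<in> set_pmf J5 \<Longrightarrow> r \<omega> > 0" "measure_pmf.expectation J5 (\<lambda>a. log 2 (r a)) \<le> \<mu>" "K > 0" for r \<mu> and K :: real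
    proof -
      have "measure_pmf.expectation (iid n J5) (\<lambda>t. min 1 (1 / K * prod_list (map r t))) \<le>
        V r / (n * \<epsilon>\<^sup>2) + 1 / K * 2 powr (n * (measure_pmf.expectation J5 (\<lambda>a. log 2 (r a)) + \<epsilon>))"
        unfolding V_def using that eps n by (intro iid_min_one_prod_le[OF finJ]) auto
      also have "\<dots> \<le> V r / (n * \<epsilon>\<^sup>2) + 1 / K * 2 powr (n * (\<mu> + \<epsilon>))"
        using that by (intro add_left_mono mult_left_mono powr_mono) auto
      finally show ?thesis .
    qed
    show "measure_pmf.expectation (iid n J5) (\<lambda>t. min 1 (1 / Md * prod_list (map rX t))) \<le>
      V rX / (n * \<epsilon>\<^sup>2) + 1 / Md * 2 powr (n * (cmi J5 jU jY jZ + \<epsilon>))"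
      by (rule bnd[OF ratio_pos(1) mean_rX]) (use Md in auto)
    show "measure_pmf.expectation (iid n J5) (\<lambda>t. min 1 (1 / Md * prod_list (map rZ t))) \<le>
      V rZ / (n * \<epsilon>\<^sup>2) + 1 / Md * 2 powr (n * (cmi J5 jU jY jZ + \<epsilon>))"
      by (rule bnd[OF ratio_pos(2) eq_refl[OF mean_rZ]]) (use Md in auto)
    show "measure_pmf.expectation (iid n J5) (\<lambda>t. min 1 (1 / M * prod_list (map rW t))) \<le>
      V rW / (n * \<epsilon>\<^sup>2) + 1 / M * 2 powr (n * (cmi J5 jX jW (\<lambda>\<omega>. (jU \<omega>, jZ \<omega>)) + \<epsilon>))"
      by (rule bnd[OF ratio_pos(3) eq_refl[OF mean_rW]]) (use M in auto)
    show "0 \<le> dmax" using d0 dmax order.trans by blast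
  qed
  finally have "measure_pmf.expectation S (\<lambda>(x, y, z). dst x (g (f x (fd y)) (fd y) z)) \<le> ?bound"
    using dle unfolding H_def prod.case by linarith
  also have "measure_pmf.expectation S (\<lambda>(x, y, z). dst x (g (f x (fd y)) (fd y) z)) =
    measure_pmf.expectation (iid n ?S0) (\<lambda>t. let xs = map fst t; ys = map (fst \<circ> snd) t; zs = map (snd \<circ> snd) t;
                 xh = g (f xs (fd ys)) (fd ys) zs
             in (1 / real n) * (\<Sum>i<n. d (xs ! i) (xh ! i)))"
    by (simp add: S_def tri_def dst_def Let_def)
  finally have le: "measure_pmf.expectation (iid n ?S0) (\<lambda>t. let xs = map fst t; ys = map (fst \<circ> snd) t; zs = map (snd \<circ> snd) t;
                 xh = g (f xs (fd ys)) (fd ys) zs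
             in (1 / real n) * (\<Sum>i<n. d (xs ! i) (xh ! i))) \<le> ?bound" .
  have len: "length (g a b z) = n" for a b z
  proof -
    obtain u w where "g a b z = g0 u w z" using gr by blast
    then show ?thesis by (simp add: g0_def)
  qed
  show ?thesis
    unfolding is_code_def
    by (rule exI[of _ fd], rule exI[of _ fd], rule exI[of _ f], rule exI[of _ g])
      (intro conjI allI impI fdr fr len le)
qed

lemma achievable_joint5:
  fixes d :: "'x \<Rightarrow> 'xh::finite \<Rightarrow> real" and xhat :: "nat \<Rightarrow> nat \<Rightarrow> 'z \<Rightarrow> 'xh"
  assumes d0: "\<And>a b. d a b \<ge> 0" and Re: "R_e \<ge> R_d" and Rd0: "R_d \<ge> 0"
    and Rd: "R_d \<ge> cmi J5 jU jY jZ" and R: "R \<ge> cmi J5 jX jW (\<lambda>\<omega>. (jU \<omega>, jZ \<omega>))"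
    and D: "measure_pmf.expectation J5 (\<lambda>(x,y,z,u,w). d x (xhat u w z)) \<le> D"
  shows "achievable pXY pZ d D R R_e R_d"
  unfolding achievable_def
proof (intro allI impI)
  fix \<delta> :: real assume \<delta>: "\<delta> > 0"
  \<comment> \<open>Half of the slack absorbs the deviation of the log-likelihood ratios; the other
    half leaves the decay 2 powr (- n \<epsilon>).\<close>
  define \<epsilon> where "\<epsilon> = \<delta> / 2"
  have eps: "\<epsilon> > 0" using \<delta> by (simp add: \<epsilon>_def)
  define dmax where "dmax = (\<Sum>a\<in>UNIV. \<Sum>b\<in>UNIV. d a b)"
  have dmax: "d a b \<le> dmax" for a b
  proof -
    have "d a b \<le> (\<Sum>b\<in>UNIV. d a b)" using d0 by (intro member_le_sum) auto
    also have "\<dots> \<le> dmax" unfolding dmax_def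
      using d0 by (intro member_le_sum[of a UNIV "\<lambda>a. \<Sum>b\<in>UNIV. d a b"]) (auto intro: sum_nonneg)
    finally show ?thesis .
  qed
  have dmax0: "dmax \<ge> 0" using d0 by (auto simp: dmax_def intro!: sum_nonneg)
  define V where "V = (\<lambda>r :: _ \<Rightarrow> real. measure_pmf.expectation J5 (\<lambda>a. (log 2 (r a) - measure_pmf.expectation J5 (\<lambda>a. log 2 (r a)))\<^sup>2))"
  define err where "err = (\<lambda>n. dmax * ((V rX / (n * \<epsilon>\<^sup>2) + 2 * 2 powr (- n * \<epsilon>)) + (V rZ / (n * \<epsilon>\<^sup>2) + 2 * 2 powr (- n * \<epsilon>)) +
      (V rW / (n * \<epsilon>\<^sup>2) + 2 * 2 powr (- n * \<epsilon>))))"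
  have lim: "((\<lambda>n. v / (real n * \<epsilon>\<^sup>2) + 2 * 2 powr (- real n * \<epsilon>)) \<longlongrightarrow> 0) sequentially" for v
    using eps by real_asymp
  have "((\<lambda>n. err (real n)) \<longlongrightarrow> dmax * (0 + 0 + 0)) sequentially"
    unfolding err_def by (intro tendsto_mult tendsto_add tendsto_const lim)
  then have "eventually (\<lambda>n. err (real n) < \<delta>) sequentially"
    using \<delta> by (intro order_tendstoD(2)[of _ 0]) simp_all
  then obtain N where N: "\<And>n. n \<ge> N \<Longrightarrow> err (real n) < \<delta>"
    by (auto simp: eventually_sequentially)
  show "\<exists>N. \<forall>n\<ge>N. n > 0 \<and> (\<exists>M Me Md. real M \<le> 2 powr (real n * (R + \<delta>)) \<and>
      real Me \<le> 2 powr (real n * (R_e + \<delta>)) \<and> real Md \<le> 2 powr (real n * (R_d + \<delta>)) \<and>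
      is_code pXY pZ d n M Me Md (D + \<delta>))"
  proof (rule exI[of _ "max N 1"], intro allI impI conjI)
    fix n assume n: "n \<ge> max N 1"
    then show n0: "n > 0" by simp
    \<comment> \<open>Rounding down costs at most a factor 2, because a real number that is at least
      1 is at most twice its floor. This is the leading 2 in \<open>err\<close>.\<close>
    define fl where "fl = (\<lambda>r. nat \<lfloor>2 powr (real n * (r + \<delta>))\<rfloor>)"
    have fl_le: "real (fl r) \<le> 2 powr (real n * (r + \<delta>))" for r
      by (simp add: fl_def)
    have fl: "fl r > 0" "1 / fl r * 2 powr (n * (c + \<epsilon>)) \<le> 2 * 2 powr (- real n * \<epsilon>)" if "r \<ge> 0" "c \<le> r" for r c
    proof -
      let ?x = "2 powr (real n * (r + \<delta>))"
      have x: "?x \<ge> 1" using that \<delta> by (intro ge_one_powr_ge_zero) auto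
      then show "fl r > 0" by (simp add: fl_def)
      have "real (fl r) = of_int \<lfloor>?x\<rfloor>" using x by (simp add: fl_def)
      moreover have "1 \<le> \<lfloor>?x\<rfloor>" using x by simp
      moreover have "?x < of_int \<lfloor>?x\<rfloor> + 1" by (rule real_of_int_floor_add_one_gt)
      ultimately have "?x / 2 \<le> fl r" by linarith
      then have "1 / fl r \<le> 1 / (?x / 2)" using x by (intro divide_left_mono mult_pos_pos) auto
      moreover have "2 powr (n * (c + \<epsilon>)) \<le> 2 powr (n * (r + \<epsilon>))"
        using that by (intro powr_mono mult_left_mono) auto
      ultimately have "1 / fl r * 2 powr (n * (c + \<epsilon>)) \<le> (1 / (?x / 2)) * 2 powr (n * (r + \<epsilon>))"
        by (rule mult_mono) auto
      also have "\<dots> = 2 * (2 powr (n * (r + \<epsilon>)) / ?x)" by simp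
      also have "2 powr (n * (r + \<epsilon>)) / ?x = 2 powr (- real n * \<epsilon>)"
        by (simp add: powr_diff[symmetric] \<epsilon>_def algebra_simps)
      finally show "1 / fl r * 2 powr (n * (c + \<epsilon>)) \<le> 2 * 2 powr (- real n * \<epsilon>)" .
    qed
    have R0: "R \<ge> 0" using cmi_nonneg[OF finite_joint5] R order.trans by blast
    have "is_code pXY pZ d n (fl R) (fl R_d) (fl R_d) (measure_pmf.expectation J5 (\<lambda>(x,y,z,u,w). d x (xhat u w z)) + dmax *
      ((V rX / (n * \<epsilon>\<^sup>2) + 1 / fl R_d * 2 powr (n * (cmi J5 jU jY jZ + \<epsilon>))) +
       (V rZ / (n * \<epsilon>\<^sup>2) + 1 / fl R_d * 2 powr (n * (cmi J5 jU jY jZ + \<epsilon>))) +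
       (V rW / (n * \<epsilon>\<^sup>2) + 1 / fl R * 2 powr (n * (cmi J5 jX jW (\<lambda>\<omega>. (jU \<omega>, jZ \<omega>)) + \<epsilon>)))))"
      unfolding V_def using d0 dmax n0 fl(1)[OF R0 order_refl] fl(1)[OF Rd0 order_refl] eps by (intro block_code) auto
    moreover have "measure_pmf.expectation J5 (\<lambda>(x,y,z,u,w). d x (xhat u w z)) + dmax *
      ((V rX / (n * \<epsilon>\<^sup>2) + 1 / fl R_d * 2 powr (n * (cmi J5 jU jY jZ + \<epsilon>))) +
       (V rZ / (n * \<epsilon>\<^sup>2) + 1 / fl R_d * 2 powr (n * (cmi J5 jU jY jZ + \<epsilon>))) +
       (V rW / (n * \<epsilon>\<^sup>2) + 1 / fl R * 2 powr (n * (cmi J5 jX jW (\<lambda>\<omega>. (jU \<omega>, jZ \<omega>)) + \<epsilon>)))) \<le> D + err n"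
      unfolding err_def using dmax0
      by (intro add_mono D mult_left_mono order_refl fl(2) R0 Rd0 Rd R)
    moreover have "err n < \<delta>" using N n by simp
    ultimately have "is_code pXY pZ d n (fl R) (fl R_d) (fl R_d) (D + \<delta>)"
      unfolding is_code_def by (smt (verit, best))
    \<comment> \<open>Here R_e \<ge> R_d enters: the message made for the decoder also fits on the
      link to the encoder.\<close>
    moreover have "2 powr (real n * (R_d + \<delta>)) \<le> 2 powr (real n * (R_e + \<delta>))"
      using Re by (intro powr_mono mult_left_mono) auto
    ultimately show "\<exists>M Me Md. real M \<le> 2 powr (real n * (R + \<delta>)) \<and>
      real Me \<le> 2 powr (real n * (R_e + \<delta>)) \<and> real Md \<le> 2 powr (real n * (R_d + \<delta>)) \<and>
      is_code pXY pZ d n M Me Md (D + \<delta>)"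
      using fl_le order.trans by blast
  qed
qed

end

section \<open>The single-letter functionals and their convex hull\<close>

text \<open>The correction \<open>t * eta c\<close> is linear in \<open>t\<close>, so it cancels
  between entropies of equal total mass. This is the source of the homogeneity of the functionals
  below.\<close>

lemma eta_mult: "c \<ge> 0 \<Longrightarrow> t \<ge> 0 \<Longrightarrow> eta (c * t) = c * eta t + t * eta c"
  by (cases "c = 0"; cases "t = 0") (auto simp: eta_def log_mult algebra_simps)

text \<open>ln s \<le> s - 1 at s = 1 / sqrt t controls the logarithm near 0. The bound vanishes
  with \<open>t\<close>, which yields continuity of \<open>eta\<close> at 0.\<close>

lemma eta_le: assumes "0 \<le> t" shows "\<bar>eta t\<bar> \<le> (2 * sqrt t + t\<^sup>2) / ln 2"
proof (cases "t = 0")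
  case False
  with assms have t: "t > 0" by simp
  have "ln t \<le> t" using ln_le_minus_one[OF t] by simp
  then have up: "t * ln t \<le> t\<^sup>2" using t by (simp add: power2_eq_square)
  have "- ln (sqrt t) = ln (1 / sqrt t)" using t by (simp add: ln_div)
  also have "\<dots> \<le> 1 / sqrt t" using ln_le_minus_one[of "1 / sqrt t"] t by simp
  finally have "- ln t \<le> 2 / sqrt t" using t by (simp add: ln_sqrt)
  then have "- (t * ln t) \<le> t * (2 / sqrt t)" using t mult_left_mono[of "- ln t" "2 / sqrt t" t] by simp
  also have "\<dots> = 2 * sqrt t" using t real_div_sqrt[of t] by (simp add: field_simps)
  finally have lo: "- (t * ln t) \<le> 2 * sqrt t" .
  have "\<bar>t * ln t\<bar> \<le> 2 * sqrt t + t\<^sup>2" using up lo t by (auto simp: abs_le_iff add_increasing add_increasing2)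
  then show ?thesis by (simp add: eta_def log_def divide_right_mono)
qed (simp add: eta_def)

lemma continuous_on_eta: "continuous_on {0..} eta"
proof -
  have "(eta \<longlongrightarrow> eta x) (at x within {0..})" if x: "x \<ge> 0" for x
  proof (cases "x = 0")
    case True
    have "((\<lambda>t. (2 * sqrt t + t\<^sup>2) / ln 2) \<longlongrightarrow> (2 * sqrt 0 + 0\<^sup>2) / ln 2) (at 0 within {0..})"
      by (intro tendsto_intros) simp
    then have "((\<lambda>t. (2 * sqrt t + t\<^sup>2) / ln 2) \<longlongrightarrow> 0) (at 0 within {0..})" by simp
    then have "(eta \<longlongrightarrow> 0) (at 0 within {0..})"
      by (rule Lim_null_comparison[rotated]) (auto simp: eventually_at_filter eta_le)
    then show ?thesis using True by (simp add: eta_def)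
  next
    case False
    then have "isCont eta x" unfolding eta_def using x by (intro continuous_intros) auto
    then show ?thesis unfolding isCont_def by (rule tendsto_within_subset) simp
  qed
  then show ?thesis by (auto simp: continuous_on_def)
qed

lemma continuous_on_eta_comp [continuous_intros]:
  assumes "continuous_on S f" "\<And>x. x \<in> S \<Longrightarrow> f x \<ge> 0"
  shows "continuous_on S (\<lambda>x. eta (f x))"
  using continuous_on_compose2[OF continuous_on_eta assms(1)] assms(2) by auto

lemma pmf_map_fiber:
  assumes "finite I" "inj_on h I" "g -` {v} = h ` I"
  shows "pmf (map_pmf g q) v = (\<Sum>i\<in>I. pmf q (h i))"
  using assms by (simp add: pmf_map measure_measure_pmf_finite sum.reindex)

lemma pmf_bind_map:
  assumes "\<And>a' b'. h a' b' = h a b \<Longrightarrow> a' = a \<and> b' = b"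
  shows "pmf (bind_pmf p (\<lambda>a. map_pmf (h a) (k a))) (h a b) = pmf p a * pmf (k a) b"
proof -
  have "bind_pmf p (\<lambda>a. map_pmf (h a) (k a)) =
      map_pmf (\<lambda>(b, a). h a b) (bind_pmf p (\<lambda>a. map_pmf (\<lambda>b. (b, a)) (k a)))"
    by (simp add: map_bind_pmf map_pmf_comp)
  also have "pmf \<dots> (h a b) = (\<Sum>i\<in>{(b, a)}. pmf (bind_pmf p (\<lambda>a. map_pmf (\<lambda>b. (b, a)) (k a))) i)"
    by (rule pmf_map_fiber[where h = "\<lambda>x. x"]) (auto dest: assms)
  finally show ?thesis by (simp add: pmf_bind_map_pair)
qed

section \<open>Information functionals of the laws conditioned on U\<close>

context
  fixes pXY :: "('x::finite \<times> 'y::finite) pmf" and pZ :: "'x \<Rightarrow> 'z::finite pmf"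
    and d :: "'x \<Rightarrow> 'xh::finite \<Rightarrow> real"
begin

definition pY :: "'y \<Rightarrow> real" where "pY y = pmf (map_pmf snd pXY) y"
text \<open>At a letter y of probability 0 this is 0 and not a law. A mixture of letter laws with
  mean \<open>pY\<close> gives such a y no weight.\<close>

definition pXgY :: "'y \<Rightarrow> 'x \<Rightarrow> real" where "pXgY y x = pmf pXY (x, y) / pY y"
definition pZgY :: "'y \<Rightarrow> 'z \<Rightarrow> real" where "pZgY y z = (\<Sum>x\<in>UNIV. pXgY y x * pmf (pZ x) z)"
definition pXof :: "('y \<Rightarrow> real) \<Rightarrow> 'x \<Rightarrow> real" where "pXof a x = (\<Sum>y\<in>UNIV. a y * pXgY y x)"

definition \<Phi>1 :: "('y \<Rightarrow> real) \<Rightarrow> real" where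
  "\<Phi>1 a = (\<Sum>y\<in>UNIV. \<Sum>z\<in>UNIV. eta (a y * pZgY y z)) - (\<Sum>z\<in>UNIV. eta (\<Sum>y\<in>UNIV. a y * pZgY y z))"

text \<open>I(X;W|Z), written as four entropies, when Y has law \<open>a\<close> and W is produced
  from X by the channel \<open>b\<close>.\<close>

definition \<Phi>2 :: "('y \<Rightarrow> real) \<Rightarrow> ('x \<Rightarrow> ('z \<Rightarrow> 'xh) \<Rightarrow> real) \<Rightarrow> real" where
  "\<Phi>2 a b = (\<Sum>x\<in>UNIV. \<Sum>z\<in>UNIV. eta (pXof a x * pmf (pZ x) z))
    + (\<Sum>w\<in>UNIV. \<Sum>z\<in>UNIV. eta (\<Sum>x\<in>UNIV. pXof a x * b x w * pmf (pZ x) z))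
    - (\<Sum>x\<in>UNIV. \<Sum>w\<in>UNIV. \<Sum>z\<in>UNIV. eta (pXof a x * b x w * pmf (pZ x) z))
    - (\<Sum>z\<in>UNIV. eta (\<Sum>x\<in>UNIV. pXof a x * pmf (pZ x) z))"

definition \<Phi>3 :: "('y \<Rightarrow> real) \<Rightarrow> ('x \<Rightarrow> ('z \<Rightarrow> 'xh) \<Rightarrow> real) \<Rightarrow> real" where
  "\<Phi>3 a b = (\<Sum>x\<in>UNIV. \<Sum>w\<in>UNIV. \<Sum>z\<in>UNIV. pXof a x * b x w * pmf (pZ x) z * d x (w z))"

lemma pY_sum: "pY y = (\<Sum>x\<in>UNIV. pmf pXY (x, y))"
  unfolding pY_def by (rule pmf_map_fiber) (auto simp: inj_on_def)

lemma pY_nonneg: "pY y \<ge> 0" by (simp add: pY_def)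

lemma pXgY_nonneg: "pXgY y x \<ge> 0" by (simp add: pXgY_def pY_nonneg)

lemma pY_mult_pXgY: "pY y * pXgY y x = pmf pXY (x, y)"
proof (cases "pY y = 0")
  case True
  then have "pmf pXY (x, y) = 0"
    unfolding pY_sum by (subst (asm) sum_nonneg_eq_0_iff) auto
  then show ?thesis using True by simp
qed (simp add: pXgY_def)

lemma pZgY_nonneg: "pZgY y z \<ge> 0"
  by (auto simp: pZgY_def intro!: sum_nonneg mult_nonneg_nonneg pXgY_nonneg)

lemma pXof_nonneg: "(\<And>y. a y \<ge> 0) \<Longrightarrow> pXof a x \<ge> 0"
  by (auto simp: pXof_def intro!: sum_nonneg mult_nonneg_nonneg pXgY_nonneg)

lemma pXof_scale: "pXof (\<lambda>y. c * a y) x = c * pXof a x"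
  by (simp add: pXof_def sum_distrib_left mult.assoc)

text \<open>The terms with \<open>eta c\<close> carry the same mass in the joint law of (Y,Z) and in
  that of Z, and cancel in the difference.\<close>

lemma \<Phi>1_scale:
  assumes "c \<ge> 0" "\<And>y. a y \<ge> 0"
  shows "\<Phi>1 (\<lambda>y. c * a y) = c * \<Phi>1 a"
proof -
  have 1: "eta (c * a y * pZgY y z) = c * eta (a y * pZgY y z) + a y * pZgY y z * eta c" for y z
    using assms pZgY_nonneg by (simp add: eta_mult mult.assoc)
  have 2: "eta (\<Sum>y\<in>UNIV. c * a y * pZgY y z) = c * eta (\<Sum>y\<in>UNIV. a y * pZgY y z) + (\<Sum>y\<in>UNIV. a y * pZgY y z) * eta c" for z
    using assms pZgY_nonneg by (simp add: mult.assoc sum_distrib_left[symmetric] eta_mult sum_nonneg)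
  have "(\<Sum>y\<in>UNIV. \<Sum>z\<in>UNIV. a y * pZgY y z * eta c) = (\<Sum>z\<in>UNIV. (\<Sum>y\<in>UNIV. a y * pZgY y z) * eta c)"
    unfolding sum_distrib_right by (rule sum.swap)
  then show ?thesis
    by (simp add: \<Phi>1_def 1 2 sum.distrib sum_distrib_left right_diff_distrib)
qed

text \<open>Two entropies enter with each sign and all four laws have the same mass, so the terms
  with \<open>eta c\<close> cancel again.\<close>

lemma \<Phi>2_scale:
  assumes c: "c \<ge> 0" and a: "\<And>y. a y \<ge> 0" and b: "\<And>x w. b x w \<ge> 0"
  shows "\<Phi>2 (\<lambda>y. c * a y) b = c * \<Phi>2 a b"
proof -
  note nn = pXof_nonneg[of a, OF a]
  have 1: "eta (c * pXof a x * pmf (pZ x) z) = c * eta (pXof a x * pmf (pZ x) z) + pXof a x * pmf (pZ x) z * eta c" for x z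
    using c nn by (simp add: eta_mult mult.assoc)
  have 2: "eta (\<Sum>x\<in>UNIV. c * pXof a x * b x w * pmf (pZ x) z) =
      c * eta (\<Sum>x\<in>UNIV. pXof a x * b x w * pmf (pZ x) z) + (\<Sum>x\<in>UNIV. pXof a x * b x w * pmf (pZ x) z) * eta c" for w z
    using c nn b by (simp add: mult.assoc sum_distrib_left[symmetric] eta_mult sum_nonneg)
  have 3: "eta (c * pXof a x * b x w * pmf (pZ x) z) = c * eta (pXof a x * b x w * pmf (pZ x) z) + pXof a x * b x w * pmf (pZ x) z * eta c" for x w z
    using c nn b by (simp add: eta_mult mult.assoc)
  have 4: "eta (\<Sum>x\<in>UNIV. c * pXof a x * pmf (pZ x) z) =
      c * eta (\<Sum>x\<in>UNIV. pXof a x * pmf (pZ x) z) + (\<Sum>x\<in>UNIV. pXof a x * pmf (pZ x) z) * eta c" for z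
    using c nn by (simp add: mult.assoc sum_distrib_left[symmetric] eta_mult sum_nonneg)
  have 5: "(\<Sum>x\<in>UNIV. \<Sum>z\<in>UNIV. pXof a x * pmf (pZ x) z * eta c) = (\<Sum>z\<in>UNIV. (\<Sum>x\<in>UNIV. pXof a x * pmf (pZ x) z) * eta c)"
    unfolding sum_distrib_right by (rule sum.swap)
  have "(\<Sum>x\<in>UNIV. \<Sum>w\<in>UNIV. \<Sum>z\<in>UNIV. pXof a x * b x w * pmf (pZ x) z * eta c) =
    (\<Sum>w\<in>UNIV. \<Sum>x\<in>UNIV. \<Sum>z\<in>UNIV. pXof a x * b x w * pmf (pZ x) z * eta c)"
    by (rule sum.swap)
  also have "\<dots> = (\<Sum>w\<in>UNIV. \<Sum>z\<in>UNIV. (\<Sum>x\<in>UNIV. pXof a x * b x w * pmf (pZ x) z) * eta c)"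
    unfolding sum_distrib_right by (intro sum.cong refl sum.swap)
  finally have 6: "(\<Sum>x\<in>UNIV. \<Sum>w\<in>UNIV. \<Sum>z\<in>UNIV. pXof a x * b x w * pmf (pZ x) z * eta c) =
    (\<Sum>w\<in>UNIV. \<Sum>z\<in>UNIV. (\<Sum>x\<in>UNIV. pXof a x * b x w * pmf (pZ x) z) * eta c)" .
  show ?thesis
    unfolding \<Phi>2_def pXof_scale 1 2 3 4 sum.distrib 5 6
    by (simp add: sum_distrib_left[symmetric] right_diff_distrib distrib_left)
qed

lemma \<Phi>3_scale: "\<Phi>3 (\<lambda>y. c * a y) b = c * \<Phi>3 a b"
  by (simp add: \<Phi>3_def pXof_scale sum_distrib_left mult.assoc)

text \<open>The first coordinate records the law of Y itself: single letters may have any such law,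
  and only a convex combination is required to return \<open>pY\<close>.\<close>

definition letterF :: "(real ^ 'y) \<times> ((real ^ ('z \<Rightarrow> 'xh)) ^ 'x) \<Rightarrow> (real ^ 'y) \<times> real \<times> real \<times> real" where
  "letterF p = (fst p, \<Phi>1 (($) (fst p)), \<Phi>2 (($) (fst p)) (\<lambda>x. ($) (snd p $ x)), \<Phi>3 (($) (fst p)) (\<lambda>x. ($) (snd p $ x)))"

definition letterK :: "((real ^ 'y) \<times> ((real ^ ('z \<Rightarrow> 'xh)) ^ 'x)) set" where
  "letterK = {p. (\<forall>y. fst p $ y \<ge> 0) \<and> (\<Sum>y\<in>UNIV. fst p $ y) = 1 \<and>
     (\<forall>x w. snd p $ x $ w \<ge> 0) \<and> (\<forall>x. (\<Sum>w\<in>UNIV. snd p $ x $ w) = 1)}"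

lemma compact_letterK: "compact letterK"
proof -
  have "bounded letterK"
  proof -
    have "norm p \<le> 1 + real CARD('x)" if "p \<in> letterK" for p
    proof -
      have "norm (fst p) \<le> (\<Sum>y\<in>UNIV. \<bar>fst p $ y\<bar>)" by (rule norm_le_l1_cart)
      also have "\<dots> = 1" using that by (auto simp: letterK_def)
      finally have 1: "norm (fst p) \<le> 1" .
      have "norm (snd p $ x) \<le> 1" for x
      proof -
        have "norm (snd p $ x) \<le> (\<Sum>y\<in>UNIV. \<bar>snd p $ x $ y\<bar>)" by (rule norm_le_l1_cart)
        also have "\<dots> = 1" using that by (auto simp: letterK_def)
        finally show ?thesis .
      qed
      then have "norm (snd p) \<le> (\<Sum>x\<in>(UNIV::'x set). 1)"
        using order.trans[OF L2_set_le_sum sum_mono, of UNIV "\<lambda>x. norm (snd p $ x)" "\<lambda>_. 1"]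
        by (simp add: norm_vec_def[of "snd p"])
      then have 2: "norm (snd p) \<le> CARD('x)" by simp
      show ?thesis using norm_Pair_le[of "fst p" "snd p"] 1 2 by simp
    qed
    then show ?thesis unfolding bounded_iff by blast
  qed
  moreover have "closed letterK"
    unfolding letterK_def
    by (intro closed_Collect_conj closed_Collect_all closed_Collect_le closed_Collect_eq continuous_intros)
  ultimately show ?thesis by (simp add: compact_eq_bounded_closed)
qed

lemma continuous_on_letterF: "continuous_on letterK letterF"
proof -
  have a: "fst p $ y \<ge> 0" "snd p $ x $ w \<ge> 0" if "p \<in> letterK" for p x y w using that by (auto simp: letterK_def)
  have p: "pXof (($) (fst p)) x \<ge> 0" if "p \<in> letterK" for p x using a that by (intro pXof_nonneg)
  have c: "continuous_on letterK (\<lambda>p. pXof (($) (fst p)) x)" for x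
    unfolding pXof_def by (intro continuous_intros)
  show ?thesis
    unfolding letterF_def \<Phi>1_def \<Phi>2_def \<Phi>3_def
    by (intro continuous_intros c) (auto intro!: sum_nonneg mult_nonneg_nonneg a p pZgY_nonneg)
qed

lemma compact_hull: "compact (convex hull (letterF ` letterK))"
  by (intro compact_convex_hull compact_continuous_image continuous_on_letterF compact_letterK)

lemma pmf_src: "pmf (src pXY pZ) (x, y, z) = pmf pXY (x, y) * pmf (pZ x) z"
proof -
  have "src pXY pZ = bind_pmf pXY (\<lambda>a. map_pmf ((\<lambda>a z. (fst a, snd a, z)) a) (pZ (fst a)))"
    by (simp add: src_def map_pmf_def case_prod_unfold)
  then have "pmf (src pXY pZ) ((\<lambda>a z. (fst a, snd a, z)) (x, y) z) = pmf pXY (x, y) * pmf (pZ (fst (x, y))) z"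
    by (simp only:) (rule pmf_bind_map, auto)
  then show ?thesis by simp
qed

text \<open>The kernel \<open>K\<close> may use both x and y for the pair (u, w). This is weaker
  than the factorisation p(u|y) p(w|x,u) and covers the laws produced by codes.\<close>

definition kerJ :: "('x \<Rightarrow> 'y \<Rightarrow> ('u \<times> ('z \<Rightarrow> 'xh)) pmf) \<Rightarrow> ('x \<times> 'y \<times> 'z \<times> 'u \<times> ('z \<Rightarrow> 'xh)) pmf" where
  "kerJ K = bind_pmf (src pXY pZ) (\<lambda>(x, y, z). map_pmf (\<lambda>(u, w). (x, y, z, u, w)) (K x y))"

lemma pmf_kerJ: "pmf (kerJ K) (x, y, z, u, w) = pmf pXY (x, y) * pmf (pZ x) z * pmf (K x y) (u, w)"
proof -
  let ?h = "\<lambda>(x, y, z) (u, w). (x, y, z, u, w)"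
  have "kerJ K = bind_pmf (src pXY pZ) (\<lambda>a. map_pmf (?h a) (K (fst a) (fst (snd a))))"
    by (simp add: kerJ_def case_prod_unfold)
  then have "pmf (kerJ K) (?h (x, y, z) (u, w)) = pmf (src pXY pZ) (x, y, z) * pmf (K (fst (x, y, z)) (fst (snd (x, y, z)))) (u, w)"
    by (simp only:) (rule pmf_bind_map, auto)
  then show ?thesis by (simp add: pmf_src)
qed

section \<open>Marginals of joint laws in which W may depend on Y given (X,U)\<close>

context
  fixes K :: "'x \<Rightarrow> 'y \<Rightarrow> ('u \<times> ('z \<Rightarrow> 'xh)) pmf" and Us :: "'u set" and k :: "'y \<Rightarrow> 'u \<Rightarrow> real"
    and b :: "'u \<Rightarrow> 'x \<Rightarrow> ('z \<Rightarrow> 'xh) \<Rightarrow> real" and A :: "'u \<Rightarrow> 'y \<Rightarrow> real"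
  assumes finUs: "finite Us" and subUs: "\<And>x y. fst ` set_pmf (K x y) \<subseteq> Us"
    and k: "\<And>x y u. pmf pXY (x, y) \<noteq> 0 \<Longrightarrow> (\<Sum>w\<in>UNIV. pmf (K x y) (u, w)) = k y u"
    and A: "\<And>u y. A u y = pY y * k y u"
    and b1: "\<And>u x. u \<in> Us \<Longrightarrow> (\<Sum>w\<in>UNIV. b u x w) = 1"
    and b: "\<And>u x w. u \<in> Us \<Longrightarrow> (\<Sum>y\<in>UNIV. pmf pXY (x, y) * pmf (K x y) (u, w)) = pXof (A u) x * b u x w"
begin

text \<open>After summing out w the kernel depends on y alone, by assumption \<open>k\<close>; so U
  - Y - X - Z holds here, and x is summed against p(x|y).\<close>

lemma kerJ_UYZ: "pmf (map_pmf (\<lambda>\<omega>. (jU \<omega>, jY \<omega>, jZ \<omega>)) (kerJ K)) (u, y, z) = A u y * pZgY y z"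
proof -
  have "pmf (map_pmf (\<lambda>\<omega>. (jU \<omega>, jY \<omega>, jZ \<omega>)) (kerJ K)) (u, y, z) =
    (\<Sum>(x, w)\<in>UNIV \<times> UNIV. pmf (kerJ K) (x, y, z, u, w))"
    by (subst pmf_map_fiber[of "UNIV \<times> UNIV" "\<lambda>(x, w). (x, y, z, u, w)"])
      (auto simp: inj_on_def case_prod_unfold image_def)
  also have "\<dots> = (\<Sum>x\<in>UNIV. \<Sum>w\<in>UNIV. pmf pXY (x, y) * pmf (pZ x) z * pmf (K x y) (u, w))"
    by (simp only: sum.cartesian_product[symmetric] pmf_kerJ)
  also have "\<dots> = (\<Sum>x\<in>UNIV. pmf pXY (x, y) * pmf (pZ x) z * k y u)"
  proof (intro sum.cong refl)
    fix x show "(\<Sum>w\<in>UNIV. pmf pXY (x, y) * pmf (pZ x) z * pmf (K x y) (u, w)) = pmf pXY (x, y) * pmf (pZ x) z * k y u"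
      using k[of x y u] by (cases "pmf pXY (x, y) = 0") (simp_all add: sum_distrib_left[symmetric])
  qed
  also have "\<dots> = A u y * pZgY y z"
    by (simp add: A pZgY_def sum_distrib_left pY_mult_pXgY[symmetric] algebra_simps)
  finally show ?thesis .
qed

text \<open>Z depends on X alone, so the sum over y touches only p(x,y) and the kernel. The result
  is that of a true channel \<open>b\<close> from (X,U) to W: the dependence of W on Y has been
  averaged out.\<close>

lemma kerJ_UXWZ:
  assumes "u \<in> Us"
  shows "pmf (map_pmf (\<lambda>\<omega>. (jU \<omega>, jX \<omega>, jW \<omega>, jZ \<omega>)) (kerJ K)) (u, x, w, z) = pXof (A u) x * b u x w * pmf (pZ x) z"
proof -
  have "pmf (map_pmf (\<lambda>\<omega>. (jU \<omega>, jX \<omega>, jW \<omega>, jZ \<omega>)) (kerJ K)) (u, x, w, z) =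
    (\<Sum>y\<in>UNIV. pmf (kerJ K) (x, y, z, u, w))"
    by (subst pmf_map_fiber[of UNIV "\<lambda>y. (x, y, z, u, w)"])
      (auto simp: inj_on_def case_prod_unfold image_def)
  also have "\<dots> = (\<Sum>y\<in>UNIV. pmf pXY (x, y) * pmf (K x y) (u, w)) * pmf (pZ x) z"
    by (simp add: pmf_kerJ sum_distrib_left mult_ac)
  finally show ?thesis using b[OF assms] by simp
qed

lemma kerJ_UZ: "pmf (map_pmf (\<lambda>\<omega>. (jU \<omega>, jZ \<omega>)) (kerJ K)) (u, z) = (\<Sum>y\<in>UNIV. A u y * pZgY y z)"
proof -
  have "map_pmf (\<lambda>\<omega>. (jU \<omega>, jZ \<omega>)) (kerJ K) = map_pmf (\<lambda>(u, y, z). (u, z)) (map_pmf (\<lambda>\<omega>. (jU \<omega>, jY \<omega>, jZ \<omega>)) (kerJ K))"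
    by (simp add: map_pmf_comp)
  then have "pmf (map_pmf (\<lambda>\<omega>. (jU \<omega>, jZ \<omega>)) (kerJ K)) (u, z) =
    (\<Sum>y\<in>UNIV. pmf (map_pmf (\<lambda>\<omega>. (jU \<omega>, jY \<omega>, jZ \<omega>)) (kerJ K)) (u, y, z))"
    by (simp only:) (rule pmf_map_fiber, auto simp: inj_on_def)
  then show ?thesis by (simp only: kerJ_UYZ)
qed

lemma kerJ_UXZ:
  assumes "u \<in> Us"
  shows "pmf (map_pmf (\<lambda>\<omega>. (jU \<omega>, jX \<omega>, jZ \<omega>)) (kerJ K)) (u, x, z) = pXof (A u) x * pmf (pZ x) z"
proof -
  have "map_pmf (\<lambda>\<omega>. (jU \<omega>, jX \<omega>, jZ \<omega>)) (kerJ K) = map_pmf (\<lambda>(u, x, w, z). (u, x, z)) (map_pmf (\<lambda>\<omega>. (jU \<omega>, jX \<omega>, jW \<omega>, jZ \<omega>)) (kerJ K))"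
    by (simp add: map_pmf_comp)
  then have "pmf (map_pmf (\<lambda>\<omega>. (jU \<omega>, jX \<omega>, jZ \<omega>)) (kerJ K)) (u, x, z) =
    (\<Sum>w\<in>UNIV. pmf (map_pmf (\<lambda>\<omega>. (jU \<omega>, jX \<omega>, jW \<omega>, jZ \<omega>)) (kerJ K)) (u, x, w, z))"
    by (simp only:) (rule pmf_map_fiber, auto simp: inj_on_def)
  also have "\<dots> = pXof (A u) x * (\<Sum>w\<in>UNIV. b u x w) * pmf (pZ x) z"
    by (simp add: kerJ_UXWZ[OF assms] sum_distrib_left sum_distrib_right)
  finally show ?thesis by (simp add: b1[OF assms])
qed

lemma kerJ_UWZ:
  assumes "u \<in> Us"
  shows "pmf (map_pmf (\<lambda>\<omega>. (jU \<omega>, jW \<omega>, jZ \<omega>)) (kerJ K)) (u, w, z) = (\<Sum>x\<in>UNIV. pXof (A u) x * b u x w * pmf (pZ x) z)"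
proof -
  have "map_pmf (\<lambda>\<omega>. (jU \<omega>, jW \<omega>, jZ \<omega>)) (kerJ K) = map_pmf (\<lambda>(u, x, w, z). (u, w, z)) (map_pmf (\<lambda>\<omega>. (jU \<omega>, jX \<omega>, jW \<omega>, jZ \<omega>)) (kerJ K))"
    by (simp add: map_pmf_comp)
  then have "pmf (map_pmf (\<lambda>\<omega>. (jU \<omega>, jW \<omega>, jZ \<omega>)) (kerJ K)) (u, w, z) =
    (\<Sum>x\<in>UNIV. pmf (map_pmf (\<lambda>\<omega>. (jU \<omega>, jX \<omega>, jW \<omega>, jZ \<omega>)) (kerJ K)) (u, x, w, z))"
    by (simp only:) (rule pmf_map_fiber, auto simp: inj_on_def)
  then show ?thesis by (simp only: kerJ_UXWZ[OF assms])
qed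

text \<open>Reconciles the law of (U,Z) computed through Y, as in \<Phi>1, with the one computed
  through X, as in \<Phi>2.\<close>

lemma sum_A_pZgY: "(\<Sum>y\<in>UNIV. A u y * pZgY y z) = (\<Sum>x\<in>UNIV. pXof (A u) x * pmf (pZ x) z)"
  unfolding pZgY_def pXof_def sum_distrib_left sum_distrib_right
  by (subst sum.swap) (simp add: mult_ac)

lemma set_kerJ: "\<omega> \<in> set_pmf (kerJ K) \<Longrightarrow> jU \<omega> \<in> Us"
  using subUs by (force simp: kerJ_def)

lemma finite_kerJ: "finite (set_pmf (kerJ K))"
proof (rule finite_subset)
  show "set_pmf (kerJ K) \<subseteq> UNIV \<times> UNIV \<times> UNIV \<times> Us \<times> UNIV" using set_kerJ by force
qed (use finUs in simp)

text \<open>Both entropies split over the values of U; the difference is H(Y|U,Z).\<close>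

lemma kerJ_\<Phi>1: "ent (map_pmf (\<lambda>\<omega>. (jU \<omega>, jY \<omega>, jZ \<omega>)) (kerJ K)) - ent (map_pmf (\<lambda>\<omega>. (jU \<omega>, jZ \<omega>)) (kerJ K)) = (\<Sum>u\<in>Us. \<Phi>1 (A u))"
proof -
  have "ent (map_pmf (\<lambda>\<omega>. (jU \<omega>, jY \<omega>, jZ \<omega>)) (kerJ K)) = (\<Sum>u\<in>Us. \<Sum>y\<in>UNIV. \<Sum>z\<in>UNIV. eta (A u y * pZgY y z))"
    by (subst ent_eq_sum[of "Us \<times> UNIV \<times> UNIV"])
      (use finUs set_kerJ in \<open>auto simp: sum.cartesian_product kerJ_UYZ intro!: sum.cong\<close>)
  moreover have "ent (map_pmf (\<lambda>\<omega>. (jU \<omega>, jZ \<omega>)) (kerJ K)) = (\<Sum>u\<in>Us. \<Sum>z\<in>UNIV. eta (\<Sum>y\<in>UNIV. A u y * pZgY y z))"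
    by (subst ent_eq_sum[of "Us \<times> UNIV"])
      (use finUs set_kerJ in \<open>auto simp: sum.cartesian_product kerJ_UZ intro!: sum.cong\<close>)
  ultimately show ?thesis by (simp add: \<Phi>1_def sum_subtractf)
qed

lemma kerJ_\<Phi>2: "ent (map_pmf (\<lambda>\<omega>. (jU \<omega>, jX \<omega>, jZ \<omega>)) (kerJ K)) + ent (map_pmf (\<lambda>\<omega>. (jU \<omega>, jW \<omega>, jZ \<omega>)) (kerJ K))
    - ent (map_pmf (\<lambda>\<omega>. (jU \<omega>, jX \<omega>, jW \<omega>, jZ \<omega>)) (kerJ K)) - ent (map_pmf (\<lambda>\<omega>. (jU \<omega>, jZ \<omega>)) (kerJ K)) = (\<Sum>u\<in>Us. \<Phi>2 (A u) (b u))"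
proof -
  have "ent (map_pmf (\<lambda>\<omega>. (jU \<omega>, jX \<omega>, jZ \<omega>)) (kerJ K)) = (\<Sum>u\<in>Us. \<Sum>x\<in>UNIV. \<Sum>z\<in>UNIV. eta (pXof (A u) x * pmf (pZ x) z))"
    by (subst ent_eq_sum[of "Us \<times> UNIV \<times> UNIV"])
      (use finUs set_kerJ in \<open>auto simp: sum.cartesian_product kerJ_UXZ intro!: sum.cong\<close>)
  moreover have "ent (map_pmf (\<lambda>\<omega>. (jU \<omega>, jW \<omega>, jZ \<omega>)) (kerJ K)) =
      (\<Sum>u\<in>Us. \<Sum>w\<in>UNIV. \<Sum>z\<in>UNIV. eta (\<Sum>x\<in>UNIV. pXof (A u) x * b u x w * pmf (pZ x) z))"
    by (subst ent_eq_sum[of "Us \<times> UNIV \<times> UNIV"])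
      (use finUs set_kerJ in \<open>auto simp: sum.cartesian_product kerJ_UWZ intro!: sum.cong\<close>)
  moreover have "ent (map_pmf (\<lambda>\<omega>. (jU \<omega>, jX \<omega>, jW \<omega>, jZ \<omega>)) (kerJ K)) =
      (\<Sum>u\<in>Us. \<Sum>x\<in>UNIV. \<Sum>w\<in>UNIV. \<Sum>z\<in>UNIV. eta (pXof (A u) x * b u x w * pmf (pZ x) z))"
    by (subst ent_eq_sum[of "Us \<times> UNIV \<times> UNIV \<times> UNIV"])
      (use finUs set_kerJ in \<open>auto simp: sum.cartesian_product kerJ_UXWZ intro!: sum.cong\<close>)
  moreover have "ent (map_pmf (\<lambda>\<omega>. (jU \<omega>, jZ \<omega>)) (kerJ K)) = (\<Sum>u\<in>Us. \<Sum>z\<in>UNIV. eta (\<Sum>x\<in>UNIV. pXof (A u) x * pmf (pZ x) z))"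
    by (subst ent_eq_sum[of "Us \<times> UNIV"])
      (use finUs set_kerJ in \<open>auto simp: sum.cartesian_product kerJ_UZ sum_A_pZgY intro!: sum.cong\<close>)
  ultimately show ?thesis by (simp add: \<Phi>2_def sum_subtractf sum.distrib)
qed

lemma kerJ_\<Phi>3: "measure_pmf.expectation (kerJ K) (\<lambda>(x, y, z, u, w). d x (w z)) = (\<Sum>u\<in>Us. \<Phi>3 (A u) (b u))"
proof -
  have "measure_pmf.expectation (kerJ K) (\<lambda>(x, y, z, u, w). d x (w z)) =
    measure_pmf.expectation (map_pmf (\<lambda>\<omega>. (jU \<omega>, jX \<omega>, jW \<omega>, jZ \<omega>)) (kerJ K)) (\<lambda>(u, x, w, z). d x (w z))"
    by (simp add: case_prod_unfold)
  also have "\<dots> = (\<Sum>(u, x, w, z)\<in>Us \<times> UNIV \<times> UNIV \<times> UNIV.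
      pmf (map_pmf (\<lambda>\<omega>. (jU \<omega>, jX \<omega>, jW \<omega>, jZ \<omega>)) (kerJ K)) (u, x, w, z) * d x (w z))"
    by (subst integral_measure_pmf[of "Us \<times> UNIV \<times> UNIV \<times> UNIV"])
      (use finUs set_kerJ in \<open>auto simp: case_prod_unfold\<close>)
  also have "\<dots> = (\<Sum>u\<in>Us. \<Phi>3 (A u) (b u))"
    unfolding \<Phi>3_def by (auto simp: sum.cartesian_product kerJ_UXWZ intro!: sum.cong)
  finally show ?thesis .
qed

end

end

lemma exists_pmf_of_weights:
  assumes fin: "finite S" and nn: "\<And>a. f a \<ge> (0::real)" and out: "\<And>a. a \<notin> S \<Longrightarrow> f a = 0" and one: "(\<Sum>a\<in>S. f a) = 1"
  shows "\<exists>q. \<forall>a. pmf q a = f a"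
proof -
  have "(\<integral>\<^sup>+ x. ennreal (f x) \<partial>count_space UNIV) = (\<Sum>x\<in>S. ennreal (f x))"
    using fin out by (intro nn_integral_count_space') auto
  also have "\<dots> = 1" using nn one by simp
  finally show ?thesis using pmf_embed_pmf[of f] nn by blast
qed

section \<open>From joint laws to hull points and back\<close>

context
  fixes pXY :: "('x::finite \<times> 'y::finite) pmf" and pZ :: "'x \<Rightarrow> 'z::finite pmf"
    and d :: "'x \<Rightarrow> 'xh::finite \<Rightarrow> real"
begin

abbreviation "letter_hull \<equiv> convex hull (letterF pXY pZ d ` letterK)"

lemma sum_pY: "(\<Sum>y\<in>UNIV. pY pXY y) = 1"
  unfolding pY_def by (intro sum_pmf_eq_1) auto

text \<open>Homogeneity moves the weights \<open>P u\<close> inside the functionals, so a convex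
  combination of letter points becomes a sum over the slices of a joint law.\<close>

lemma letterF_sum:
  assumes fin: "finite Us" and P: "\<And>u. u \<in> Us \<Longrightarrow> P u \<ge> 0"
    and pt: "\<And>u. u \<in> Us \<Longrightarrow> (a u, b u) \<in> letterK" and A: "\<And>u y. u \<in> Us \<Longrightarrow> A u y = P u * a u $ y"
  shows "(\<Sum>u\<in>Us. P u *\<^sub>R letterF pXY pZ d (a u, b u)) =
    (\<chi> y. \<Sum>u\<in>Us. A u y, \<Sum>u\<in>Us. \<Phi>1 pXY pZ (A u), \<Sum>u\<in>Us. \<Phi>2 pXY pZ (A u) (\<lambda>x. ($) (b u $ x)),
     \<Sum>u\<in>Us. \<Phi>3 pXY pZ d (A u) (\<lambda>x. ($) (b u $ x)))"
proof -
  have Aeq: "A u = (\<lambda>y. P u * a u $ y)" if "u \<in> Us" for u using A that by auto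
  have nn: "a u $ y \<ge> 0" "b u $ x $ w \<ge> 0" if "u \<in> Us" for u x y w
    using pt[OF that] by (auto simp: letterK_def)
  have "\<Phi>1 pXY pZ (A u) = P u * \<Phi>1 pXY pZ (($) (a u))"
    "\<Phi>2 pXY pZ (A u) (\<lambda>x. ($) (b u $ x)) = P u * \<Phi>2 pXY pZ (($) (a u)) (\<lambda>x. ($) (b u $ x))"
    "\<Phi>3 pXY pZ d (A u) (\<lambda>x. ($) (b u $ x)) = P u * \<Phi>3 pXY pZ d (($) (a u)) (\<lambda>x. ($) (b u $ x))" if "u \<in> Us" for u
    unfolding Aeq[OF that] using P[OF that] nn[OF that]
    by (auto intro!: \<Phi>1_scale \<Phi>2_scale \<Phi>3_scale)
  then show ?thesis
    by (simp add: prod_eq_iff fst_sum snd_sum letterF_def vec_eq_iff A)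
qed

text \<open>Conditioning on U = u gives a letter point, made of the law of Y and the averaged
  channel from X to W. The mass of u is its weight in the convex combination.\<close>

lemma kerJ_point_in_hull:
  fixes K :: "'x \<Rightarrow> 'y \<Rightarrow> ('u \<times> ('z \<Rightarrow> 'xh)) pmf"
  assumes finUs: "finite Us" and subUs: "\<And>x y. fst ` set_pmf (K x y) \<subseteq> Us"
    and k: "\<And>x y u. pmf pXY (x, y) \<noteq> 0 \<Longrightarrow> (\<Sum>w\<in>UNIV. pmf (K x y) (u, w)) = k y u"
  defines "J \<equiv> kerJ pXY pZ K"
  shows "(\<chi> y. pY pXY y, ent (map_pmf (\<lambda>\<omega>. (jU \<omega>, jY \<omega>, jZ \<omega>)) J) - ent (map_pmf (\<lambda>\<omega>. (jU \<omega>, jZ \<omega>)) J),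
    ent (map_pmf (\<lambda>\<omega>. (jU \<omega>, jX \<omega>, jZ \<omega>)) J) + ent (map_pmf (\<lambda>\<omega>. (jU \<omega>, jW \<omega>, jZ \<omega>)) J)
    - ent (map_pmf (\<lambda>\<omega>. (jU \<omega>, jX \<omega>, jW \<omega>, jZ \<omega>)) J) - ent (map_pmf (\<lambda>\<omega>. (jU \<omega>, jZ \<omega>)) J),
    measure_pmf.expectation J (\<lambda>(x, y, z, u, w). d x (w z))) \<in> letter_hull"
proof -
  define A where "A u y = pY pXY y * k y u" for u y
  define P where "P u = (\<Sum>y\<in>UNIV. A u y)" for u
  define B where "B u x w = (\<Sum>y\<in>UNIV. pmf pXY (x, y) * pmf (K x y) (u, w))" for u x w
  \<comment> \<open>Where the conditioning event is null, \<open>b\<close> becomes a point mass and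
    \<open>a\<close> becomes \<open>pY\<close>, so that every \<open>u\<close> still gives an
    element of \<open>letterK\<close>.\<close>
  define b where "b u x w = (if pXof pXY (A u) x = 0 then (if w = undefined then 1 else 0) else B u x w / pXof pXY (A u) x)" for u x w
  define a where "a u y = (if P u = 0 then pY pXY y else A u y / P u)" for u y
  \<comment> \<open>\<open>k\<close> is tied to the kernel only at pairs of positive probability, so
    a y of positive probability needs an x as witness.\<close>
  have ex: "\<exists>x. pmf pXY (x, y) \<noteq> 0" if "pY pXY y \<noteq> 0" for y
    using that unfolding pY_sum by (metis sum.neutral)
  have A0: "A u y \<ge> 0" for u y
  proof (cases "pY pXY y = 0")
    case False
    from ex[OF this] obtain x where "pmf pXY (x, y) \<noteq> 0" by blast
    then have "k y u \<ge> 0" using k[of x y u] by (metis pmf_nonneg sum_nonneg)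
    then show ?thesis by (simp add: A_def pY_nonneg)
  qed (simp add: A_def)
  have P0: "P u \<ge> 0" for u unfolding P_def using A0 by (intro sum_nonneg)
  have sumA: "(\<Sum>u\<in>Us. A u y) = pY pXY y" for y
  proof (cases "pY pXY y = 0")
    case False
    from ex[OF this] obtain x where x: "pmf pXY (x, y) \<noteq> 0" by blast
    have "(\<Sum>u\<in>Us. k y u) = (\<Sum>u\<in>Us. \<Sum>w\<in>UNIV. pmf (K x y) (u, w))" by (simp add: k[OF x])
    also have "\<dots> = (\<Sum>v\<in>Us \<times> UNIV. pmf (K x y) v)" by (simp add: sum.cartesian_product)
    also have "\<dots> = 1" using finUs subUs[of x y] by (intro sum_pmf_eq_1) auto
    finally show ?thesis by (simp add: A_def sum_distrib_left[symmetric])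
  qed (simp add: A_def)
  have sumP: "(\<Sum>u\<in>Us. P u) = 1"
    unfolding P_def by (subst sum.swap) (simp add: sumA sum_pY)
  have sumB: "(\<Sum>w\<in>UNIV. B u x w) = pXof pXY (A u) x" for u x
  proof -
    have "(\<Sum>w\<in>UNIV. B u x w) = (\<Sum>y\<in>UNIV. \<Sum>w\<in>UNIV. pmf pXY (x, y) * pmf (K x y) (u, w))"
      unfolding B_def by (rule sum.swap)
    also have "\<dots> = (\<Sum>y\<in>UNIV. pmf pXY (x, y) * k y u)"
    proof (intro sum.cong refl)
      fix y show "(\<Sum>w\<in>UNIV. pmf pXY (x, y) * pmf (K x y) (u, w)) = pmf pXY (x, y) * k y u"
        using k[of x y u] by (cases "pmf pXY (x, y) = 0") (simp_all add: sum_distrib_left[symmetric])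
    qed
    also have "\<dots> = pXof pXY (A u) x"
      by (simp add: pXof_def A_def pY_mult_pXgY[symmetric] mult_ac)
    finally show ?thesis .
  qed
  have B0: "B u x w \<ge> 0" for u x w by (auto simp: B_def intro!: sum_nonneg)
  have Beq: "B u x w = pXof pXY (A u) x * b u x w" for u x w
  proof (cases "pXof pXY (A u) x = 0")
    case True
    then have "(\<Sum>w\<in>UNIV. B u x w) = 0" by (simp add: sumB)
    then have "B u x w = 0" using B0 by (subst (asm) sum_nonneg_eq_0_iff) auto
    then show ?thesis using True by simp
  qed (simp add: b_def)
  have b1: "(\<Sum>w\<in>UNIV. b u x w) = 1" for u x
    by (cases "pXof pXY (A u) x = 0") (simp_all add: b_def sum_divide_distrib[symmetric] sumB)
  have "pXof pXY (A u) x \<ge> 0" for u x using A0 by (intro pXof_nonneg)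
  then have b0: "b u x w \<ge> 0" for u x w using B0 by (simp add: b_def)
  have Aa: "A u y = P u * a u y" for u y
  proof (cases "P u = 0")
    case True
    then have "A u y = 0" unfolding P_def using A0 by (subst (asm) sum_nonneg_eq_0_iff) auto
    then show ?thesis using True by simp
  qed (simp add: a_def)
  have a1: "(\<Sum>y\<in>UNIV. a u y) = 1" for u
    by (cases "P u = 0") (simp_all add: a_def sum_pY sum_divide_distrib[symmetric] P_def[symmetric])
  have a0: "a u y \<ge> 0" for u y using A0 P0 pY_nonneg by (auto simp: a_def)
  have pt: "(\<chi> y. a u y, \<chi> x w. b u x w) \<in> letterK" for u
    using a0 a1 b0 b1 by (simp add: letterK_def)
  have eq: "(\<Sum>u\<in>Us. P u *\<^sub>R letterF pXY pZ d (\<chi> y. a u y, \<chi> x w. b u x w)) =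
    (\<chi> y. \<Sum>u\<in>Us. A u y, \<Sum>u\<in>Us. \<Phi>1 pXY pZ (A u), \<Sum>u\<in>Us. \<Phi>2 pXY pZ (A u) (\<lambda>x. ($) ((\<chi> x w. b u x w) $ x)),
     \<Sum>u\<in>Us. \<Phi>3 pXY pZ d (A u) (\<lambda>x. ($) ((\<chi> x w. b u x w) $ x)))"
    by (rule letterF_sum) (use finUs P0 pt Aa in auto)
  have "(\<Sum>u\<in>Us. P u *\<^sub>R letterF pXY pZ d (\<chi> y. a u y, \<chi> x w. b u x w)) \<in> letter_hull"
    using finUs P0 sumP pt by (intro convex_sum[OF _ convex_convex_hull] hull_inc) auto
  moreover have "(\<lambda>x. ($) ((\<chi> x w. b u x w) $ x)) = b u" for u by (simp add: fun_eq_iff)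
  moreover note kerJ_\<Phi>1[OF finUs subUs k A_def b1 Beq[unfolded B_def], of pZ]
    kerJ_\<Phi>2[OF finUs subUs k A_def b1 Beq[unfolded B_def], of pZ]
    kerJ_\<Phi>3[OF finUs subUs k A_def b1 Beq[unfolded B_def], of pZ d]
  ultimately show ?thesis
    unfolding J_def eq by (simp add: sumA)
qed

text \<open>The index of a finite convex combination serves as U. Its weights and the letter laws
  give p(u|y) by Bayes, and the channels of the letters give p(w|x,u). The bound on
  \<open>R1\<close> is I(U;Y|Z) = H(Y|Z) - H(Y|U,Z).\<close>

lemma hull_imp_RYXZ:
  assumes c: "(\<chi> y. pY pXY y, c1, c2, c3) \<in> letter_hull"
    and R1: "R1 \<ge> ent (map_pmf (\<lambda>(x,y,z). (y, z)) (src pXY pZ)) - ent (map_pmf (\<lambda>(x,y,z). z) (src pXY pZ)) - c1"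
    and R: "R \<ge> c2" and D: "D \<ge> c3"
  shows "(R, R1) \<in> RYXZ pXY pZ d D"
proof -
  obtain n \<mu> p where \<mu>: "\<And>i. i \<in> {1..n::nat} \<Longrightarrow> 0 \<le> \<mu> i" "sum \<mu> {1..n} = 1"
    and p: "\<And>i. i \<in> {1..n} \<Longrightarrow> p i \<in> letterF pXY pZ d ` letterK"
    and eq: "(\<Sum>i=1..n. \<mu> i *\<^sub>R p i) = (\<chi> y. pY pXY y, c1, c2, c3)"
    using c unfolding convex_hull_indexed by blast
  obtain pt where pt: "\<And>i. i \<in> {1..n} \<Longrightarrow> pt i \<in> letterK \<and> p i = letterF pXY pZ d (pt i)"
    using p unfolding image_iff by metis
  define a where "a i = fst (pt i)" for i
  define b where "b i = snd (pt i)" for i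
  define Us where "Us = {1..n}"
  have ptK: "(a i, b i) \<in> letterK" and pF: "p i = letterF pXY pZ d (a i, b i)" if "i \<in> Us" for i
    using pt[of i] that by (auto simp: a_def b_def Us_def)
  have finUs: "finite Us" by (simp add: Us_def)
  have nn: "a i $ y \<ge> 0" "b i $ x $ w \<ge> 0" "(\<Sum>w\<in>UNIV. b i $ x $ w) = 1" if "i \<in> Us" for i x y w
    using ptK[OF that] by (auto simp: letterK_def)
  define A where "A i y = \<mu> i * a i $ y" for i y
  have A0: "A i y \<ge> 0" if "i \<in> Us" for i y using that nn \<mu> by (auto simp: A_def Us_def)
  have "(\<chi> y. pY pXY y, c1, c2, c3) = (\<Sum>i\<in>Us. \<mu> i *\<^sub>R letterF pXY pZ d (a i, b i))"
    unfolding eq[symmetric] Us_def[symmetric] by (intro sum.cong refl) (simp add: pF)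
  also have "\<dots> = (\<chi> y. \<Sum>u\<in>Us. A u y, \<Sum>u\<in>Us. \<Phi>1 pXY pZ (A u), \<Sum>u\<in>Us. \<Phi>2 pXY pZ (A u) (\<lambda>x. ($) (b u $ x)),
     \<Sum>u\<in>Us. \<Phi>3 pXY pZ d (A u) (\<lambda>x. ($) (b u $ x)))"
    by (rule letterF_sum) (use finUs \<mu> ptK in \<open>auto simp: A_def Us_def\<close>)
  finally have sumA: "\<And>y. (\<Sum>u\<in>Us. A u y) = pY pXY y" and c1: "c1 = (\<Sum>u\<in>Us. \<Phi>1 pXY pZ (A u))"
    and c2: "c2 = (\<Sum>u\<in>Us. \<Phi>2 pXY pZ (A u) (\<lambda>x. ($) (b u $ x)))" and c3: "c3 = (\<Sum>u\<in>Us. \<Phi>3 pXY pZ d (A u) (\<lambda>x. ($) (b u $ x)))"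
    by (auto simp: vec_eq_iff)
  have "Us \<noteq> {}" using \<mu>(2) unfolding Us_def by (metis sum.empty zero_neq_one)
  have "\<exists>q. \<forall>i. pmf q i = (if i \<in> Us then A i y / pY pXY y else 0)" if "pY pXY y \<noteq> 0" for y
    using that A0 pY_nonneg[of pXY] sumA[of y] finUs
    by (intro exists_pmf_of_weights[of Us]) (auto simp: sum_divide_distrib[symmetric])
  then obtain q where q: "\<And>y i. pY pXY y \<noteq> 0 \<Longrightarrow> pmf (q y) i = (if i \<in> Us then A i y / pY pXY y else 0)"
    by metis
  obtain u0 where u0: "u0 \<in> Us" using \<open>Us \<noteq> {}\<close> by blast
  \<comment> \<open>Bayes divides by \<open>pY\<close>; at a y of probability 0 any fixed element of
    \<open>Us\<close> will do.\<close>
  define qU where "qU y = (if pY pXY y = 0 then return_pmf u0 else q y)" for y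
  have qU_sub: "set_pmf (qU y) \<subseteq> Us" for y
    using u0 q by (auto simp: qU_def set_pmf_iff split: if_splits)
  have qU: "pY pXY y * pmf (qU y) i = A i y" if "i \<in> Us" for y i
  proof (cases "pY pXY y = 0")
    case True
    then have "(\<Sum>u\<in>Us. A u y) = 0" by (simp add: sumA)
    then have "A i y = 0" using A0 finUs that by (subst (asm) sum_nonneg_eq_0_iff) auto
    then show ?thesis using True by simp
  qed (use q that in \<open>simp add: qU_def\<close>)
  have "\<exists>r. \<forall>w. pmf r w = b i $ x $ w" if "i \<in> Us" for i x
    using nn[OF that] by (intro exists_pmf_of_weights[of UNIV]) auto
  then obtain r where r: "\<And>i x w. i \<in> Us \<Longrightarrow> pmf (r i x) w = b i $ x $ w" by metis
  define K where "K x y = bind_pmf (qU y) (\<lambda>u. map_pmf (Pair u) (r u x))" for x y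
  have pK: "pmf (K x y) (u, w) = pmf (qU y) u * pmf (r u x) w" for x y u w
    unfolding K_def by (rule pmf_bind_map) auto
  have subK: "fst ` set_pmf (K x y) \<subseteq> Us" for x y using subsetD[OF qU_sub] by (auto simp: K_def)
  have kK: "(\<Sum>w\<in>UNIV. pmf (K x y) (u, w)) = pmf (qU y) u" for x y u
    by (simp add: pK sum_distrib_left[symmetric] sum_pmf_eq_1)
  \<comment> \<open>The identities for \<open>kerJ\<close> want the slice formula at every u,
    whereas \<open>A\<close> is known to satisfy it only on \<open>Us\<close>.\<close>
  define A' where "A' u y = pY pXY y * pmf (qU y) u" for u y
  have A': "A' u = A u" if "u \<in> Us" for u using qU[OF that] by (auto simp: A'_def)
  have bK: "(\<Sum>y\<in>UNIV. pmf pXY (x, y) * pmf (K x y) (u, w)) = pXof pXY (A' u) x * b u $ x $ w" if "u \<in> Us" for u x w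
    by (simp add: pK r[OF that] pXof_def A'_def pY_mult_pXgY[symmetric] sum_distrib_left mult_ac)
  let ?G = "kerJ pXY pZ K"
  note e1 = kerJ_\<Phi>1[OF finUs subK kK A'_def nn(3) bK, of pZ]
  note e2 = kerJ_\<Phi>2[OF finUs subK kK A'_def nn(3) bK, of pZ]
  note e3 = kerJ_\<Phi>3[OF finUs subK kK A'_def nn(3) bK, of pZ d]
  have finG: "finite (set_pmf ?G)" by (rule finite_kerJ[OF finUs subK kK A'_def nn(3) bK])
  \<comment> \<open>W is a map from side information to reconstruction. It is coded as a number, and
    \<open>xhat\<close> decodes it and applies it to z.\<close>
  define qW where "qW x u = map_pmf (to_nat :: ('z \<Rightarrow> 'xh) \<Rightarrow> nat) (r u x)" for x u
  define xhat where "xhat u w = (from_nat w :: 'z \<Rightarrow> 'xh)" for u w :: nat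
  define h where "h = (\<lambda>(x::'x, y::'y, z::'z, u::nat, w). (x, y, z, u, to_nat (w :: 'z \<Rightarrow> 'xh)))"
  have J: "joint5 pXY pZ qU qW = map_pmf h ?G"
    by (simp add: joint5_src kerJ_def K_def qW_def h_def pmf_monad)
  have YZ: "map_pmf (\<lambda>\<omega>. (jY \<omega>, jZ \<omega>)) ?G = map_pmf (\<lambda>(x,y,z). (y, z)) (src pXY pZ)"
    "map_pmf jZ ?G = map_pmf (\<lambda>(x,y,z). z) (src pXY pZ)"
    by (simp_all add: kerJ_def pmf_monad)
  have ee: "ent (map_pmf f (map_pmf h ?G)) = ent (map_pmf g ?G)"
    if "\<And>\<omega> \<omega>'. f (h \<omega>) = f (h \<omega>') \<longleftrightarrow> g \<omega> = g \<omega>'" for f :: "_ \<Rightarrow> 'f" and g :: "_ \<Rightarrow> 'g"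
    unfolding map_pmf_comp using that by (intro ent_map_cong finG) auto
  have cmi1: "cmi (joint5 pXY pZ qU qW) jU jY jZ = ent (map_pmf (\<lambda>\<omega>. (jY \<omega>, jZ \<omega>)) ?G) - ent (map_pmf jZ ?G)
      - (ent (map_pmf (\<lambda>\<omega>. (jU \<omega>, jY \<omega>, jZ \<omega>)) ?G) - ent (map_pmf (\<lambda>\<omega>. (jU \<omega>, jZ \<omega>)) ?G))"
  proof -
    have "ent (map_pmf (\<lambda>\<omega>. (jU \<omega>, jZ \<omega>)) (map_pmf h ?G)) = ent (map_pmf (\<lambda>\<omega>. (jU \<omega>, jZ \<omega>)) ?G)"
      "ent (map_pmf (\<lambda>\<omega>. (jY \<omega>, jZ \<omega>)) (map_pmf h ?G)) = ent (map_pmf (\<lambda>\<omega>. (jY \<omega>, jZ \<omega>)) ?G)"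
      "ent (map_pmf (\<lambda>\<omega>. (jU \<omega>, jY \<omega>, jZ \<omega>)) (map_pmf h ?G)) = ent (map_pmf (\<lambda>\<omega>. (jU \<omega>, jY \<omega>, jZ \<omega>)) ?G)"
      "ent (map_pmf jZ (map_pmf h ?G)) = ent (map_pmf jZ ?G)"
      by (rule ee; auto simp: h_def)+
    then show ?thesis unfolding cmi_def J by linarith
  qed
  have cmi2: "cmi (joint5 pXY pZ qU qW) jX jW (\<lambda>\<omega>. (jU \<omega>, jZ \<omega>)) = 
    ent (map_pmf (\<lambda>\<omega>. (jU \<omega>, jX \<omega>, jZ \<omega>)) ?G) + ent (map_pmf (\<lambda>\<omega>. (jU \<omega>, jW \<omega>, jZ \<omega>)) ?G)
    - ent (map_pmf (\<lambda>\<omega>. (jU \<omega>, jX \<omega>, jW \<omega>, jZ \<omega>)) ?G) - ent (map_pmf (\<lambda>\<omega>. (jU \<omega>, jZ \<omega>)) ?G)"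
  proof -
    have "ent (map_pmf (\<lambda>\<omega>. (jX \<omega>, (jU \<omega>, jZ \<omega>))) (map_pmf h ?G)) = ent (map_pmf (\<lambda>\<omega>. (jU \<omega>, jX \<omega>, jZ \<omega>)) ?G)"
      "ent (map_pmf (\<lambda>\<omega>. (jW \<omega>, (jU \<omega>, jZ \<omega>))) (map_pmf h ?G)) = ent (map_pmf (\<lambda>\<omega>. (jU \<omega>, jW \<omega>, jZ \<omega>)) ?G)"
      "ent (map_pmf (\<lambda>\<omega>. (jX \<omega>, jW \<omega>, (jU \<omega>, jZ \<omega>))) (map_pmf h ?G)) = ent (map_pmf (\<lambda>\<omega>. (jU \<omega>, jX \<omega>, jW \<omega>, jZ \<omega>)) ?G)"
      "ent (map_pmf (\<lambda>\<omega>. (jU \<omega>, jZ \<omega>)) (map_pmf h ?G)) = ent (map_pmf (\<lambda>\<omega>. (jU \<omega>, jZ \<omega>)) ?G)"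
      by (rule ee; auto simp: h_def)+
    then show ?thesis unfolding cmi_def J by linarith
  qed
  have ed: "measure_pmf.expectation (joint5 pXY pZ qU qW) (\<lambda>(x,y,z,u,w). d x (xhat u w z)) =
    measure_pmf.expectation ?G (\<lambda>(x, y, z, u, w). d x (w z))"
    unfolding J by (simp add: h_def xhat_def case_prod_unfold)
  have f1: "finite (\<Union>y. set_pmf (qU y))" using finUs qU_sub by (meson UN_least finite_subset)
  have f2: "finite (\<Union>x u. set_pmf (qW x u))"
  proof (rule finite_subset)
    show "(\<Union>x u. set_pmf (qW x u)) \<subseteq> range (to_nat :: ('z \<Rightarrow> 'xh) \<Rightarrow> nat)" by (auto simp: qW_def)
  qed simp
  have s: "(\<Sum>u\<in>Us. \<Phi>1 pXY pZ (A' u)) = c1" "(\<Sum>u\<in>Us. \<Phi>2 pXY pZ (A' u) (\<lambda>x. ($) (b u $ x))) = c2"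
    "(\<Sum>u\<in>Us. \<Phi>3 pXY pZ d (A' u) (\<lambda>x. ($) (b u $ x))) = c3"
    unfolding c1 c2 c3 by (simp_all add: A')
  have "R1 \<ge> cmi (joint5 pXY pZ qU qW) jU jY jZ" using R1 e1 s(1) cmi1 unfolding YZ by linarith
  moreover have "R \<ge> cmi (joint5 pXY pZ qU qW) jX jW (\<lambda>\<omega>. (jU \<omega>, jZ \<omega>))" using R e2 s(2) cmi2 by linarith
  moreover have "measure_pmf.expectation (joint5 pXY pZ qU qW) (\<lambda>(x,y,z,u,w). d x (xhat u w z)) \<le> D"
    using ed e3 s(3) D by linarith
  ultimately show ?thesis
    unfolding RYXZ_def Let_def using f1 f2 by blast
qed

end

section \<open>Converse\<close>

text \<open>The summand is I(T; V i | C i). Since \<open>C (Suc i)\<close> determines both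
  \<open>C i\<close> and \<open>V i\<close>, it is at most H(T | C i) - H(T | C (Suc i)), and these
  differences telescope to at most H(T). Both rate bounds of the converse are instances.\<close>

lemma entropy_chain:
  fixes C :: "nat \<Rightarrow> 'o \<Rightarrow> 'c" and V :: "nat \<Rightarrow> 'o \<Rightarrow> 'v" and T :: "'o \<Rightarrow> 't"
  assumes fin: "finite (set_pmf L)"
    and ref: "\<And>i \<omega> \<omega>'. i < n \<Longrightarrow> \<omega> \<in> set_pmf L \<Longrightarrow> \<omega>' \<in> set_pmf L \<Longrightarrow> C (Suc i) \<omega> = C (Suc i) \<omega>' \<Longrightarrow>
        C i \<omega> = C i \<omega>' \<and> V i \<omega> = V i \<omega>'"
  shows "(\<Sum>i<n. ent (map_pmf (\<lambda>\<omega>. (T \<omega>, C i \<omega>)) L) - ent (map_pmf (C i) L)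
      - ent (map_pmf (\<lambda>\<omega>. (T \<omega>, C i \<omega>, V i \<omega>)) L) + ent (map_pmf (\<lambda>\<omega>. (C i \<omega>, V i \<omega>)) L)) \<le> ent (map_pmf T L)"
proof -
  define G where "G i = ent (map_pmf (\<lambda>\<omega>. (T \<omega>, C i \<omega>)) L) - ent (map_pmf (C i) L)" for i
  have step: "ent (map_pmf (\<lambda>\<omega>. (T \<omega>, C i \<omega>)) L) - ent (map_pmf (C i) L)
      - ent (map_pmf (\<lambda>\<omega>. (T \<omega>, C i \<omega>, V i \<omega>)) L) + ent (map_pmf (\<lambda>\<omega>. (C i \<omega>, V i \<omega>)) L) \<le> G i - G (Suc i)"
    if "i < n" for i
  proof -
    have "0 \<le> cmi L T (C (Suc i)) (\<lambda>\<omega>. (C i \<omega>, V i \<omega>))" by (rule cmi_nonneg[OF fin])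
    moreover have "ent (map_pmf (\<lambda>\<omega>. (C (Suc i) \<omega>, C i \<omega>, V i \<omega>)) L) = ent (map_pmf (C (Suc i)) L)"
      by (rule ent_map_cong[OF fin]) (use ref[OF that] in blast)
    moreover have "ent (map_pmf (\<lambda>\<omega>. (T \<omega>, C (Suc i) \<omega>, C i \<omega>, V i \<omega>)) L) = ent (map_pmf (\<lambda>\<omega>. (T \<omega>, C (Suc i) \<omega>)) L)"
      by (rule ent_map_cong[OF fin]) (use ref[OF that] in blast)
    ultimately show ?thesis by (simp add: cmi_def G_def)
  qed
  have "(\<Sum>i<n. ent (map_pmf (\<lambda>\<omega>. (T \<omega>, C i \<omega>)) L) - ent (map_pmf (C i) L)
      - ent (map_pmf (\<lambda>\<omega>. (T \<omega>, C i \<omega>, V i \<omega>)) L) + ent (map_pmf (\<lambda>\<omega>. (C i \<omega>, V i \<omega>)) L)) \<le> (\<Sum>i<n. G i - G (Suc i))"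
    by (intro sum_mono step) simp
  also have "\<dots> = G 0 - G n" by (simp add: sum_lessThan_telescope')
  finally have le: "(\<Sum>i<n. ent (map_pmf (\<lambda>\<omega>. (T \<omega>, C i \<omega>)) L) - ent (map_pmf (C i) L)
      - ent (map_pmf (\<lambda>\<omega>. (T \<omega>, C i \<omega>, V i \<omega>)) L) + ent (map_pmf (\<lambda>\<omega>. (C i \<omega>, V i \<omega>)) L)) \<le> G 0 - G n" .
  moreover have "G n \<ge> 0"
    using ent_map_mono[OF fin, of "\<lambda>\<omega>. (T \<omega>, C n \<omega>)" "C n"] by (simp add: G_def)
  moreover have "G 0 \<le> ent (map_pmf T L)"
  proof -
    have "0 \<le> cmi L T (C 0) (\<lambda>_. ())" by (rule cmi_nonneg[OF fin])
    moreover have "ent (map_pmf (\<lambda>\<omega>. (T \<omega>, ())) L) = ent (map_pmf T L)"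
      "ent (map_pmf (\<lambda>\<omega>. (C 0 \<omega>, ())) L) = ent (map_pmf (C 0) L)"
      "ent (map_pmf (\<lambda>\<omega>. (T \<omega>, C 0 \<omega>, ())) L) = ent (map_pmf (\<lambda>\<omega>. (T \<omega>, C 0 \<omega>)) L)"
      by (rule ent_map_cong[OF fin]; blast)+
    moreover have "ent (map_pmf (\<lambda>_. ()) L) \<ge> 0" by (intro ent_nonneg) simp
    ultimately show ?thesis by (simp add: cmi_def G_def)
  qed
  ultimately show ?thesis by linarith
qed

lemma iid_split:
  "iid (i + Suc m) P = bind_pmf (iid i P) (\<lambda>pre. bind_pmf P (\<lambda>s. bind_pmf (iid m P) (\<lambda>post. return_pmf (pre @ s # post))))"
proof (induction i)
  case 0
  show ?case by (simp add: bind_return_pmf)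
next
  case (Suc i)
  have "iid (Suc i + Suc m) P = bind_pmf P (\<lambda>a. bind_pmf (iid (i + Suc m) P) (\<lambda>as. return_pmf (a # as)))" by simp
  also have "\<dots> = bind_pmf (iid (Suc i) P) (\<lambda>pre. bind_pmf P (\<lambda>s. bind_pmf (iid m P) (\<lambda>post. return_pmf (pre @ s # post))))"
    unfolding Suc by (simp add: bind_assoc_pmf bind_return_pmf)
  finally show ?case .
qed

text \<open>Drawing letter i first displays its independence from the letters before and after
  it.\<close>

lemma iid_split_pair:
  assumes "i < n"
  shows "iid n P = bind_pmf P (\<lambda>s. map_pmf (\<lambda>(pre, post). pre @ s # post) (pair_pmf (iid i P) (iid (n - Suc i) P)))"
proof -
  have n: "n = i + Suc (n - Suc i)" using assms by simp
  show ?thesis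
    by (subst n, subst iid_split, subst bind_commute_pmf)
      (simp add: pair_pmf_def map_pmf_def bind_assoc_pmf bind_return_pmf)
qed

lemma list_eq_iff_update:
  assumes "length l = n" "length l' = n" "i < n"
  shows "l = l' \<longleftrightarrow> l[i := u] = l'[i := u] \<and> l ! i = l' ! i"
  using assms by (metis list_update_id list_update_overwrite)

section \<open>Single-letter variables of a block code\<close>

locale helper_code =
  fixes pXY :: "('x::finite \<times> 'y::finite) pmf" and pZ :: "'x \<Rightarrow> 'z::finite pmf"
    and d :: "'x \<Rightarrow> 'xh::finite \<Rightarrow> real"
    and n M Me Md :: nat
    and fe fd :: "'y list \<Rightarrow> nat" and f :: "'x list \<Rightarrow> nat \<Rightarrow> nat" and g :: "nat \<Rightarrow> nat \<Rightarrow> 'z list \<Rightarrow> 'xh list"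
  assumes n: "n > 0"
    and fe: "\<And>ys. length ys = n \<Longrightarrow> fe ys \<in> {1..Me}"
    and fd: "\<And>ys. length ys = n \<Longrightarrow> fd ys \<in> {1..Md}"
    and f: "\<And>xs m. length xs = n \<Longrightarrow> m \<in> {1..Me} \<Longrightarrow> f xs m \<in> {1..M}"
begin

abbreviation "P \<equiv> src pXY pZ"
abbreviation "L \<equiv> iid n P"

definition xs :: "('x \<times> 'y \<times> 'z) list \<Rightarrow> 'x list" where "xs t = map fst t"
definition ys :: "('x \<times> 'y \<times> 'z) list \<Rightarrow> 'y list" where "ys t = map (fst \<circ> snd) t"
definition zs :: "('x \<times> 'y \<times> 'z) list \<Rightarrow> 'z list" where "zs t = map (snd \<circ> snd) t"
definition ss :: "('x \<times> 'y \<times> 'z) list \<Rightarrow> ('x \<times> 'y) list" where "ss t = map (\<lambda>(x, y, z). (x, y)) t"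
definition Td :: "('x \<times> 'y \<times> 'z) list \<Rightarrow> nat" where "Td t = fd (ys t)"
definition Tx :: "('x \<times> 'y \<times> 'z) list \<Rightarrow> nat" where "Tx t = f (xs t) (fe (ys t))"
definition Xi :: "nat \<Rightarrow> ('x \<times> 'y \<times> 'z) list \<Rightarrow> 'x" where "Xi i t = xs t ! i"
definition Yi :: "nat \<Rightarrow> ('x \<times> 'y \<times> 'z) list \<Rightarrow> 'y" where "Yi i t = ys t ! i"
definition Zi :: "nat \<Rightarrow> ('x \<times> 'y \<times> 'z) list \<Rightarrow> 'z" where "Zi i t = zs t ! i"
text \<open>Overwriting position \<open>i\<close> by \<open>undefined\<close> forgets \<open>Z i\<close> and keeps the other indices in place.\<close>
definition rest :: "nat \<Rightarrow> ('x \<times> 'y \<times> 'z) list \<Rightarrow> ('x \<times> 'y) list \<times> 'z list" where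
  "rest i t = (take i (ss t), (zs t)[i := undefined])"
definition Ui :: "nat \<Rightarrow> ('x \<times> 'y \<times> 'z) list \<Rightarrow> nat \<times> ('x \<times> 'y) list \<times> 'z list" where
  "Ui i t = (Td t, rest i t)"
definition Wi :: "nat \<Rightarrow> ('x \<times> 'y \<times> 'z) list \<Rightarrow> 'z \<Rightarrow> 'xh" where
  "Wi i t = (\<lambda>z. g (Tx t) (Td t) ((zs t)[i := z]) ! i)"
text \<open>Carries the information of \<open>rest i\<close> together with \<open>Zi i\<close>, but
  grows with i, as the chain rule demands.\<close>

definition Ci :: "nat \<Rightarrow> ('x \<times> 'y \<times> 'z) list \<Rightarrow> 'z list \<times> ('x \<times> 'y) list" where
  "Ci i t = (zs t, take i (ss t))"

lemmas seq_defs = xs_def ys_def zs_def ss_def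

lemma finite_L: "finite (set_pmf L)" by (intro finite_set_pmf_iid) simp

lemma L_length: "t \<in> set_pmf L \<Longrightarrow> length t = n" by (simp add: set_pmf_iid)

lemma length_seq [simp]: "length (xs t) = length t" "length (ys t) = length t" "length (zs t) = length t" "length (ss t) = length t"
  by (simp_all add: seq_defs)

lemma Ci_eq_iff:
  assumes "t \<in> set_pmf L" "t' \<in> set_pmf L" "i < n"
  shows "Ci i t = Ci i t' \<longleftrightarrow> rest i t = rest i t' \<and> Zi i t = Zi i t'"
  using list_eq_iff_update[of "zs t" n "zs t'" i undefined] assms L_length
  by (auto simp: Ci_def rest_def Zi_def)

lemma Ci_Suc:
  assumes "t \<in> set_pmf L" "t' \<in> set_pmf L" "i < n" "Ci (Suc i) t = Ci (Suc i) t'"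
  shows "Ci i t = Ci i t' \<and> Xi i t = Xi i t' \<and> Yi i t = Yi i t'"
proof -
  have l: "length t = n" "length t' = n" using assms L_length by auto
  have e: "take (Suc i) (ss t) = take (Suc i) (ss t')" "zs t = zs t'" using assms by (auto simp: Ci_def)
  then have "take i (ss t) = take i (ss t')" "ss t ! i = ss t' ! i"
    using l assms(3) by (auto simp: take_Suc_conv_app_nth)
  then show ?thesis using e l assms(3)
    by (auto simp: Ci_def Xi_def Yi_def seq_defs case_prod_unfold)
qed

lemma L_split:
  fixes q :: "_ \<Rightarrow> 'q"
  assumes i: "i < n"
    and q: "\<And>pre s post. length pre = i \<Longrightarrow> length post = n - Suc i \<Longrightarrow> q (pre @ s # post) = q' s pre post"
  shows "map_pmf q L = bind_pmf P (\<lambda>s. map_pmf (\<lambda>(pre, post). q' s pre post) (pair_pmf (iid i P) (iid (n - Suc i) P)))"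
  unfolding iid_split_pair[OF i] map_bind_pmf map_pmf_comp
  by (intro bind_pmf_cong refl map_pmf_cong) (auto simp: set_pmf_iid q)

text \<open>The law of (U i, W i) given the i-th letters of X and Y. Neither variable reads Z at
  position i, so \<open>undefined\<close> may stand there.\<close>

definition Ki :: "nat \<Rightarrow> 'x \<Rightarrow> 'y \<Rightarrow> ((nat \<times> ('x \<times> 'y) list \<times> 'z list) \<times> ('z \<Rightarrow> 'xh)) pmf" where
  "Ki i x y = map_pmf (\<lambda>(pre, post). (Ui i (pre @ (x, y, undefined) # post), Wi i (pre @ (x, y, undefined) # post)))
     (pair_pmf (iid i P) (iid (n - Suc i) P))"

lemma kerJ_Ki:
  assumes i: "i < n"
  shows "map_pmf (\<lambda>t. (Xi i t, Yi i t, Zi i t, Ui i t, Wi i t)) L = kerJ pXY pZ (Ki i)"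
proof -
  have "map_pmf (\<lambda>t. (Xi i t, Yi i t, Zi i t, Ui i t, Wi i t)) L =
    bind_pmf P (\<lambda>s. map_pmf (\<lambda>(pre, post). (fst s, fst (snd s), snd (snd s),
      Ui i (pre @ (fst s, fst (snd s), undefined) # post), Wi i (pre @ (fst s, fst (snd s), undefined) # post)))
      (pair_pmf (iid i P) (iid (n - Suc i) P)))"
    by (rule L_split[OF i])
      (auto simp: Xi_def Yi_def Zi_def Ui_def Wi_def rest_def Td_def Tx_def seq_defs list_update_append nth_append case_prod_unfold)
  then show ?thesis by (simp add: kerJ_def Ki_def map_pmf_comp case_prod_unfold)
qed

text \<open>\<open>Ui\<close> reads the X-letters only before position i, and \<open>Td\<close> is a
  function of Y^n. Hence x may be replaced by \<open>undefined\<close>, which is the Markov chain U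
  - Y - X.\<close>

lemma Ki_marginal:
  assumes i: "i < n"
  shows "(\<Sum>w\<in>UNIV. pmf (Ki i x y) (u, w)) =
    pmf (map_pmf (\<lambda>(pre, post). Ui i (pre @ (undefined, y, undefined) # post)) (pair_pmf (iid i P) (iid (n - Suc i) P))) u"
proof -
  have "(\<Sum>w\<in>UNIV. pmf (Ki i x y) (u, w)) = pmf (map_pmf fst (Ki i x y)) u"
    by (rule pmf_map_fiber[symmetric]) (auto simp: inj_on_def)
  also have "map_pmf fst (Ki i x y) = map_pmf (\<lambda>(pre, post). Ui i (pre @ (undefined, y, undefined) # post)) (pair_pmf (iid i P) (iid (n - Suc i) P))"
    unfolding Ki_def map_pmf_comp
    by (intro map_pmf_cong refl)
      (auto simp: set_pmf_iid Ui_def rest_def Td_def seq_defs case_prod_unfold)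
  finally show ?thesis .
qed

text \<open>H(Y i | U i, Z i), a conditional entropy and not an information: it is subtracted from
  H(Y|Z), which is the same for all i.\<close>

definition c1 :: "nat \<Rightarrow> real" where
  "c1 i = ent (map_pmf (\<lambda>t. (Ui i t, Yi i t, Zi i t)) L) - ent (map_pmf (\<lambda>t. (Ui i t, Zi i t)) L)"
definition c2 :: "nat \<Rightarrow> real" where
  "c2 i = ent (map_pmf (\<lambda>t. (Ui i t, Xi i t, Zi i t)) L) + ent (map_pmf (\<lambda>t. (Ui i t, Wi i t, Zi i t)) L)
    - ent (map_pmf (\<lambda>t. (Ui i t, Xi i t, Wi i t, Zi i t)) L) - ent (map_pmf (\<lambda>t. (Ui i t, Zi i t)) L)"
definition c3 :: "nat \<Rightarrow> real" where
  "c3 i = measure_pmf.expectation L (\<lambda>t. d (Xi i t) (Wi i t (Zi i t)))"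

lemma point_in_hull:
  assumes i: "i < n"
  shows "(\<chi> y. pY pXY y, c1 i, c2 i, c3 i) \<in> letter_hull pXY pZ d"
proof -
  have fin: "finite (\<Union>x y. fst ` set_pmf (Ki i x y))"
    by (auto simp: Ki_def intro!: finite_imageI finite_set_pmf_iid finite_cartesian_product)
  have "fst ` set_pmf (Ki i x y) \<subseteq> (\<Union>x y. fst ` set_pmf (Ki i x y))" for x y by blast
  from kerJ_point_in_hull[where K = "Ki i" and pXY = pXY and pZ = pZ and d = d, OF fin this Ki_marginal[OF i]]
  show ?thesis
    unfolding kerJ_Ki[OF i, symmetric] map_pmf_comp integral_map_pmf c1_def c2_def c3_def by simp
qed

text \<open>\<open>rest i\<close> is made of letters other than the i-th and is therefore
  independent of it. Its entropy cancels, leaving H(Y|Z).\<close>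

lemma ent_indep:
  assumes i: "i < n"
  shows "ent (map_pmf (\<lambda>t. (Ci i t, Yi i t)) L) - ent (map_pmf (Ci i) L) =
    ent (map_pmf (\<lambda>(x,y,z). (y, z)) P) - ent (map_pmf (\<lambda>(x,y,z). z) P)"
proof -
  define Q where "Q = map_pmf (\<lambda>(pre, post). rest i (pre @ undefined # post)) (pair_pmf (iid i P) (iid (n - Suc i) P))"
  have finQ: "finite (set_pmf Q)" by (auto simp: Q_def intro!: finite_imageI finite_cartesian_product finite_set_pmf_iid)
  have pair: "map_pmf (\<lambda>t. (rest i t, h (Xi i t, Yi i t, Zi i t))) L = pair_pmf Q (map_pmf h P)" for h :: "_ \<Rightarrow> 'h"
  proof -
    have "map_pmf (\<lambda>t. (rest i t, h (Xi i t, Yi i t, Zi i t))) L =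
      bind_pmf P (\<lambda>s. map_pmf (\<lambda>(pre, post). (rest i (pre @ undefined # post), h s)) (pair_pmf (iid i P) (iid (n - Suc i) P)))"
      by (rule L_split[OF i])
        (auto simp: Xi_def Yi_def Zi_def rest_def seq_defs list_update_append nth_append)
    also have "\<dots> = bind_pmf P (\<lambda>s. bind_pmf Q (\<lambda>r. return_pmf (r, h s)))"
      by (simp add: Q_def pmf_monad)
    also have "\<dots> = bind_pmf Q (\<lambda>r. bind_pmf P (\<lambda>s. return_pmf (r, h s)))" by (rule bind_commute_pmf)
    also have "\<dots> = pair_pmf Q (map_pmf h P)" by (simp add: pair_pmf_def pmf_monad)
    finally show ?thesis .
  qed
  have "ent (map_pmf (\<lambda>t. (Ci i t, Yi i t)) L) = ent (map_pmf (\<lambda>t. (rest i t, (Yi i t, Zi i t))) L)"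
    by (rule ent_map_cong[OF finite_L]) (use Ci_eq_iff i in auto)
  also have "\<dots> = ent Q + ent (map_pmf (\<lambda>(x,y,z). (y, z)) P)"
    using pair[of "\<lambda>(x,y,z). (y, z)"] finQ by (simp add: ent_pair_pmf)
  finally have 1: "ent (map_pmf (\<lambda>t. (Ci i t, Yi i t)) L) = ent Q + ent (map_pmf (\<lambda>(x,y,z). (y, z)) P)" .
  have "ent (map_pmf (Ci i) L) = ent (map_pmf (\<lambda>t. (rest i t, Zi i t)) L)"
    by (rule ent_map_cong[OF finite_L]) (use Ci_eq_iff i in auto)
  also have "\<dots> = ent Q + ent (map_pmf (\<lambda>(x,y,z). z) P)"
    using pair[of "\<lambda>(x,y,z). z"] finQ by (simp add: ent_pair_pmf)
  finally show ?thesis using 1 by simp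
qed

text \<open>H(Y|Z) - H(Y i | U i, Z i) equals I(Td; Y i | C i), and the chain rule bounds the sum by
  the entropy of the helper's message.\<close>

lemma sum_c1: "n * (ent (map_pmf (\<lambda>(x,y,z). (y, z)) P) - ent (map_pmf (\<lambda>(x,y,z). z) P)) - (\<Sum>i<n. c1 i) \<le> log 2 Md"
proof -
  let ?h = "ent (map_pmf (\<lambda>(x,y,z). (y, z)) P) - ent (map_pmf (\<lambda>(x,y,z). z) P)"
  have "n * ?h - (\<Sum>i<n. c1 i) = (\<Sum>i<n. ?h - c1 i)" by (simp add: sum_subtractf)
  also have "\<dots> = (\<Sum>i<n. ent (map_pmf (\<lambda>t. (Td t, Ci i t)) L) - ent (map_pmf (Ci i) L)
      - ent (map_pmf (\<lambda>t. (Td t, Ci i t, Yi i t)) L) + ent (map_pmf (\<lambda>t. (Ci i t, Yi i t)) L))"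
  proof (intro sum.cong refl)
    fix i assume "i \<in> {..<n}"
    then have i: "i < n" by simp
    have "ent (map_pmf (\<lambda>t. (Td t, Ci i t)) L) = ent (map_pmf (\<lambda>t. (Ui i t, Zi i t)) L)"
      "ent (map_pmf (\<lambda>t. (Td t, Ci i t, Yi i t)) L) = ent (map_pmf (\<lambda>t. (Ui i t, Yi i t, Zi i t)) L)"
      by (rule ent_map_cong[OF finite_L]; use Ci_eq_iff i in \<open>auto simp: Ui_def\<close>)+
    then show "?h - c1 i = ent (map_pmf (\<lambda>t. (Td t, Ci i t)) L) - ent (map_pmf (Ci i) L)
      - ent (map_pmf (\<lambda>t. (Td t, Ci i t, Yi i t)) L) + ent (map_pmf (\<lambda>t. (Ci i t, Yi i t)) L)"
      using ent_indep[OF i] by (simp add: c1_def)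
  qed
  also have "\<dots> \<le> ent (map_pmf Td L)"
    by (rule entropy_chain[OF finite_L]) (use Ci_Suc in blast)
  also have "\<dots> \<le> log 2 (card {1..Md})"
  proof (rule ent_le_log_card)
    show "set_pmf (map_pmf Td L) \<subseteq> {1..Md}" using fd L_length by (auto simp: Td_def)
  qed simp
  finally show ?thesis by simp
qed

text \<open>\<open>Wi\<close> is a function of \<open>Tx\<close> and \<open>Ui\<close>, so I(X i; W
  i | U i, Z i) is at most I(X i; Tx | U i, Z i). The chain rule with (Td, C i) as growing condition
  then bounds the sum by the entropy of \<open>Tx\<close>. This allows \<open>Tx\<close> to depend
  on all of Y^n through \<open>fe\<close>.\<close>

lemma sum_c2: "(\<Sum>i<n. c2 i) \<le> log 2 M"
proof -
  have "(\<Sum>i<n. c2 i) \<le> (\<Sum>i<n. ent (map_pmf (\<lambda>t. (Tx t, (Td t, Ci i t))) L) - ent (map_pmf (\<lambda>t. (Td t, Ci i t)) L)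
      - ent (map_pmf (\<lambda>t. (Tx t, (Td t, Ci i t), Xi i t)) L) + ent (map_pmf (\<lambda>t. ((Td t, Ci i t), Xi i t)) L))"
  proof (intro sum_mono)
    fix i assume "i \<in> {..<n}"
    then have i: "i < n" by simp
    \<comment> \<open>Overwriting position i erases whatever stood there, so agreement of the
      blanked sequences suffices for every inserted z.\<close>
    have W: "Wi i t = Wi i t'" if "Tx t = Tx t'" "Ui i t = Ui i t'" for t t'
    proof -
      have "(zs t)[i := z] = (zs t')[i := z]" for z
      proof -
        have "(zs t)[i := undefined] = (zs t')[i := undefined]" using that by (simp add: Ui_def rest_def)
        then have "(zs t)[i := undefined, i := z] = (zs t')[i := undefined, i := z]" by simp
        then show ?thesis by simp
      qed
      then show ?thesis using that by (simp add: Wi_def Ui_def)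
    qed
    have UT: "Ui i t = Ui i t' \<longleftrightarrow> Td t = Td t' \<and> rest i t = rest i t'" for t t' by (simp add: Ui_def)
    have e: "ent (map_pmf (\<lambda>t. (Tx t, (Td t, Ci i t))) L) = ent (map_pmf (\<lambda>t. (Tx t, (Ui i t, Wi i t, Zi i t))) L)"
      "ent (map_pmf (\<lambda>t. (Td t, Ci i t)) L) = ent (map_pmf (\<lambda>t. (Ui i t, Zi i t)) L)"
      "ent (map_pmf (\<lambda>t. (Tx t, (Td t, Ci i t), Xi i t)) L) = ent (map_pmf (\<lambda>t. (Xi i t, Tx t, (Ui i t, Wi i t, Zi i t))) L)"
      "ent (map_pmf (\<lambda>t. ((Td t, Ci i t), Xi i t)) L) = ent (map_pmf (\<lambda>t. (Ui i t, Xi i t, Zi i t)) L)"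
      "ent (map_pmf (\<lambda>t. (Ui i t, Xi i t, Wi i t, Zi i t)) L) = ent (map_pmf (\<lambda>t. (Xi i t, (Ui i t, Wi i t, Zi i t))) L)"
      by (rule ent_map_cong[OF finite_L]; use Ci_eq_iff[OF _ _ i] UT W in blast)+
    have "0 \<le> cmi L (Xi i) Tx (\<lambda>t. (Ui i t, Wi i t, Zi i t))" by (rule cmi_nonneg[OF finite_L])
    then show "c2 i \<le> ent (map_pmf (\<lambda>t. (Tx t, (Td t, Ci i t))) L) - ent (map_pmf (\<lambda>t. (Td t, Ci i t)) L)
      - ent (map_pmf (\<lambda>t. (Tx t, (Td t, Ci i t), Xi i t)) L) + ent (map_pmf (\<lambda>t. ((Td t, Ci i t), Xi i t)) L)"
      unfolding cmi_def c2_def e by linarith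
  qed
  also have "\<dots> \<le> ent (map_pmf Tx L)"
    by (rule entropy_chain[OF finite_L]) (use Ci_Suc in blast)
  also have "\<dots> \<le> log 2 (card {1..M})"
  proof (rule ent_le_log_card)
    show "set_pmf (map_pmf Tx L) \<subseteq> {1..M}" using f fe L_length by (auto simp: Tx_def)
  qed simp
  finally show ?thesis by simp
qed

text \<open>Inserting the true Z i at position i restores the received sequence, so W i at Z i is
  the actual i-th reconstruction.\<close>

lemma sum_c3: "(\<Sum>i<n. c3 i) / n = measure_pmf.expectation L
        (\<lambda>t. let xs = map fst t; ys = map (fst \<circ> snd) t; zs = map (snd \<circ> snd) t;
                 xh = g (f xs (fe ys)) (fd ys) zs
             in (1 / real n) * (\<Sum>i<n. d (xs ! i) (xh ! i)))"
proof -
  have "(\<Sum>i<n. c3 i) / n = measure_pmf.expectation L (\<lambda>t. (1 / real n) * (\<Sum>i<n. d (Xi i t) (Wi i t (Zi i t))))"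
    unfolding c3_def using integrable_finite_pmf[OF finite_L] by simp
  also have "\<dots> = measure_pmf.expectation L
        (\<lambda>t. let xs = map fst t; ys = map (fst \<circ> snd) t; zs = map (snd \<circ> snd) t;
                 xh = g (f xs (fe ys)) (fd ys) zs
             in (1 / real n) * (\<Sum>i<n. d (xs ! i) (xh ! i)))"
    by (simp add: Let_def Wi_def Zi_def Xi_def Tx_def Td_def seq_defs)
  finally show ?thesis .
qed

text \<open>Convexity of the hull takes the place of a time-sharing variable.\<close>

lemma average_in_hull:
  "(\<chi> y. pY pXY y, (\<Sum>i<n. c1 i) / n, (\<Sum>i<n. c2 i) / n, (\<Sum>i<n. c3 i) / n) \<in> letter_hull pXY pZ d"
proof -
  have "(\<Sum>i<n. (1 / real n) *\<^sub>R (\<chi> y. pY pXY y, c1 i, c2 i, c3 i)) \<in> letter_hull pXY pZ d"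
    using n point_in_hull by (intro convex_sum[OF _ convex_convex_hull]) auto
  also have "(\<Sum>i<n. (1 / real n) *\<^sub>R (\<chi> y. pY pXY y, c1 i, c2 i, c3 i)) =
    (\<chi> y. pY pXY y, (\<Sum>i<n. c1 i) / n, (\<Sum>i<n. c2 i) / n, (\<Sum>i<n. c3 i) / n)"
    using n by (simp add: prod_eq_iff fst_sum snd_sum sum_constant_scaleR sum_divide_distrib del: sum_constant)
  finally show ?thesis .
qed

end

lemma code_imp_hull:
  fixes pXY :: "('x::finite \<times> 'y::finite) pmf" and pZ :: "'x \<Rightarrow> 'z::finite pmf"
    and d :: "'x \<Rightarrow> 'xh::finite \<Rightarrow> real"
  assumes n: "n > 0" and code: "is_code pXY pZ d n M Me Md D"
    and M: "real M \<le> 2 powr (real n * R)" and Md: "real Md \<le> 2 powr (real n * R1)"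
  shows "\<exists>c1 c2 c3. (\<chi> y. pY pXY y, c1, c2, c3) \<in> letter_hull pXY pZ d \<and>
    ent (map_pmf (\<lambda>(x,y,z). (y, z)) (src pXY pZ)) - ent (map_pmf (\<lambda>(x,y,z). z) (src pXY pZ)) - c1 \<le> R1 \<and> c2 \<le> R \<and> c3 \<le> D"
proof -
  from code obtain fe fd f and g :: "nat \<Rightarrow> nat \<Rightarrow> 'z list \<Rightarrow> 'xh list" where c:
    "\<forall>ys. length ys = n \<longrightarrow> fe ys \<in> {1..Me}"
    "\<forall>ys. length ys = n \<longrightarrow> fd ys \<in> {1..Md}"
    "\<forall>xs m. length xs = n \<longrightarrow> m \<in> {1..Me} \<longrightarrow> f xs m \<in> {1..M}"
    "measure_pmf.expectation (iid n (src pXY pZ))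
        (\<lambda>t. let xs = map fst t; ys = map (fst \<circ> snd) t; zs = map (snd \<circ> snd) t;
                 xh = g (f xs (fe ys)) (fd ys) zs
             in (1 / real n) * (\<Sum>i<n. d (xs ! i) (xh ! i))) \<le> D"
    unfolding is_code_def by blast
  interpret helper_code pXY pZ d n M Me Md fe fd f g
    by standard (use n c in auto)
  have pos: "Md > 0" "M > 0"
    using c(1)[rule_format, of "replicate n undefined"] c(2)[rule_format, of "replicate n undefined"]
      c(3)[rule_format, of "replicate n undefined"] by fastforce+
  have lg: "log 2 m \<le> n * r" if "m > 0" "real m \<le> 2 powr (real n * r)" for m :: nat and r :: real
    using that by (simp add: log_le_iff)
  have "ent (map_pmf (\<lambda>(x,y,z). (y, z)) P) - ent (map_pmf (\<lambda>(x,y,z). z) P) - (\<Sum>i<n. c1 i) / n \<le> R1"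
    using sum_c1 lg[OF pos(1) Md] n by (simp add: field_simps)
  moreover have "(\<Sum>i<n. c2 i) / n \<le> R"
    using sum_c2 lg[OF pos(2) M] n by (simp add: field_simps)
  moreover have "(\<Sum>i<n. c3 i) / n \<le> D" using sum_c3 c(4) by simp
  ultimately show ?thesis using average_in_hull by blast
qed

theorem theorem5:
  fixes pXY :: "('x::finite \<times> 'y::finite) pmf"
    and pZ :: "'x \<Rightarrow> 'z::finite pmf"
    and d :: "'x \<Rightarrow> 'xh::finite \<Rightarrow> real"
    and R_e R_d D :: real
  assumes "\<forall>a b. d a b \<ge> 0"
    and "R_e \<ge> R_d" and "R_d \<ge> 0"
  shows "RgO pXY pZ d R_e R_d D = Rreg pXY pZ d R_d D"
proof (intro set_eqI iffI)
  fix R assume "R \<in> Rreg pXY pZ d R_d D"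
  then obtain qU qW xhat where "finite (\<Union>y. set_pmf (qU y))" "finite (\<Union>x u. set_pmf (qW x u))"
    "R_d \<ge> cmi (joint5 pXY pZ qU qW) jU jY jZ" "R \<ge> cmi (joint5 pXY pZ qU qW) jX jW (\<lambda>\<omega>. (jU \<omega>, jZ \<omega>))"
    "measure_pmf.expectation (joint5 pXY pZ qU qW) (\<lambda>(x,y,z,u,w). d x (xhat u w z)) \<le> D"
    unfolding Rreg_def RYXZ_def Let_def by auto
  then have "achievable pXY pZ d D R R_e R_d"
    using assms by (intro achievable_joint5) auto
  then show "R \<in> RgO pXY pZ d R_e R_d D"
    unfolding RgO_def RgO_D_def using closure_subset by fastforce
next
  fix R assume "R \<in> RgO pXY pZ d R_e R_d D"
  then have cl: "(R, R_e, R_d) \<in> closure {(R, R_e, R_d). achievable pXY pZ d D R R_e R_d}"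
    by (simp add: RgO_def RgO_D_def)
  let ?h = "ent (map_pmf (\<lambda>(x,y,z). (y, z)) (src pXY pZ)) - ent (map_pmf (\<lambda>(x,y,z). z) (src pXY pZ))"
  \<comment> \<open>One half of \<delta> pays for approximating the triple by an achievable one, the
    other half is the slack of its code.\<close>
  have pt: "\<exists>c. c \<in> letter_hull pXY pZ d \<and> fst c = (\<chi> y. pY pXY y) \<and> ?h - fst (snd c) \<le> R_d + \<delta> \<and>
      fst (snd (snd c)) \<le> R + \<delta> \<and> snd (snd (snd c)) \<le> D + \<delta>" if \<delta>: "\<delta> > 0" for \<delta>
  proof -
    obtain R' R_e' R_d' where ach: "achievable pXY pZ d D R' R_e' R_d'"
      and near: "dist (R', R_e', R_d') (R, R_e, R_d) < \<delta> / 2"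
      using cl \<delta> unfolding closure_approachable by (metis (mono_tags, lifting) case_prodE half_gt_zero mem_Collect_eq)
    have "dist R' R < \<delta> / 2" "dist R_d' R_d < \<delta> / 2"
      using near dist_fst_le[of "(R', R_e', R_d')" "(R, R_e, R_d)"] dist_snd_le[of "(R', R_e', R_d')" "(R, R_e, R_d)"]
        dist_snd_le[of "(R_e', R_d')" "(R_e, R_d)"] by auto
    then have le: "R' + \<delta> / 2 \<le> R + \<delta>" "R_d' + \<delta> / 2 \<le> R_d + \<delta>" 
      unfolding dist_real_def by linarith+
    obtain N where "\<And>n. n \<ge> N \<Longrightarrow> n > 0 \<and>
       (\<exists>M Me Md. real M \<le> 2 powr (real n * (R' + \<delta> / 2)) \<and> real Me \<le> 2 powr (real n * (R_e' + \<delta> / 2)) \<and>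
                  real Md \<le> 2 powr (real n * (R_d' + \<delta> / 2)) \<and> is_code pXY pZ d n M Me Md (D + \<delta> / 2))"
      using ach \<delta> unfolding achievable_def by (meson half_gt_zero)
    from this[of N] obtain M Me Md where "N > 0" "real M \<le> 2 powr (real N * (R' + \<delta> / 2))"
      "real Md \<le> 2 powr (real N * (R_d' + \<delta> / 2))" "is_code pXY pZ d N M Me Md (D + \<delta> / 2)" by auto
    then obtain c1 c2 c3 where "(\<chi> y. pY pXY y, c1, c2, c3) \<in> letter_hull pXY pZ d"
      "?h - c1 \<le> R_d' + \<delta> / 2" "c2 \<le> R' + \<delta> / 2" "c3 \<le> D + \<delta> / 2"
      using code_imp_hull by metis
    then show ?thesis using le \<delta> by (intro exI[of _ "(\<chi> y. pY pXY y, c1, c2, c3)"]) auto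
  qed
  define \<delta> where "\<delta> m = 1 / real (Suc m)" for m
  have "\<delta> m > 0" for m by (simp add: \<delta>_def)
  then have "\<forall>m. \<exists>c. c \<in> letter_hull pXY pZ d \<and> fst c = (\<chi> y. pY pXY y) \<and> ?h - fst (snd c) \<le> R_d + \<delta> m \<and>
      fst (snd (snd c)) \<le> R + \<delta> m \<and> snd (snd (snd c)) \<le> D + \<delta> m"
    using pt by blast
  from choice[OF this] obtain c where c: "\<And>m. c m \<in> letter_hull pXY pZ d" "\<And>m. fst (c m) = (\<chi> y. pY pXY y)"
    "\<And>m. ?h - fst (snd (c m)) \<le> R_d + \<delta> m" "\<And>m. fst (snd (snd (c m))) \<le> R + \<delta> m"
    "\<And>m. snd (snd (snd (c m))) \<le> D + \<delta> m"
    by blast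
  \<comment> \<open>The hull does not depend on the block length, so hull points with vanishing
    slack accumulate at a hull point with none.\<close>
  obtain l r where l: "l \<in> letter_hull pXY pZ d" "strict_mono r" "(c \<circ> r) \<longlonglongrightarrow> l"
    using compact_hull[of pXY pZ d] c(1) unfolding compact_def by metis
  have \<delta>0: "(\<lambda>m. \<delta> (r m)) \<longlonglongrightarrow> 0"
    using LIMSEQ_subseq_LIMSEQ[OF LIMSEQ_inverse_real_of_nat l(2)] by (simp add: \<delta>_def comp_def inverse_eq_divide)
  have lim: "(\<lambda>m. c (r m)) \<longlonglongrightarrow> l" using l(3) by (simp add: comp_def)
  have "(\<lambda>m. fst (c (r m))) \<longlonglongrightarrow> fst l" by (intro tendsto_intros lim)
  then have "fst l = (\<chi> y. pY pXY y)" unfolding c(2) by (simp add: LIMSEQ_const_iff)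
  moreover have "?h - fst (snd l) \<le> R_d + 0"
    by (rule LIMSEQ_le[OF tendsto_diff[OF tendsto_const tendsto_fst[OF tendsto_snd[OF lim]]] tendsto_add[OF tendsto_const \<delta>0]])
      (use c(3) in auto)
  moreover have "fst (snd (snd l)) \<le> R + 0"
    by (rule LIMSEQ_le[OF tendsto_fst[OF tendsto_snd[OF tendsto_snd[OF lim]]] tendsto_add[OF tendsto_const \<delta>0]])
      (use c(4) in auto)
  moreover have "snd (snd (snd l)) \<le> D + 0"
    by (rule LIMSEQ_le[OF tendsto_snd[OF tendsto_snd[OF tendsto_snd[OF lim]]] tendsto_add[OF tendsto_const \<delta>0]])
      (use c(5) in auto)
  moreover from calculation(1)
  have "(\<chi> y. pY pXY y, fst (snd l), fst (snd (snd l)), snd (snd (snd l))) \<in> letter_hull pXY pZ d"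
    using l(1) by (metis prod.collapse)
  ultimately have "(R, R_d) \<in> RYXZ pXY pZ d D"
    by (intro hull_imp_RYXZ) simp_all
  then show "R \<in> Rreg pXY pZ d R_d D" by (simp add: Rreg_def)
qed

end
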